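(* Let $\Omega\subset\mathbb{R}^N$ be a smooth bounded domain, let $A_n=T_n$ be the union of the $\frac1n$-periodic holes contained in $\Omega$ and $B_n=\Omega\setminus A_n$ (see context), let $X\in(0,1)$ be the constant weak-$*$ limit of $\chi_{A_n}$ in $L^\infty(\Omega)$, and let $f_n,f\in L^2(\Omega)$ with $\int_\Omega f_n\,dx=0$ for all $n$ and $f_n\to f$ strongly in $L^2(\Omega)$. Let $(u_n,v_n)\in W_n$ be the family of weak solutions of the coupled local/nonlocal problem with source $f_n$ (see context). Then there is a pair $(u,v)\in L^2(\Omega)\times L^2(\Omega)$ such that, as $n\to\infty$, $$\chi_{A_n}u_n\rightharpoonup u\quad\text{and}\quad \chi_{B_n}v_n\rightharpoonup v\quad\text{weakly in }L^2(\Omega),$$ where $\chi_{A_n}u_n$ and $\chi_{B_n}v_n$ are the extensions by zero to $\Omega$. The limit pair satisfies $$\int_\Omega u(x)\,dx+\int_\Omega v(x)\,dx=0,$$ and $(u,v)$ is uniquely characterized (among pairs in $L^2(\Omega)\times L^2(\Omega)$ satisfying this zero-mean condition) as the solution of the homogenized system, for a.e. $x\in\Omega$, $$f(x)X=\int_\Omega J(x-y)\big(Xv(y)-(1-X)u(x)\big)\,dy,$$ $$f(x)(1-X)=\int_\Omega G(x-y)\big((1-X)v(y)-(1-X)v(x)\big)\,dy+\int_\Omega J(x-y)\big((1-X)u(y)-Xv(x)\big)\,dy.$$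
   Context: Kernels. $N\ge2$. Each $K\in\{J,G\}$ is a continuous, nonnegative, radial, compactly supported function $K:\mathbb{R}^N\to\mathbb{R}$ with $K(0)>0$ and $\int_{\mathbb{R}^N}K(z)\,dz=1$. Moreover $B_R(0)\subset\operatorname{supp}J$ for some $R>\operatorname{diam}(\Omega)$. Holes. $Y=(0,\ell_1)\times\cdots\times(0,\ell_N)$ is a reference cell, $T\subset Y$ is a (nonempty) open set with smooth boundary and $\overline T\subset Y$. For $k\in\mathbb{Z}^N$ write $k\ell=(k_1\ell_1,\dots,k_N\ell_N)$. The set of holes is $$T_n=\bigcup\Big\{\tfrac1n(k\ell+\overline T)\;:\;k\in\mathbb{Z}^N,\ \tfrac1n(k\ell+\overline T)\subset\Omega\Big\}.$$ Only $n$ for which $T_n\neq\emptyset$ are considered. Here $A_n=T_n$ and $B_n=\Omega\setminus T_n$, and $\chi_{A_n}\rightharpoonup X$, $\chi_{B_n}\rightharpoonup 1-X$ weakly-$*$ in $L^\infty(\Omega)$, with $X$ a constant, $0<X<1$. Problem. $W_n=\{(u,v)\in H^1(A_n)\times L^2(B_n):\int_{A_n}u\,dx+\int_{B_n}v\,dx=0\}$ (with $H^1(A_n)$ the Sobolev space on the interior of $A_n$). The strong form of the problem is $$f_n(x)=\Delta u_n(x)+\int_{B_n}J(x-y)(v_n(y)-u_n(x))\,dy,\ x\in A_n,\qquad \frac{\partial u_n}{\partial\eta}=0\ \text{on }\partial A_n,$$ $$f_n(x)=\int_{B_n}G(x-y)(v_n(y)-v_n(x))\,dy+\int_{A_n}J(x-y)(u_n(y)-v_n(x))\,dy,\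 x\in B_n.$$ The weak solution is the unique $(u_n,v_n)\in W_n$ such that for all $(\varphi,\phi)\in W_n$ $$a_n((u_n,v_n),(\varphi,\phi))=-\int_{A_n}f_n\varphi\,dx-\int_{B_n}f_n\phi\,dx,$$ where $$a_n((u,v),(\varphi,\phi))=\int_{A_n}\nabla u\cdot\nabla\varphi\,dx+\frac12\int_{B_n}\int_{B_n}G(x-y)(v(y)-v(x))(\phi(y)-\phi(x))\,dy\,dx+\int_{A_n}\int_{B_n}J(x-y)(v(y)-u(x))(\phi(y)-\varphi(x))\,dy\,dx.$$ *)

theory Defs
  imports "HOL-Analysis.Analysis"
begin

section \<open>Smooth functions, supports and smooth boundaries\<close>

text \<open>\<open>Ck_on k f S\<close> is meant for open \<open>S\<close>; the directional derivatives are the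
  functions \<open>\<lambda>x. Df(x) e\<close>.\<close>

primrec Ck_on :: "nat \<Rightarrow> ('a::euclidean_space \<Rightarrow> real) \<Rightarrow> 'a set \<Rightarrow> bool" where
  "Ck_on 0 f S \<longleftrightarrow> continuous_on S f"
| "Ck_on (Suc k) f S \<longleftrightarrow> (\<forall>x\<in>S. f differentiable (at x)) \<and>
     (\<forall>e. Ck_on k (\<lambda>x. frechet_derivative f (at x) e) S)"

definition smooth_on :: "('a::euclidean_space \<Rightarrow> real) \<Rightarrow> 'a set \<Rightarrow> bool" where
  "smooth_on f S \<longleftrightarrow> (\<forall>k. Ck_on k f S)"

definition supp :: "('a::euclidean_space \<Rightarrow> real) \<Rightarrow> 'a set" where
  "supp f = closure {x. f x \<noteq> 0}"

definition test_functions :: "'a::euclidean_space set \<Rightarrow> ('a \<Rightarrow> real) set" where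
  "test_functions U = {\<psi>. smooth_on \<psi> UNIV \<and> compact (supp \<psi>) \<and> supp \<psi> \<subseteq> U}"

text \<open>Near each boundary point, \<open>U\<close> is the set of points strictly above the graph of a smooth
  function over a hyperplane \<open>\<nu>\<^sup>\<bottom>\<close>. The function \<open>\<gamma>\<close> is defined on the whole space, but only its
  values on that hyperplane are used.\<close>

definition smooth_boundary :: "'a::euclidean_space set \<Rightarrow> bool" where
  "smooth_boundary U \<longleftrightarrow>
    (\<forall>p\<in>frontier U. \<exists>r>0. \<exists>\<nu> \<gamma>. norm \<nu> = 1 \<and> smooth_on \<gamma> UNIV \<and>
       U \<inter> ball p r = {x \<in> ball p r. \<gamma> (x - (x \<bullet> \<nu>) *\<^sub>R \<nu>) < x \<bullet> \<nu>})"

definition smooth_bounded_domain :: "'a::euclidean_space set \<Rightarrow> bool" where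
  "smooth_bounded_domain \<Omega> \<longleftrightarrow>
     open \<Omega> \<and> connected \<Omega> \<and> \<Omega> \<noteq> {} \<and> bounded \<Omega> \<and> smooth_boundary \<Omega>"

section \<open>Square-integrable functions and the Sobolev space\<close>

text \<open>Elements of \<open>L\<^sup>2\<close> and \<open>H\<^sup>1\<close> are represented by functions on the whole space, whose
  values outside the domain are irrelevant; equality in these spaces is equality a.e.\<close>

definition L2 :: "'a::euclidean_space set \<Rightarrow> ('a \<Rightarrow> 'b::euclidean_space) set" where
  "L2 S = {f. f \<in> borel_measurable (lebesgue_on S) \<and>
              integrable (lebesgue_on S) (\<lambda>x. (norm (f x))\<^sup>2)}"

definition L2_tendsto ::
  "'a::euclidean_space set \<Rightarrow> (nat \<Rightarrow> 'a \<Rightarrow> real) \<Rightarrow> ('a \<Rightarrow> real) \<Rightarrow> bool" where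
  "L2_tendsto S w w0 \<longleftrightarrow>
     (\<lambda>n. sqrt (LINT x|lebesgue_on S. (w n x - w0 x)\<^sup>2)) \<longlonglongrightarrow> 0"

definition L2_weakly_tendsto ::
  "'a::euclidean_space set \<Rightarrow> (nat \<Rightarrow> 'a \<Rightarrow> real) \<Rightarrow> ('a \<Rightarrow> real) \<Rightarrow> bool" where
  "L2_weakly_tendsto S w w0 \<longleftrightarrow>
     (\<forall>g\<in>L2 S. (\<lambda>n. LINT x|lebesgue_on S. w n x * g x)
                 \<longlonglongrightarrow> (LINT x|lebesgue_on S. w0 x * g x))"

definition Linf_weakstar_tendsto ::
  "'a::euclidean_space set \<Rightarrow> (nat \<Rightarrow> 'a \<Rightarrow> real) \<Rightarrow> ('a \<Rightarrow> real) \<Rightarrow> bool" where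
  "Linf_weakstar_tendsto S w w0 \<longleftrightarrow>
     (\<forall>g. integrable (lebesgue_on S) g \<longrightarrow>
        (\<lambda>n. LINT x|lebesgue_on S. w n x * g x)
           \<longlonglongrightarrow> (LINT x|lebesgue_on S. w0 x * g x))"

text \<open>\<open>g\<close> is a representative in \<open>L\<^sup>2(U)\<close> of the distributional gradient of \<open>u\<close> on the open
  set \<open>U\<close>; such a \<open>g\<close> is unique up to null sets.\<close>

definition is_weak_gradient ::
  "(real^'n) set \<Rightarrow> (real^'n \<Rightarrow> real) \<Rightarrow> (real^'n \<Rightarrow> real^'n) \<Rightarrow> bool" where
  "is_weak_gradient U u g \<longleftrightarrow> g \<in> L2 U \<and>
     (\<forall>\<psi>\<in>test_functions U. \<forall>i.
        (LINT x|lebesgue_on U. u x * frechet_derivative \<psi> (at x) (axis i 1))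
          = - (LINT x|lebesgue_on U. g x $ i * \<psi> x))"

definition H1 :: "(real^'n) set \<Rightarrow> (real^'n \<Rightarrow> real) set" where
  "H1 U = {u \<in> L2 U. \<exists>g. is_weak_gradient U u g}"

section \<open>Kernels and holes\<close>

definition interaction_kernel :: "('a::euclidean_space \<Rightarrow> real) \<Rightarrow> bool" where
  "interaction_kernel K \<longleftrightarrow> continuous_on UNIV K \<and> (\<forall>z. 0 \<le> K z) \<and>
     (\<forall>z w. norm z = norm w \<longrightarrow> K z = K w) \<and> compact (supp K) \<and>
     0 < K 0 \<and> (LINT z|lebesgue. K z) = 1"

definition reference_cell :: "real^'n \<Rightarrow> (real^'n) set" where
  "reference_cell l = {x. \<forall>i. 0 < x $ i \<and> x $ i < l $ i}"

definition hole :: "real^'n \<Rightarrow> (real^'n) set \<Rightarrow> nat \<Rightarrow> int^'n \<Rightarrow> (real^'n) set" where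
  "hole l T n k = (\<lambda>x. (1 / real n) *\<^sub>R ((\<chi> i. of_int (k $ i) * l $ i) + x)) ` closure T"

definition holes ::
  "(real^'n) set \<Rightarrow> real^'n \<Rightarrow> (real^'n) set \<Rightarrow> nat \<Rightarrow> (real^'n) set" where
  "holes \<Omega> l T n = \<Union> {hole l T n k | k. hole l T n k \<subseteq> \<Omega>}"

section \<open>The coupled local/nonlocal problem\<close>

definition W_space ::
  "(real^'n) set \<Rightarrow> (real^'n) set \<Rightarrow> ((real^'n \<Rightarrow> real) \<times> (real^'n \<Rightarrow> real)) set" where
  "W_space A B = {(u, v). u \<in> H1 (interior A) \<and> v \<in> L2 B \<and>
     (LINT x|lebesgue_on A. u x) + (LINT x|lebesgue_on B. v x) = 0}"

text \<open>The bilinear form \<open>a\<^sub>n((u,v),(\<phi>,\<theta>))\<close>; the arguments \<open>Du\<close> and \<open>D\<phi>\<close> are representatives of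
  the weak gradients of \<open>u\<close> and \<open>\<phi>\<close>.\<close>

definition a_form ::
  "(real^'n \<Rightarrow> real) \<Rightarrow> (real^'n \<Rightarrow> real) \<Rightarrow> (real^'n) set \<Rightarrow> (real^'n) set \<Rightarrow>
   (real^'n \<Rightarrow> real) \<Rightarrow> (real^'n \<Rightarrow> real^'n) \<Rightarrow> (real^'n \<Rightarrow> real) \<Rightarrow>
   (real^'n \<Rightarrow> real) \<Rightarrow> (real^'n \<Rightarrow> real^'n) \<Rightarrow> (real^'n \<Rightarrow> real) \<Rightarrow> real" where
  "a_form J G A B u Du v \<phi> D\<phi> \<theta> =
     (LINT x|lebesgue_on A. Du x \<bullet> D\<phi> x)
     + 1/2 * (LINT x|lebesgue_on B. LINT y|lebesgue_on B.
                G (x - y) * (v y - v x) * (\<theta> y - \<theta> x))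
     + (LINT x|lebesgue_on A. LINT y|lebesgue_on B.
                J (x - y) * (v y - u x) * (\<theta> y - \<phi> x))"

text \<open>Quantifying over all representatives \<open>Du\<close>, \<open>D\<phi>\<close> does not strengthen the notion, as they are
  unique a.e.; their existence is part of membership in the space.\<close>

definition weak_solution ::
  "(real^'n \<Rightarrow> real) \<Rightarrow> (real^'n \<Rightarrow> real) \<Rightarrow> (real^'n) set \<Rightarrow> (real^'n) set \<Rightarrow>
   (real^'n \<Rightarrow> real) \<Rightarrow> (real^'n \<Rightarrow> real) \<Rightarrow> (real^'n \<Rightarrow> real) \<Rightarrow> bool" where
  "weak_solution J G A B f u v \<longleftrightarrow> (u, v) \<in> W_space A B \<and>
     (\<forall>\<phi> \<theta> Du D\<phi>. (\<phi>, \<theta>) \<in> W_space A B \<longrightarrow>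
        is_weak_gradient (interior A) u Du \<longrightarrow> is_weak_gradient (interior A) \<phi> D\<phi> \<longrightarrow>
        a_form J G A B u Du v \<phi> D\<phi> \<theta>
          = - (LINT x|lebesgue_on A. f x * \<phi> x) - (LINT x|lebesgue_on B. f x * \<theta> x))"

definition homogenized_system ::
  "(real^'n \<Rightarrow> real) \<Rightarrow> (real^'n \<Rightarrow> real) \<Rightarrow> (real^'n) set \<Rightarrow> real \<Rightarrow>
   (real^'n \<Rightarrow> real) \<Rightarrow> (real^'n \<Rightarrow> real) \<Rightarrow> (real^'n \<Rightarrow> real) \<Rightarrow> bool" where
  "homogenized_system J G \<Omega> X f u v \<longleftrightarrow>
     (AE x in lebesgue_on \<Omega>.
        f x * X = (LINT y|lebesgue_on \<Omega>. J (x - y) * (X * v y - (1 - X) * u x)) \<and>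
        f x * (1 - X) =
          (LINT y|lebesgue_on \<Omega>. G (x - y) * ((1 - X) * v y - (1 - X) * v x))
          + (LINT y|lebesgue_on \<Omega>. J (x - y) * ((1 - X) * u y - X * v x)))"

end

theory Submission
  imports Defs "HOL-Complex_Analysis.Great_Picard"
begin

text \<open>
Let \<open>U\<^sub>n\<close> and \<open>V\<^sub>n\<close> be the extensions of \<open>u\<^sub>n\<close> and \<open>v\<^sub>n\<close> by zero to \<open>\<Omega>\<close>, and write \<open>K * w\<close> for the integral
of \<open>K (x - y) w y\<close> over \<open>y \<in> \<Omega>\<close>. The theorem follows from two observations.

First, each hole sits inside its own periodic cell. A function that is constant on each cell therefore
has zero weak gradient on the holes, and such functions approximate continuous functions uniformly as
the cells shrink (\<open>weak_gradient_locally_constant\<close>, \<open>cell_corner_locally_constant\<close>). With them as test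
functions the Dirichlet term disappears from the weak formulation, and what remains is
\<open>(J * \<chi>\<^sub>B) U\<^sub>n = \<chi>\<^sub>A (J * V\<^sub>n - f\<^sub>n)\<close> and \<open>(G * \<chi>\<^sub>B + J * \<chi>\<^sub>A) V\<^sub>n = \<chi>\<^sub>B (G * V\<^sub>n + J * U\<^sub>n - f\<^sub>n)\<close>, the first of
them only against functions that are constant on cells.

Second, convolution is compact. If \<open>U\<^sub>n\<close> and \<open>V\<^sub>n\<close> are bounded in \<open>L\<^sup>2\<close>, then \<open>J * U\<^sub>n\<close>, \<open>J * V\<^sub>n\<close> and \<open>G * V\<^sub>n\<close>
converge uniformly along a subsequence. In the two identities all coefficients now converge strongly,
and the indicators converge weakly-* to \<open>X\<close> and \<open>1 - X\<close>. Dividing by the coefficient of \<open>U\<^sub>n\<close>, respectively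
\<open>V\<^sub>n\<close>, shows that these converge weakly to explicit functions \<open>u\<close> and \<open>v\<close>, and the limits of the
convolutions must be \<open>J * u\<close>, \<open>J * v\<close> and \<open>G * v\<close>. So \<open>(u, v)\<close> solves the homogenized system
(\<open>weak_limit_of_quotient\<close>, \<open>hole_solutions_compact\<close>).

The solution of the system with mean zero is unique: for zero source, the energy of
\<open>J (x - y) (u x / X - v y / (1 - X))\<^sup>2\<close> vanishes, and since \<open>J\<close> is positive near the origin and \<open>\<Omega>\<close> is connected,
\<open>u / X\<close> and \<open>v / (1 - X)\<close> are one and the same constant, which is zero by the mean condition
(\<open>limit_system_zero\<close>). Uniqueness gives the bound in \<open>L\<^sup>2\<close> by contradiction: normalised solutions
would converge weakly to zero, and the energy inequality would make them converge to zero strongly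
(\<open>hole_solutions_bounded\<close>). It also turns convergence of subsequences into convergence of the
whole sequence (\<open>hole_solutions_converge\<close>).
\<close>

lemmas LINT_cong = Bochner_Integration.integral_cong

section \<open>Square-integrable functions on a bounded open set\<close>

locale bounded_region =
  fixes \<Omega> :: "'a::euclidean_space set"
  assumes region_open: "open \<Omega>" and region_bounded: "bounded \<Omega>" and region_nonempty: "\<Omega> \<noteq> {}"
begin

abbreviation M where "M \<equiv> lebesgue_on \<Omega>"

lemma region_lmeasurable [simp]: "\<Omega> \<in> lmeasurable"
  using region_open region_bounded by (simp add: lmeasurable_open)

lemma region_sets [simp]: "\<Omega> \<in> sets lebesgue"
  using region_lmeasurable by blast

sublocale finite_measure M
  by (simp add: finite_measure_lebesgue_on)

lemma measurable_on_region: "g \<in> borel_measurable borel \<Longrightarrow> g \<in> borel_measurable M"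
  by (intro measurable_restrict_space1 measurable_completion) simp

lemma continuous_measurable: "continuous_on \<Omega> g \<Longrightarrow> g \<in> borel_measurable M"
  by (simp add: continuous_imp_measurable_on_sets_lebesgue)

lemma real_L2_iff:
  fixes w :: "'a \<Rightarrow> real"
  shows "w \<in> L2 \<Omega> \<longleftrightarrow> w \<in> borel_measurable M \<and> integrable M (\<lambda>x. (w x)\<^sup>2)"
  by (simp add: L2_def)

lemma L2D:
  fixes w :: "'a \<Rightarrow> real"
  assumes "w \<in> L2 \<Omega>"
  shows "w \<in> borel_measurable M" "integrable M (\<lambda>x. (w x)\<^sup>2)"
  using assms by (auto simp: real_L2_iff)

lemma L2_mult_integrable:
  fixes u v :: "'a \<Rightarrow> real"
  assumes "u \<in> L2 \<Omega>" "v \<in> L2 \<Omega>"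
  shows "integrable M (\<lambda>x. u x * v x)"
proof (rule Bochner_Integration.integrable_bound)
  show "integrable M (\<lambda>x. (u x)\<^sup>2 + (v x)\<^sup>2)" using assms by (auto simp: L2D)
  show "(\<lambda>x. u x * v x) \<in> borel_measurable M"
    by (intro borel_measurable_times L2D assms)
  have "\<bar>u x * v x\<bar> \<le> \<bar>(u x)\<^sup>2 + (v x)\<^sup>2\<bar>" for x
  proof -
    have "0 \<le> (\<bar>u x\<bar> - \<bar>v x\<bar>)\<^sup>2" by simp
    then have "2 * (\<bar>u x\<bar> * \<bar>v x\<bar>) \<le> (u x)\<^sup>2 + (v x)\<^sup>2" by (simp add: power2_diff)
    moreover have "0 \<le> \<bar>u x\<bar> * \<bar>v x\<bar>" by (rule mult_nonneg_nonneg) simp_all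
    ultimately show ?thesis unfolding abs_mult by linarith
  qed
  then show "AE x in M. norm (u x * v x) \<le> norm ((u x)\<^sup>2 + (v x)\<^sup>2)" by simp
qed

lemma L2_add:
  fixes u v :: "'a \<Rightarrow> real"
  assumes "u \<in> L2 \<Omega>" "v \<in> L2 \<Omega>"
  shows "(\<lambda>x. u x + v x) \<in> L2 \<Omega>"
proof -
  have "(\<lambda>x. (u x + v x)\<^sup>2) = (\<lambda>x. (u x)\<^sup>2 + (v x)\<^sup>2 + 2 * (u x * v x))"
    by (auto simp: power2_sum)
  then show ?thesis using L2D(2)[OF assms(1)] L2D(2)[OF assms(2)] L2_mult_integrable[OF assms]
    by (simp add: real_L2_iff borel_measurable_add L2D(1)[OF assms(1)] L2D(1)[OF assms(2)])
qed

lemma L2_bounded_mult: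
  fixes b u :: "'a \<Rightarrow> real"
  assumes u: "u \<in> L2 \<Omega>" and b: "b \<in> borel_measurable M" "\<And>x. x \<in> \<Omega> \<Longrightarrow> \<bar>b x\<bar> \<le> C"
  shows "(\<lambda>x. b x * u x) \<in> L2 \<Omega>"
proof -
  have "integrable M (\<lambda>x. (b x * u x)\<^sup>2)"
  proof (rule Bochner_Integration.integrable_bound)
    show "integrable M (\<lambda>x. C\<^sup>2 * (u x)\<^sup>2)" using u by (auto simp: L2D)
    show "(\<lambda>x. (b x * u x)\<^sup>2) \<in> borel_measurable M"
      by (intro borel_measurable_power borel_measurable_times L2D(1)[OF u] b(1))
    have "(b x * u x)\<^sup>2 \<le> C\<^sup>2 * (u x)\<^sup>2" if "x \<in> \<Omega>" for x
    proof -
      have "(b x)\<^sup>2 \<le> C\<^sup>2" using power_mono[OF b(2)[OF that], of 2] by simp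
      then show ?thesis by (simp add: power_mult_distrib mult_right_mono)
    qed
    then show "AE x in M. norm ((b x * u x)\<^sup>2) \<le> norm (C\<^sup>2 * (u x)\<^sup>2)" by (auto intro!: AE_I2)
  qed
  then show ?thesis
    by (simp add: real_L2_iff borel_measurable_times L2D(1)[OF u] b(1))
qed

lemma L2_bounded:
  fixes b :: "'a \<Rightarrow> real"
  assumes b: "b \<in> borel_measurable M" "\<And>x. x \<in> \<Omega> \<Longrightarrow> \<bar>b x\<bar> \<le> C"
  shows "b \<in> L2 \<Omega>"
proof -
  have "(\<lambda>x. 1 :: real) \<in> L2 \<Omega>" by (simp add: real_L2_iff)
  from L2_bounded_mult[OF this b] show ?thesis by simp
qed

lemma L2_const [simp]: "(\<lambda>x. c :: real) \<in> L2 \<Omega>"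
  by (rule L2_bounded[of _ "\<bar>c\<bar>"]) auto

lemma L2_cmult: "u \<in> L2 \<Omega> \<Longrightarrow> (\<lambda>x. c * u x :: real) \<in> L2 \<Omega>"
  by (rule L2_bounded_mult[of _ _ "\<bar>c\<bar>"]) auto

lemma L2_diff:
  fixes u v :: "'a \<Rightarrow> real"
  assumes "u \<in> L2 \<Omega>" "v \<in> L2 \<Omega>"
  shows "(\<lambda>x. u x - v x) \<in> L2 \<Omega>"
  using L2_add[OF assms(1) L2_cmult[OF assms(2), of "-1"]] by simp

lemma L2_indicator_mult:
  fixes u :: "'a \<Rightarrow> real"
  assumes "u \<in> L2 \<Omega>" "S \<in> sets M"
  shows "(\<lambda>x. indicat_real S x * u x) \<in> L2 \<Omega>"
  by (rule L2_bounded_mult[of _ _ 1]) (use assms in \<open>auto simp: indicator_def\<close>)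

lemma L2_indicator: "S \<in> sets M \<Longrightarrow> indicat_real S \<in> L2 \<Omega>"
  by (rule L2_bounded[of _ 1]) (auto simp: indicator_def)

lemma L2_integrable:
  fixes u :: "'a \<Rightarrow> real"
  assumes "u \<in> L2 \<Omega>"
  shows "integrable M u"
  using L2_mult_integrable[OF assms L2_const[of 1]] by simp

lemma continuous_bounded_on_region:
  fixes \<psi> :: "'a \<Rightarrow> real"
  assumes "continuous_on UNIV \<psi>"
  obtains C where "0 < C" "\<And>x. x \<in> \<Omega> \<Longrightarrow> \<bar>\<psi> x\<bar> \<le> C"
proof -
  have "compact (\<psi> ` closure \<Omega>)"
    by (intro compact_continuous_image continuous_on_subset[OF assms])
       (auto simp: region_bounded compact_closure)
  then obtain C where "0 < C" "\<forall>x\<in>\<psi> ` closure \<Omega>. norm x \<le> C"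
    using compact_imp_bounded bounded_pos by metis
  then show ?thesis using closure_subset[of \<Omega>] by (intro that[of C]) auto
qed

lemma L2_continuous: "continuous_on UNIV \<psi> \<Longrightarrow> (\<psi> :: 'a \<Rightarrow> real) \<in> L2 \<Omega>"
  by (metis L2_bounded continuous_bounded_on_region continuous_measurable continuous_on_subset
      subset_UNIV)

lemma L2_continuous_mult:
  "continuous_on UNIV \<psi> \<Longrightarrow> u \<in> L2 \<Omega> \<Longrightarrow> (\<lambda>x. \<psi> x * u x :: real) \<in> L2 \<Omega>"
  by (metis L2_bounded_mult continuous_bounded_on_region continuous_measurable continuous_on_subset
      subset_UNIV)

lemma L2_Cauchy_Schwarz:
  fixes u v :: "'a \<Rightarrow> real"
  assumes u: "u \<in> L2 \<Omega>" and v: "v \<in> L2 \<Omega>"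
  shows "\<bar>LINT x|M. u x * v x\<bar> \<le> sqrt (LINT x|M. (u x)\<^sup>2) * sqrt (LINT x|M. (v x)\<^sup>2)"
proof -
  define a b c where "a = (LINT x|M. (u x)\<^sup>2)" and "b = (LINT x|M. (v x)\<^sup>2)"
    and "c = (LINT x|M. u x * v x)"
  have ab: "0 \<le> a" "0 \<le> b" by (simp_all add: a_def b_def)
  have quad: "0 \<le> a * s\<^sup>2 - 2 * c * s * t + b * t\<^sup>2" for s t
  proof -
    have "0 \<le> (LINT x|M. (s * u x - t * v x)\<^sup>2)" by simp
    also have "\<dots> = (LINT x|M. s\<^sup>2 * (u x)\<^sup>2 - 2 * s * t * (u x * v x) + t\<^sup>2 * (v x)\<^sup>2)"
      by (intro LINT_cong) (auto simp: power2_eq_square algebra_simps)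
    also have "\<dots> = a * s\<^sup>2 - 2 * c * s * t + b * t\<^sup>2"
      using L2D[OF u] L2D[OF v] L2_mult_integrable[OF u v]
      unfolding a_def b_def c_def
      by (subst Bochner_Integration.integral_add Bochner_Integration.integral_diff; simp)+
    finally show ?thesis .
  qed
  have "c\<^sup>2 \<le> a * b"
  proof (cases "b = 0")
    case True
    have "c = 0"
    proof (rule ccontr)
      assume "c \<noteq> 0"
      then show False
        using quad[of 1 "(a + 1) / (2 * c)"] True by (simp add: field_simps)
    qed
    then show ?thesis using True by simp
  next
    case False
    then have "0 < b" using ab by simp
    moreover have "0 \<le> b * (a * b - c\<^sup>2)"
      using quad[of b c] by (simp add: power2_eq_square algebra_simps)
    ultimately show ?thesis by (simp add: zero_le_mult_iff)
  qed
  then have "\<bar>c\<bar> \<le> sqrt (a * b)"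
    by (metis real_sqrt_abs real_sqrt_le_mono)
  then show ?thesis by (simp add: a_def b_def c_def real_sqrt_mult)
qed

lemma uniform_imp_L2_vanishing:
  fixes h :: "nat \<Rightarrow> 'a \<Rightarrow> real"
  assumes h: "\<And>n. h n \<in> L2 \<Omega>" and unif: "uniform_limit \<Omega> h (\<lambda>x. 0) sequentially"
  shows "(\<lambda>n. LINT x|M. (h n x)\<^sup>2) \<longlonglongrightarrow> 0"
proof (rule LIMSEQ_I)
  fix r :: real assume r: "0 < r"
  define e where "e = sqrt (r / (measure M \<Omega> + 1))"
  have e: "0 < e" using r by (simp add: e_def add_nonneg_pos)
  obtain N where N: "\<And>n x. n \<ge> N \<Longrightarrow> x \<in> \<Omega> \<Longrightarrow> \<bar>h n x\<bar> < e"
    using uniform_limitD[OF unif e] by (auto simp: eventually_sequentially dist_real_def)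
  show "\<exists>N. \<forall>n\<ge>N. norm ((LINT x|M. (h n x)\<^sup>2) - 0) < r"
  proof (intro exI allI impI)
    fix n assume n: "N \<le> n"
    have "(LINT x|M. (h n x)\<^sup>2) \<le> (LINT x|M. e\<^sup>2)"
    proof (rule integral_mono)
      fix x assume "x \<in> space M"
      then show "(h n x)\<^sup>2 \<le> e\<^sup>2"
        using power_mono[of "\<bar>h n x\<bar>" e 2] N[OF n, of x] by auto
    qed (use L2D[OF h] in auto)
    also have "\<dots> = r * (measure M \<Omega> / (measure M \<Omega> + 1))"
      using r by (simp add: e_def)
    also have "\<dots> < r * 1"
      by (intro mult_strict_left_mono[OF _ r]) (simp add: divide_less_eq add_nonneg_pos)
    finally show "norm ((LINT x|M. (h n x)\<^sup>2) - 0) < r" by simp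
  qed
qed

end

section \<open>Interaction kernels and convolution over the region\<close>

lemma kernel_commute: "interaction_kernel K \<Longrightarrow> K (x - y) = K (y - x)"
  unfolding interaction_kernel_def by (metis norm_minus_commute)

lemma kernel_nonneg: "interaction_kernel K \<Longrightarrow> 0 \<le> K z"
  unfolding interaction_kernel_def by blast

lemma kernel_continuous: "interaction_kernel K \<Longrightarrow> continuous_on S K"
  unfolding interaction_kernel_def by (metis continuous_on_subset subset_UNIV)

lemma kernel_bounded:
  assumes "interaction_kernel K"
  obtains B where "0 < B" "\<And>z. \<bar>K z\<bar> \<le> B"
proof -
  have "compact (K ` supp K)"
    using assms unfolding interaction_kernel_def
    by (metis compact_continuous_image kernel_continuous[OF assms])
  then obtain B where B: "0 < B" "\<forall>x\<in>K ` supp K. norm x \<le> B"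
    using compact_imp_bounded bounded_pos by metis
  have "\<bar>K z\<bar> \<le> B" for z
  proof (cases "K z = 0")
    case False
    then have "z \<in> supp K" unfolding supp_def using closure_subset by fastforce
    then show ?thesis using B by auto
  qed (use B in auto)
  then show ?thesis using that B by blast
qed

lemma kernel_uniformly_continuous:
  assumes K: "interaction_kernel K"
  shows "uniformly_continuous_on UNIV K"
proof -
  obtain R where R: "supp K \<subseteq> cball 0 R"
    using K bounded_any_center[of "supp K" 0] compact_imp_bounded[of "supp K"]
    unfolding interaction_kernel_def subset_iff mem_cball by blast
  have uc: "uniformly_continuous_on (cball 0 (R + 1)) K"
    by (intro compact_uniformly_continuous kernel_continuous[OF K] compact_cball)
  have zero: "K z = 0" if "z \<notin> cball 0 R" for z
    using that R closure_subset[of "{x. K x \<noteq> 0}"] unfolding supp_def by blast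
  show ?thesis unfolding uniformly_continuous_on_def
  proof (intro allI impI)
    fix e :: real assume "0 < e"
    then obtain d where d: "0 < d"
      "\<And>z w. z \<in> cball 0 (R + 1) \<Longrightarrow> w \<in> cball 0 (R + 1) \<Longrightarrow> dist w z < d \<Longrightarrow> dist (K w) (K z) < e"
      using uc unfolding uniformly_continuous_on_def by metis
    show "\<exists>d>0. \<forall>x\<in>UNIV. \<forall>x'\<in>UNIV. dist x' x < d \<longrightarrow> dist (K x') (K x) < e"
    proof (intro exI[of _ "min d 1"] conjI ballI impI)
      fix z w :: 'a assume zw: "dist w z < min d 1"
      have tri: "dist 0 z \<le> dist 0 w + dist w z" "dist 0 w \<le> dist 0 z + dist w z"
        using dist_triangle[of 0 z w] dist_triangle[of 0 w z] by (auto simp: dist_commute)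
      show "dist (K w) (K z) < e"
      proof (cases "z \<in> cball 0 (R + 1) \<and> w \<in> cball 0 (R + 1)")
        case True
        then show ?thesis using d(2)[of z w] zw by auto
      next
        case False
        then have "z \<notin> cball 0 R" "w \<notin> cball 0 R" using tri zw by auto
        then show ?thesis using zero \<open>0 < e\<close> by simp
      qed
    qed (use d in auto)
  qed
qed

lemma kernel_positive_near_zero:
  assumes K: "interaction_kernel K"
  obtains d where "0 < d" "\<And>z. norm z < d \<Longrightarrow> K 0 / 2 < K z" "0 < K 0"
proof -
  have "0 < K 0" using K unfolding interaction_kernel_def by (elim conjE)
  have "(K \<longlongrightarrow> K 0) (nhds 0)"
    using kernel_continuous[OF K, of UNIV]
    by (simp add: continuous_on_eq_continuous_at continuous_at tendsto_at_iff_tendsto_nhds)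
  then have "\<forall>\<^sub>F z in nhds 0. K 0 / 2 < K z"
    using \<open>0 < K 0\<close> by (intro order_tendstoD(1)) auto
  then obtain d where d: "0 < d" "\<And>z. norm z < d \<Longrightarrow> K 0 / 2 < K z"
    unfolding eventually_nhds_metric by auto
  then show ?thesis using that \<open>0 < K 0\<close> by blast
qed

lemma kernel_measurable: "interaction_kernel K \<Longrightarrow> K \<in> borel_measurable borel"
  by (intro borel_measurable_continuous_onI kernel_continuous)

context bounded_region
begin

definition conv :: "('a \<Rightarrow> real) \<Rightarrow> ('a \<Rightarrow> real) \<Rightarrow> 'a \<Rightarrow> real" where
  "conv K w x = (LINT y|M. K (x - y) * w y)"

lemma kernel_section_measurable:
  assumes "interaction_kernel K" shows "(\<lambda>y. K (x - y)) \<in> borel_measurable M"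
  by (intro continuous_measurable continuous_on_compose2[OF kernel_continuous[OF assms, of UNIV]])
     (auto intro!: continuous_intros)

lemma conv_integrable:
  assumes K: "interaction_kernel K" and w: "integrable M w"
  shows "integrable M (\<lambda>y. K (x - y) * w y)"
proof -
  obtain B where B: "0 < B" "\<And>z. \<bar>K z\<bar> \<le> B" using kernel_bounded[OF K] by blast
  show ?thesis
  proof (rule Bochner_Integration.integrable_bound)
    show "integrable M (\<lambda>y. B * w y)" using w by simp
    show "(\<lambda>y. K (x - y) * w y) \<in> borel_measurable M"
      by (intro borel_measurable_times kernel_section_measurable[OF K] borel_measurable_integrable w)
    show "AE y in M. norm (K (x - y) * w y) \<le> norm (B * w y)"
      using B by (intro AE_I2) (auto simp: abs_mult intro!: mult_right_mono order_trans[OF B(2)])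
  qed
qed

lemma conv_diff_bound:
  assumes K: "interaction_kernel K" and w: "integrable M w"
    and e: "\<And>y. y \<in> \<Omega> \<Longrightarrow> \<bar>K (x - y) - K (x' - y)\<bar> \<le> e"
  shows "\<bar>conv K w x - conv K w x'\<bar> \<le> e * (LINT y|M. \<bar>w y\<bar>)"
proof -
  have "conv K w x - conv K w x' = (LINT y|M. K (x - y) * w y - K (x' - y) * w y)"
    unfolding conv_def by (simp add: conv_integrable[OF K w])
  also have "\<bar>\<dots>\<bar> \<le> (LINT y|M. \<bar>K (x - y) * w y - K (x' - y) * w y\<bar>)"
    by (rule integral_abs_bound)
  also have "\<dots> \<le> (LINT y|M. e * \<bar>w y\<bar>)"
  proof (rule integral_mono)
    fix y assume "y \<in> space M"
    then show "\<bar>K (x - y) * w y - K (x' - y) * w y\<bar> \<le> e * \<bar>w y\<bar>"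
      using e[of y] by (simp add: left_diff_distrib[symmetric] abs_mult mult_right_mono)
  qed (use w in \<open>auto simp: conv_integrable[OF K w] intro!: Bochner_Integration.integrable_diff integrable_abs\<close>)
  finally show ?thesis by simp
qed

lemma conv_abs_bound:
  assumes K: "interaction_kernel K" and w: "integrable M w" and B: "\<And>z. \<bar>K z\<bar> \<le> B"
  shows "(LINT y|M. \<bar>K (x - y) * w y\<bar>) \<le> B * (LINT y|M. \<bar>w y\<bar>)"
proof -
  have "(LINT y|M. \<bar>K (x - y) * w y\<bar>) \<le> (LINT y|M. B * \<bar>w y\<bar>)"
  proof (rule integral_mono)
    show "integrable M (\<lambda>y. \<bar>K (x - y) * w y\<bar>)" by (intro integrable_abs conv_integrable K w)
    show "\<bar>K (x - y) * w y\<bar> \<le> B * \<bar>w y\<bar>" for y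
      by (simp add: abs_mult B mult_right_mono)
  qed (use w in auto)
  then show ?thesis by simp
qed

lemma conv_bound:
  assumes K: "interaction_kernel K" and w: "integrable M w" and B: "\<And>z. \<bar>K z\<bar> \<le> B"
  shows "\<bar>conv K w x\<bar> \<le> B * (LINT y|M. \<bar>w y\<bar>)"
  unfolding conv_def by (rule order_trans[OF integral_abs_bound conv_abs_bound[OF K w B]])

lemma conv_equicontinuous:
  assumes K: "interaction_kernel K" and e: "0 < e" and C: "0 \<le> C"
  obtains d where "0 < d" "\<And>w x x'. integrable M w \<Longrightarrow> (LINT y|M. \<bar>w y\<bar>) \<le> C \<Longrightarrow>
     norm (x - x') < d \<Longrightarrow> \<bar>conv K w x - conv K w x'\<bar> < e"
proof -
  define e' where "e' = e / (C + 1)"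
  have e': "0 < e'" using e C by (simp add: e'_def)
  obtain d where d: "0 < d" "\<And>x x'. norm (x - x') < d \<Longrightarrow> \<bar>K x - K x'\<bar> < e'"
    using kernel_uniformly_continuous[OF K] e'
    unfolding uniformly_continuous_on_def dist_norm by (metis UNIV_I real_norm_def)
  have "\<bar>conv K w x - conv K w x'\<bar> < e"
    if w: "integrable M w" "(LINT y|M. \<bar>w y\<bar>) \<le> C" and n: "norm (x - x') < d" for w x x'
  proof -
    have "\<bar>conv K w x - conv K w x'\<bar> \<le> e' * (LINT y|M. \<bar>w y\<bar>)"
      by (intro conv_diff_bound K w) (use d(2) n in \<open>force intro: less_imp_le\<close>)
    also have "\<dots> \<le> e' * C" using e' w by (intro mult_left_mono) auto
    also have "\<dots> < e" using e C by (simp add: e'_def field_simps)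
    finally show ?thesis .
  qed
  then show ?thesis using that d by blast
qed

lemma conv_continuous:
  assumes K: "interaction_kernel K" and w: "integrable M w"
  shows "continuous_on S (conv K w)"
proof (rule continuous_on_subset[OF _ subset_UNIV])
  show "continuous_on UNIV (conv K w)" unfolding continuous_on_iff
  proof (intro ballI allI impI)
    fix x :: 'a and e :: real assume e: "0 < e"
    have "0 \<le> (LINT y|M. \<bar>w y\<bar>)" by simp
    then obtain d where d: "0 < d" "\<And>v x x'. integrable M v \<Longrightarrow>
        (LINT y|M. \<bar>v y\<bar>) \<le> (LINT y|M. \<bar>w y\<bar>) \<Longrightarrow>
        norm (x - x') < d \<Longrightarrow> \<bar>conv K v x - conv K v x'\<bar> < e"
      using conv_equicontinuous[OF K e] by metis
    then show "\<exists>d>0. \<forall>x'\<in>UNIV. dist x' x < d \<longrightarrow> dist (conv K w x') (conv K w x) < e"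
      by (intro exI[of _ d]) (auto simp: dist_norm w)
  qed
qed

lemma conv_L2: "interaction_kernel K \<Longrightarrow> integrable M w \<Longrightarrow> conv K w \<in> L2 \<Omega>"
  by (intro L2_continuous conv_continuous)

lemma conv_mult_integrable:
  assumes K: "interaction_kernel K" and w: "integrable M w" and u: "integrable M u"
  shows "integrable M (\<lambda>x. u x * conv K w x)"
proof -
  obtain C where C: "0 < C" "\<And>x. x \<in> \<Omega> \<Longrightarrow> \<bar>conv K w x\<bar> \<le> C"
    using continuous_bounded_on_region[OF conv_continuous[OF K w]] by metis
  show ?thesis
  proof (rule Bochner_Integration.integrable_bound)
    show "integrable M (\<lambda>x. C * u x)" using u by simp
    show "(\<lambda>x. u x * conv K w x) \<in> borel_measurable M"
      by (intro borel_measurable_times continuous_measurable conv_continuous[OF K w] borel_measurable_integrable u)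
    have "norm (u x * conv K w x) \<le> norm (C * u x)" if "x \<in> \<Omega>" for x
      using mult_left_mono[OF C(2)[OF that] abs_ge_zero[of "u x"]] C(1)
      by (simp add: abs_mult mult.commute[of C])
    then show "AE x in M. norm (u x * conv K w x) \<le> norm (C * u x)" by (intro AE_I2) simp
  qed
qed

lemma conv_cmult: "conv K (\<lambda>y. c * w y) x = c * conv K w x"
  unfolding conv_def by (simp add: mult.left_commute[of _ c])

lemma conv_diff:
  assumes "interaction_kernel K" "integrable M v" "integrable M w"
  shows "conv K (\<lambda>y. v y - w y) x = conv K v x - conv K w x"
  using conv_integrable[OF assms(1,2), of x] conv_integrable[OF assms(1,3), of x]
  by (simp add: conv_def right_diff_distrib)

lemma conv_cong_AE:
  assumes "AE y in M. v y = w y" "v \<in> borel_measurable M" "w \<in> borel_measurable M" "interaction_kernel K"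
  shows "conv K v x = conv K w x"
  unfolding conv_def
  by (intro integral_cong_AE borel_measurable_times kernel_section_measurable assms)
     (use assms(1) in eventually_elim, simp)

lemma conv_symmetric:
  assumes K: "interaction_kernel K" and v: "integrable M v" and w: "integrable M w"
  shows "(LINT x|M. v x * conv K w x) = (LINT x|M. w x * conv K v x)"
proof -
  interpret P: pair_sigma_finite M M ..
  obtain B where B: "0 < B" "\<And>z. \<bar>K z\<bar> \<le> B" using kernel_bounded[OF K] by blast
  have [measurable]: "v \<in> borel_measurable M" "w \<in> borel_measurable M" "K \<in> borel_measurable borel"
    using v w kernel_measurable[OF K] by auto
  have [measurable]: "(\<lambda>x. x) \<in> M \<rightarrow>\<^sub>M borel" by (rule measurable_on_region) simp
  have meas: "(\<lambda>(x, y). v x * (K (x - y) * w y)) \<in> borel_measurable (M \<Otimes>\<^sub>M M)"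
    by measurable
  have int: "integrable (M \<Otimes>\<^sub>M M) (\<lambda>(x, y). v x * (K (x - y) * w y))"
  proof (rule P.Fubini_integrable[OF meas])
    have bd: "(LINT y|M. \<bar>K (x - y)\<bar> * \<bar>w y\<bar>) \<le> B * (LINT y|M. \<bar>w y\<bar>)" for x
      using conv_abs_bound[OF K w B(2), of x] by (simp add: abs_mult)
    show "integrable M (\<lambda>x. LINT y|M. norm (case (x, y) of (x, y) \<Rightarrow> v x * (K (x - y) * w y)))"
    proof (rule Bochner_Integration.integrable_bound)
      show "integrable M (\<lambda>x. (B * (LINT y|M. \<bar>w y\<bar>)) * v x)" using v by simp
      show "(\<lambda>x. LINT y|M. norm (case (x, y) of (x, y) \<Rightarrow> v x * (K (x - y) * w y))) \<in> borel_measurable M"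
        by measurable
      have "\<bar>v x\<bar> * (LINT y|M. \<bar>K (x - y)\<bar> * \<bar>w y\<bar>) \<le> \<bar>v x\<bar> * (B * (LINT y|M. \<bar>w y\<bar>))" for x
        by (intro mult_left_mono bd) simp
      moreover have "0 \<le> (LINT y|M. \<bar>K (x - y)\<bar> * \<bar>w y\<bar>)" for x by simp
      ultimately show "AE x in M. norm (LINT y|M. norm (case (x, y) of (x, y) \<Rightarrow> v x * (K (x - y) * w y)))
          \<le> norm ((B * (LINT y|M. \<bar>w y\<bar>)) * v x)"
        using B(1) by (intro AE_I2) (simp add: abs_mult mult_ac)
    qed
    show "AE x in M. integrable M (\<lambda>y. case (x, y) of (x, y) \<Rightarrow> v x * (K (x - y) * w y))"
      using conv_integrable[OF K w] by simp
  qed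
  have "(LINT x|M. v x * conv K w x) = (LINT x|M. LINT y|M. v x * (K (x - y) * w y))"
    unfolding conv_def by simp
  also have "\<dots> = (LINT y|M. LINT x|M. v x * (K (x - y) * w y))"
    using P.Fubini_integral[of "\<lambda>x y. v x * (K (x - y) * w y)"] int by simp
  also have "\<dots> = (LINT y|M. w y * conv K v y)"
    unfolding conv_def kernel_commute[OF K, of _ "_ :: 'a"]
    by (auto intro!: LINT_cong simp: kernel_commute[OF K] mult_ac
        simp flip: integral_mult_right_zero)
  finally show ?thesis .
qed

end

section \<open>Weak gradients of locally constant functions\<close>

lemma open_diff_supp: "open (- supp \<psi>)"
  by (simp add: supp_def open_Compl)

lemma supp_zero: "x \<notin> supp \<psi> \<Longrightarrow> \<psi> x = 0"
  using closure_subset[of "{x. \<psi> x \<noteq> 0}"] unfolding supp_def by blast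

text \<open>
The integral of \<open>g (x + t e)\<close> does not depend on \<open>t\<close>, so the difference quotients of \<open>g\<close>
integrate to zero; they converge to the derivative and are dominated thanks to the compact
support.
\<close>

lemma integral_directional_derivative_zero:
  fixes g :: "'a::euclidean_space \<Rightarrow> real"
  assumes der: "\<And>x. (g has_derivative g' x) (at x)"
    and cont: "continuous_on UNIV (\<lambda>x. g' x e)"
    and comp: "compact C" and out: "\<And>x. x \<notin> C \<Longrightarrow> g x = 0"
  shows "(LINT x|lebesgue. g' x e) = 0"
proof -
  obtain R where R: "C \<subseteq> cball 0 R"
    using compact_imp_bounded[OF comp] bounded_any_center[of C 0] unfolding subset_iff mem_cball by blast
  have g0: "g x = 0" if "norm x > R" for x
    using out[of x] R that by force
  have D0: "g' x e = 0" if "norm x > R" for x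
  proof -
    have "open {x :: 'a. R < norm x}" by (intro open_Collect_less continuous_intros)
    then have "(g has_derivative (\<lambda>h. 0)) (at x)"
      using has_derivative_transform_within_open[of "\<lambda>x. 0" "\<lambda>h. 0" x UNIV "{x. R < norm x}" g] that g0
      by simp
    then have "g' x = (\<lambda>h. 0)" using der by (metis has_derivative_unique)
    then show ?thesis by simp
  qed
  have gcont: "continuous_on UNIV g"
    using der by (meson continuous_at_imp_continuous_on has_derivative_continuous)
  have bounded_cont: "\<exists>B>0. \<forall>x. \<bar>p x\<bar> \<le> B"
    if "continuous_on UNIV p" "\<And>x. norm x > R \<Longrightarrow> p x = 0" for p :: "'a \<Rightarrow> real"
  proof -
    have "compact (p ` cball 0 R)"
      by (intro compact_continuous_image continuous_on_subset[OF that(1)]) auto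
    then obtain B where B: "0 < B" "\<forall>x\<in>p ` cball 0 R. norm x \<le> B"
      using compact_imp_bounded bounded_pos by metis
    have "\<bar>p x\<bar> \<le> B" for x
      using B that(2)[of x] by (cases "norm x > R") auto
    then show ?thesis using B(1) by blast
  qed
  obtain B where B: "0 < B" "\<And>x. \<bar>g' x e\<bar> \<le> B" using bounded_cont[OF cont D0] by blast
  obtain B' where B': "0 < B'" "\<And>x. \<bar>g x\<bar> \<le> B'" using bounded_cont[OF gcont g0] by blast
  have gm: "g \<in> borel_measurable borel" by (rule borel_measurable_continuous_onI[OF gcont])
  have ind: "integrable lborel (indicator (cball (0::'a) r) :: 'a \<Rightarrow> real)" for r
    using emeasure_bounded_finite[of "cball (0::'a) r"] by (intro integrable_real_indicator) auto
  have gint: "integrable lborel g"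
  proof (rule Bochner_Integration.integrable_bound)
    show "integrable lborel (\<lambda>x. B' * indicator (cball (0::'a) R) x)" using ind by simp
    show "AE x in lborel. norm (g x) \<le> norm (B' * indicator (cball 0 R) x)"
      using B' g0 by (intro AE_I2) (auto simp: indicator_def)
  qed (use gm in simp)
  have shift: "integrable lborel (\<lambda>x. g (a + x))" "(LINT x|lborel. g (a + x)) = (LINT x|lborel. g x)" for a
  proof -
    have "integrable (distr lborel borel ((+) a)) g" using gint by (simp add: lborel_distr_plus)
    then show "integrable lborel (\<lambda>x. g (a + x))" by (rule integrable_distr[rotated]) simp
    have "(LINT x|lborel. g x) = (LINT x|distr lborel borel ((+) a). g x)" by (simp add: lborel_distr_plus)
    also have "\<dots> = (LINT x|lborel. g (a + x))" by (rule integral_distr) (use gm in auto)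
    finally show "(LINT x|lborel. g (a + x)) = (LINT x|lborel. g x)" by simp
  qed
  define h :: "nat \<Rightarrow> real" where "h n = inverse (real (Suc n))" for n
  have h: "0 < h n" "h n \<le> 1" for n by (auto simp: h_def inverse_le_1_iff)
  have h0: "h \<longlonglongrightarrow> 0" unfolding h_def by (rule LIMSEQ_inverse_real_of_nat)
  define d where "d n x = (g (h n *\<^sub>R e + x) - g x) / h n" for n x
  have line: "((\<lambda>t. g (t *\<^sub>R e + x)) has_real_derivative g' (t *\<^sub>R e + x) e) (at t)" for t x
  proof -
    have "((\<lambda>t. g (t *\<^sub>R e + x)) has_derivative (\<lambda>s. g' (t *\<^sub>R e + x) (s *\<^sub>R e))) (at t)"
      by (rule has_derivative_compose[of "\<lambda>t. t *\<^sub>R e + x", OF _ der]) (auto intro!: derivative_eq_intros)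
    moreover have "(\<lambda>s. g' (t *\<^sub>R e + x) (s *\<^sub>R e)) = (*) (g' (t *\<^sub>R e + x) e)"
      using linear_cmul[OF has_derivative_linear[OF der]] by (auto simp: mult.commute)
    ultimately show ?thesis by (simp add: has_field_derivative_def)
  qed
  have "(\<lambda>n. LINT x|lborel. d n x) \<longlonglongrightarrow> (LINT x|lborel. g' x e)"
  proof (rule integral_dominated_convergence)
    show "(\<lambda>x. g' x e) \<in> borel_measurable lborel"
      using borel_measurable_continuous_onI[OF cont] by simp
    show "d n \<in> borel_measurable lborel" for n
    proof -
      have "(\<lambda>x. g (h n *\<^sub>R e + x)) \<in> borel_measurable borel"
        by (rule measurable_compose[OF _ gm]) simp
      then show ?thesis unfolding d_def using gm by simp
    qed
    show "integrable lborel (\<lambda>x. B * indicator (cball (0::'a) (R + norm e)) x)" using ind by simp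
    show "AE x in lborel. (\<lambda>n. d n x) \<longlonglongrightarrow> g' x e"
    proof (rule AE_I2)
      fix x
      have "((\<lambda>t. (g ((0 + t) *\<^sub>R e + x) - g (0 *\<^sub>R e + x)) / t) \<longlongrightarrow> g' (0 *\<^sub>R e + x) e) (at 0)"
        using line[of x 0] unfolding DERIV_def .
      then have lim: "((\<lambda>t. (g (t *\<^sub>R e + x) - g x) / t) \<longlongrightarrow> g' x e) (at 0)" by simp
      have "filterlim h (at 0) sequentially"
        unfolding filterlim_at using h0 h(1) by (auto simp: less_imp_neq[symmetric])
      from filterlim_compose[OF lim this] show "(\<lambda>n. d n x) \<longlonglongrightarrow> g' x e" unfolding d_def .
    qed
    show "AE x in lborel. norm (d n x) \<le> B * indicator (cball 0 (R + norm e)) x" for n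
    proof (rule AE_I2)
      fix x
      have tri: "norm x \<le> norm (h n *\<^sub>R e + x) + norm e"
        using norm_triangle_ineq4[of "h n *\<^sub>R e + x" "h n *\<^sub>R e"] h[of n]
          mult_right_mono[OF h(2)[of n] norm_ge_zero[of e]] by simp
      show "norm (d n x) \<le> B * indicator (cball 0 (R + norm e)) x"
      proof (cases "norm x \<le> R + norm e")
        case True
        obtain z where z: "g (h n *\<^sub>R e + x) - g (0 *\<^sub>R e + x) = (h n - 0) * g' (z *\<^sub>R e + x) e"
          using MVT2[OF h(1)[of n], of "\<lambda>t. g (t *\<^sub>R e + x)" "\<lambda>t. g' (t *\<^sub>R e + x) e"] line by blast
        then have "d n x = g' (z *\<^sub>R e + x) e" using h(1)[of n] by (simp add: d_def)
        then show ?thesis using True B by simp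
      next
        case False
        then have "norm x > R" "norm (h n *\<^sub>R e + x) > R" using tri norm_ge_zero[of e] by linarith+
        then show ?thesis using False g0 by (simp add: d_def)
      qed
    qed
  qed
  moreover have "(LINT x|lborel. d n x) = 0" for n
    unfolding d_def using shift gint by simp
  ultimately have "(LINT x|lborel. g' x e) = 0"
    using LIMSEQ_unique[of "\<lambda>n. 0 :: real" 0] by simp
  then show ?thesis
    using integral_completion[of "\<lambda>x. g' x e" lborel] borel_measurable_continuous_onI[OF cont] by simp
qed

text \<open>
These are the test functions that make the Dirichlet term disappear. If \<open>\<phi>\<close> is locally constant
on \<open>U\<close> and \<open>\<psi>\<close> has compact support in \<open>U\<close>, then \<open>\<phi> \<psi>\<close> is differentiable on the whole space with
derivative \<open>\<phi> D\<psi>\<close>, even where \<open>\<phi>\<close> jumps, because \<open>\<psi>\<close> vanishes near every such point.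
\<close>

lemma weak_gradient_locally_constant:
  fixes \<phi> :: "real^'n \<Rightarrow> real"
  assumes U: "open U" and loc: "\<And>x. x \<in> U \<Longrightarrow> \<forall>\<^sub>F y in nhds x. \<phi> y = \<phi> x"
  shows "is_weak_gradient U \<phi> (\<lambda>x. 0)"
proof -
  have zero: "(\<lambda>x. 0 :: real^'n) \<in> L2 U" by (simp add: L2_def)
  have main: "(LINT x|lebesgue_on U. \<phi> x * frechet_derivative \<psi> (at x) e) = 0"
    if \<psi>: "\<psi> \<in> test_functions U" for \<psi> and e :: "real^'n"
  proof -
    define D where "D x = frechet_derivative \<psi> (at x)" for x
    have "Ck_on (Suc 0) \<psi> UNIV" and comp: "compact (supp \<psi>)" and sub: "supp \<psi> \<subseteq> U"
      using \<psi> by (auto simp: test_functions_def smooth_on_def)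
    then have der: "(\<psi> has_derivative D x) (at x)" and cont: "continuous_on UNIV (\<lambda>x. D x e)" for x
      by (auto simp: D_def frechet_derivative_works)
    have off: "\<forall>\<^sub>F y in nhds x. y \<notin> supp \<psi>" if "x \<notin> supp \<psi>" for x
      using eventually_nhds_in_open[OF open_diff_supp, of x \<psi>] that by simp
    have D0: "D x = (\<lambda>h. 0)" if "x \<notin> supp \<psi>" for x
    proof -
      have "(\<psi> has_derivative (\<lambda>h. 0)) (at x)"
        using has_derivative_transform_within_open[of "\<lambda>x. 0" "\<lambda>h. 0" x UNIV "- supp \<psi>" \<psi>]
          that supp_zero[of _ \<psi>] open_diff_supp by auto
      then show ?thesis using der by (metis has_derivative_unique)
    qed
    have der': "((\<lambda>x. \<phi> x * \<psi> x) has_derivative (\<lambda>h. \<phi> x * D x h)) (at x)"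
      and cont': "isCont (\<lambda>x. \<phi> x * D x e) x" for x
    proof -
      have "\<forall>\<^sub>F y in nhds x. \<phi> y * \<psi> y = \<phi> x * \<psi> y \<and> \<phi> y * D y e = \<phi> x * D y e"
      proof (cases "x \<in> supp \<psi>")
        case True
        then have "\<forall>\<^sub>F y in nhds x. \<phi> y = \<phi> x" using loc sub by blast
        then show ?thesis by eventually_elim simp
      next
        case False
        show ?thesis using off[OF False] False
          by (auto elim!: eventually_mono simp: supp_zero D0)
      qed
      then obtain S where S: "open S" "x \<in> S" "\<And>y. y \<in> S \<Longrightarrow> \<phi> y * \<psi> y = \<phi> x * \<psi> y"
        "\<And>y. y \<in> S \<Longrightarrow> \<phi> y * D y e = \<phi> x * D y e" unfolding eventually_nhds by blast
      have "((\<lambda>y. \<phi> x * \<psi> y) has_derivative (\<lambda>h. \<phi> x * D x h)) (at x)"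
        by (intro has_derivative_mult_right der)
      then show "((\<lambda>x. \<phi> x * \<psi> x) has_derivative (\<lambda>h. \<phi> x * D x h)) (at x)"
        by (rule has_derivative_transform_within_open[OF _ S(1,2)]) (rule S(3)[symmetric])
      have "isCont (\<lambda>y. \<phi> x * D y e) x"
        using cont by (auto simp: continuous_on_eq_continuous_at intro!: continuous_intros)
      moreover have "\<forall>\<^sub>F y in nhds x. \<phi> y * D y e = \<phi> x * D y e"
        using S unfolding eventually_nhds by blast
      ultimately show "isCont (\<lambda>x. \<phi> x * D x e) x"
        by (subst isCont_cong)
    qed
    have "(LINT x|lebesgue. \<phi> x * D x e) = 0"
    proof (rule integral_directional_derivative_zero[OF der' _ comp, of e])
      show "continuous_on UNIV (\<lambda>x. \<phi> x * D x e)"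
        using cont' by (simp add: continuous_at_imp_continuous_on)
    qed (simp add: supp_zero)
    moreover have "(LINT x|lebesgue_on U. \<phi> x * D x e) = (LINT x|lebesgue. (if x \<in> U then \<phi> x * D x e else 0))"
      using U by (subst Lebesgue_Measure.integral_restrict_UNIV) auto
    moreover have "(\<lambda>x. if x \<in> U then \<phi> x * D x e else 0) = (\<lambda>x. \<phi> x * D x e)"
      using D0 sub by fastforce
    ultimately show ?thesis unfolding D_def by simp
  qed
  show ?thesis unfolding is_weak_gradient_def using zero main by simp
qed

section \<open>Geometry of the holes\<close>

text \<open>
Near each of its points the boundary is contained in the image of a hyperplane under the
differentiable map \<open>y \<mapsto> y + \<gamma> y \<nu>\<close>. The integrals in the weak formulation run over the closed
holes whereas \<open>u\<close> is only known to be in \<open>H\<^sup>1\<close> of their interior; this lemma closes the gap.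
\<close>

lemma negligible_frontier_smooth:
  fixes U :: "'a::euclidean_space set"
  assumes U: "open U" and sm: "smooth_boundary U"
  shows "negligible (frontier U)"
  unfolding locally_negligible_alt[of "frontier U"]
proof
  fix p assume "p \<in> frontier U"
  then obtain r \<nu> \<gamma> where r: "0 < r" and \<nu>: "norm \<nu> = 1" and \<gamma>: "smooth_on \<gamma> UNIV"
    and eq: "U \<inter> ball p r = {x \<in> ball p r. \<gamma> (x - (x \<bullet> \<nu>) *\<^sub>R \<nu>) < x \<bullet> \<nu>}"
    using sm unfolding smooth_boundary_def by blast
  have mem: "y \<in> U \<longleftrightarrow> \<gamma> (y - (y \<bullet> \<nu>) *\<^sub>R \<nu>) < y \<bullet> \<nu>" if "y \<in> ball p r" for y
    using eq that by blast
  have "Ck_on (Suc 0) \<gamma> UNIV" using \<gamma> by (simp add: smooth_on_def)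
  then have diff: "\<gamma> differentiable (at x)" for x by simp
  then have cont: "continuous_on UNIV \<gamma>"
    by (simp add: continuous_at_imp_continuous_on differentiable_imp_continuous_within)
  have contc: "continuous_on UNIV (\<lambda>x. \<gamma> (x - (x \<bullet> \<nu>) *\<^sub>R \<nu>))"
    by (rule continuous_on_compose2[OF cont]) (auto intro!: continuous_intros)
  define S where "S = {y. \<nu> \<bullet> y = 0}"
  have negS: "negligible S" unfolding S_def using \<nu> by (intro negligible_hyperplane) auto
  have "(\<lambda>y. y + \<gamma> y *\<^sub>R \<nu>) differentiable_on S"
    unfolding differentiable_on_def
    by (intro ballI differentiable_add differentiable_scaleR differentiable_at_withinI[OF diff]
        differentiable_ident differentiable_const)
  then have neg: "negligible ((\<lambda>y. y + \<gamma> y *\<^sub>R \<nu>) ` S)"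
    by (rule negligible_differentiable_image_negligible[OF order_refl negS])
  have "frontier U \<inter> ball p r \<subseteq> (\<lambda>y. y + \<gamma> y *\<^sub>R \<nu>) ` S"
  proof
    fix x assume x: "x \<in> frontier U \<inter> ball p r"
    let ?y = "x - (x \<bullet> \<nu>) *\<^sub>R \<nu>"
    have "x \<notin> U" using x U by (auto simp: frontier_def interior_open)
    then have 1: "x \<bullet> \<nu> \<le> \<gamma> ?y" using mem[of x] x by (simp del: mem_ball)
    have 2: "\<not> x \<bullet> \<nu> < \<gamma> ?y"
    proof
      assume lt: "x \<bullet> \<nu> < \<gamma> ?y"
      define V where "V = {x. x \<bullet> \<nu> < \<gamma> (x - (x \<bullet> \<nu>) *\<^sub>R \<nu>)} \<inter> ball p r"
      have "open {x. x \<bullet> \<nu> < \<gamma> (x - (x \<bullet> \<nu>) *\<^sub>R \<nu>)}"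
        by (rule open_Collect_less[OF _ contc]) (intro continuous_intros)
      then have "open V" unfolding V_def by (intro open_Int open_ball)
      moreover have "x \<in> V" using lt x unfolding V_def by simp
      moreover have "V \<inter> U = {}" using mem unfolding V_def by fastforce
      ultimately have "V \<inter> closure U = {}" using open_Int_closure_eq_empty by blast
      then show False using x \<open>x \<in> V\<close> by (auto simp: frontier_def)
    qed
    have "x \<bullet> \<nu> = \<gamma> ?y" using 1 2 by simp
    moreover have "?y \<in> S" using \<nu> by (simp add: S_def inner_diff_right inner_commute norm_eq_1)
    ultimately show "x \<in> (\<lambda>y. y + \<gamma> y *\<^sub>R \<nu>) ` S" by (intro image_eqI[of _ _ ?y]) auto
  qed
  then have "negligible (frontier U \<inter> ball p r)" using neg negligible_subset by blast
  moreover have "openin (top_of_set (frontier U)) (frontier U \<inter> ball p r)" by (simp add: openin_open_Int)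
  ultimately show "\<exists>V. openin (top_of_set (frontier U)) V \<and> p \<in> V \<and> negligible V"
    using \<open>p \<in> frontier U\<close> r by (intro exI[of _ "frontier U \<inter> ball p r"]) auto
qed

lemma bounded_reference_cell: "bounded (reference_cell l)"
proof (rule bounded_subset)
  show "reference_cell l \<subseteq> cbox 0 l"
    by (auto simp: reference_cell_def mem_box_cart less_imp_le)
qed simp

lemma compact_hole:
  fixes T :: "(real^'n) set"
  assumes "closure T \<subseteq> reference_cell l"
  shows "compact (hole l T n k)"
proof -
  have "bounded (closure T)" using assms bounded_reference_cell bounded_subset by blast
  then have "compact (closure T)" by (simp add: compact_eq_bounded_closed)
  then show ?thesis unfolding hole_def by (rule compact_continuous_image[rotated]) (intro continuous_intros)
qed

lemma holes_subset: "holes \<Omega> l T n \<subseteq> \<Omega>"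
  by (auto simp: holes_def)

lemma holes_UN: "holes \<Omega> l T n = (\<Union>k\<in>{k. hole l T n k \<subseteq> \<Omega>}. hole l T n k)"
  by (auto simp: holes_def)

lemma holes_borel:
  fixes T :: "(real^'n) set"
  assumes "closure T \<subseteq> reference_cell l"
  shows "holes \<Omega> l T n \<in> sets borel"
  unfolding holes_UN using compact_hole[OF assms]
  by (intro sets.countable_UN' countableI_type) (auto intro: borel_compact)

lemma negligible_holes_diff_interior:
  fixes T :: "(real^'n) set"
  assumes T: "open T" "smooth_boundary T" and cl: "closure T \<subseteq> reference_cell l" and n: "0 < n"
  shows "negligible (holes \<Omega> l T n - interior (holes \<Omega> l T n))"
proof -
  define F where "F k x = (1 / real n) *\<^sub>R ((\<chi> i. of_int (k $ i) * l $ i) + x)" for k :: "int^'n" and x :: "real^'n"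
  have F: "hole l T n k = F k ` closure T" for k by (simp add: hole_def F_def[abs_def])
  have Fop: "open (F k ` T)" for k
  proof -
    have "F k ` T = (\<lambda>x. (1 / real n) *\<^sub>R x) ` ((+) (\<chi> i. of_int (k $ i) * l $ i) ` T)"
      by (simp add: F_def[abs_def] image_image)
    then show ?thesis using T(1) n by (auto intro!: open_scaling open_translation)
  qed
  have "holes \<Omega> l T n - interior (holes \<Omega> l T n) \<subseteq> (\<Union>k. F k ` frontier T)"
  proof
    fix x assume x: "x \<in> holes \<Omega> l T n - interior (holes \<Omega> l T n)"
    then obtain k where k: "F k ` closure T \<subseteq> \<Omega>" "x \<in> F k ` closure T"
      by (auto simp: holes_UN F)
    have "F k ` T \<subseteq> holes \<Omega> l T n"
      unfolding holes_UN F using k(1) closure_subset[of T] by blast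
    then have "F k ` T \<subseteq> interior (holes \<Omega> l T n)" using Fop by (simp add: interior_maximal)
    then have "x \<notin> F k ` T" using x by blast
    then show "x \<in> (\<Union>k. F k ` frontier T)"
      using k(2) T(1) by (auto simp: frontier_def interior_open)
  qed
  moreover have "negligible (\<Union>k. F k ` frontier T)"
  proof (rule negligible_countable_Union)
    have "F k differentiable_on frontier T" for k
      unfolding F_def[abs_def] differentiable_on_def by (intro ballI derivative_intros)
    then have "negligible (F k ` frontier T)" for k
      by (intro negligible_differentiable_image_negligible negligible_frontier_smooth T) auto
    then show "negligible V" if "V \<in> range (\<lambda>k. F k ` frontier T)" for V
      using that by blast
  qed auto
  ultimately show ?thesis using negligible_subset by blast
qed

text \<open>
The lower corner of the cell of side lengths \<open>l / n\<close> that contains the point. A composition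
\<open>\<psi> \<circ> cell_corner l n\<close> is the piecewise constant approximation of \<open>\<psi>\<close> on the scale of the holes.
\<close>

definition cell_corner :: "real^'n \<Rightarrow> nat \<Rightarrow> real^'n \<Rightarrow> real^'n" where
  "cell_corner l n x = (\<chi> i. of_int \<lfloor>real n * x $ i / l $ i\<rfloor> * l $ i / real n)"

lemma cell_corner_measurable:
  fixes l :: "real^'n"
  shows "cell_corner l n \<in> borel_measurable borel"
proof -
  have "(\<lambda>x. cell_corner l n x $ i) \<in> borel_measurable borel" for i
  proof -
    have "(\<lambda>t :: real. of_int \<lfloor>real n * t / l $ i\<rfloor> * l $ i / real n) \<in> borel_measurable borel"
      by measurable
    moreover have "(\<lambda>x :: real^'n. x $ i) \<in> borel_measurable borel"
      by (intro borel_measurable_continuous_onI continuous_intros)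
    ultimately show ?thesis
      unfolding cell_corner_def vec_lambda_beta by (rule measurable_compose[rotated])
  qed
  then show ?thesis
    by (subst borel_measurable_euclidean_space) (auto simp: Basis_vec_def inner_axis)
qed

lemma cell_corner_close:
  assumes l: "\<And>i. 0 < l $ i" and n: "0 < n"
  shows "norm (cell_corner l n x - x) \<le> (\<Sum>i\<in>UNIV. l $ i) / real n"
proof -
  have "\<bar>cell_corner l n x $ i - x $ i\<bar> \<le> l $ i / real n" for i
  proof -
    define t where "t = real n * x $ i / l $ i"
    have x: "x $ i = t * (l $ i / real n)" using l[of i] n by (simp add: t_def)
    have "cell_corner l n x $ i - x $ i = (of_int \<lfloor>t\<rfloor> - t) * (l $ i / real n)"
      unfolding x left_diff_distrib by (simp add: cell_corner_def t_def)
    moreover have "\<bar>of_int \<lfloor>t\<rfloor> - t\<bar> \<le> 1" by linarith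
    ultimately show ?thesis
      using l[of i] n mult_right_mono[of "\<bar>of_int \<lfloor>t\<rfloor> - t\<bar>" 1 "l $ i / real n"] by (simp add: abs_mult)
  qed
  then have "(\<Sum>i\<in>UNIV. \<bar>(cell_corner l n x - x) $ i\<bar>) \<le> (\<Sum>i\<in>UNIV. l $ i / real n)"
    by (intro sum_mono) simp
  then show ?thesis
    using norm_le_l1_cart[of "cell_corner l n x - x"] by (simp add: sum_divide_distrib)
qed

text \<open>
Every hole lies in the interior of its cell, and \<open>cell_corner\<close> jumps only across cell faces.
\<close>

lemma cell_corner_locally_constant:
  assumes l: "\<And>i. 0 < l $ i" and n: "0 < n" and cl: "closure T \<subseteq> reference_cell l"
    and x: "x \<in> holes \<Omega> l T n"
  shows "\<forall>\<^sub>F y in nhds x. cell_corner l n y = cell_corner l n x"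
proof -
  obtain k z where z: "z \<in> closure T" and xz: "x = (1 / real n) *\<^sub>R ((\<chi> i. of_int (k $ i) * l $ i) + z)"
    using x by (auto simp: holes_UN hole_def)
  have "\<forall>\<^sub>F y in nhds x. \<lfloor>real n * y $ i / l $ i\<rfloor> = k $ i" for i
  proof -
    have "real n * x $ i / l $ i = of_int (k $ i) + z $ i / l $ i"
      using n l[of i] by (simp add: xz field_simps)
    moreover have "0 < z $ i / l $ i" "z $ i / l $ i < 1"
      using z cl l[of i] by (auto simp: reference_cell_def)
    ultimately have lt: "of_int (k $ i) < real n * x $ i / l $ i" "real n * x $ i / l $ i < of_int (k $ i) + 1"
      by auto
    have lim: "((\<lambda>y. real n * y $ i / l $ i) \<longlongrightarrow> real n * x $ i / l $ i) (nhds x)"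
      using l[of i] by (intro tendsto_intros filterlim_ident) auto
    show ?thesis
      using order_tendstoD(1)[OF lim lt(1)] order_tendstoD(2)[OF lim lt(2)]
      by eventually_elim (simp add: floor_unique)
  qed
  then have ev: "\<forall>\<^sub>F y in nhds x. \<forall>i. \<lfloor>real n * y $ i / l $ i\<rfloor> = k $ i" by (rule eventually_all_finite)
  then have "\<forall>i. \<lfloor>real n * x $ i / l $ i\<rfloor> = k $ i" by (rule eventually_nhds_x_imp_x)
  with ev show ?thesis by (auto simp: cell_corner_def elim: eventually_mono)
qed

section \<open>The weak formulation as a nonlocal identity\<close>

lemma L2_almost_full_subset:
  fixes u :: "'a::euclidean_space \<Rightarrow> real"
  assumes A: "A \<in> sets lebesgue" and neg: "negligible (A - A')" and A': "A' \<in> sets lebesgue" "A' \<subseteq> A"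
    and u: "u \<in> L2 A'"
  shows "u \<in> L2 A"
proof -
  have m: "u \<in> borel_measurable (lebesgue_on A)"
  proof -
    have "u measurable_on A'" using u A' by (simp add: L2_def measurable_on_iff_borel_measurable)
    then have "u measurable_on A"
      by (rule measurable_on_spike_set) (rule negligible_subset[OF neg], use A' in auto)
    then show ?thesis using A by (simp add: measurable_on_iff_borel_measurable)
  qed
  have AE: "AE x in lebesgue. x \<notin> A - A'"
    using neg unfolding negligible_iff_null_sets by (rule AE_not_in)
  have "integrable lebesgue (\<lambda>x. indicat_real A' x *\<^sub>R (u x)\<^sup>2)"
    using u A' by (simp add: L2_def integrable_restrict_space)
  moreover have "(\<lambda>x. indicat_real A x *\<^sub>R (u x)\<^sup>2) \<in> borel_measurable lebesgue"
    using m A by (subst borel_measurable_restrict_space_iff[symmetric]) auto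
  ultimately have "integrable lebesgue (\<lambda>x. indicat_real A x *\<^sub>R (u x)\<^sup>2)"
    using AE A'(2)
    by (elim integrable_cong_AE_imp) (auto elim!: eventually_mono simp: indicator_def)
  then have "integrable (lebesgue_on A) (\<lambda>x. (u x)\<^sup>2)"
    using A by (simp add: integrable_restrict_space)
  then show ?thesis using m by (simp add: L2_def)
qed

context bounded_region
begin

lemma subregion_sets_iff: "S \<subseteq> \<Omega> \<Longrightarrow> S \<in> sets M \<longleftrightarrow> S \<in> sets lebesgue"
  by (subst sets_restrict_space_iff) auto

lemma integral_subregion:
  fixes h :: "'a \<Rightarrow> real"
  assumes "S \<in> sets lebesgue" "S \<subseteq> \<Omega>"
  shows "(LINT x|lebesgue_on S. h x) = (LINT x|M. indicat_real S x * h x)"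
proof -
  have "(\<lambda>x. indicat_real \<Omega> x *\<^sub>R (indicat_real S x * h x)) = (\<lambda>x. indicat_real S x *\<^sub>R h x)"
    using assms(2) by (auto simp: fun_eq_iff split: split_indicator)
  then show ?thesis using assms(1) by (simp add: integral_restrict_space)
qed

lemma L2_subregion:
  fixes h :: "'a \<Rightarrow> real"
  assumes S: "S \<in> sets lebesgue" "S \<subseteq> \<Omega>" and h: "h \<in> L2 S"
  shows "(\<lambda>x. indicat_real S x * h x) \<in> L2 \<Omega>"
proof -
  have "(\<lambda>x. indicat_real S x *\<^sub>R h x) \<in> borel_measurable lebesgue"
    using h S by (subst borel_measurable_restrict_space_iff[symmetric]) (auto simp: L2_def)
  then have m: "(\<lambda>x. indicat_real S x * h x) \<in> borel_measurable M"
    by (simp add: measurable_restrict_space1)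
  have "integrable lebesgue (\<lambda>x. indicat_real S x *\<^sub>R (h x)\<^sup>2)"
    using h S by (simp add: L2_def integrable_restrict_space)
  moreover have "(\<lambda>x. indicat_real \<Omega> x *\<^sub>R (indicat_real S x * h x)\<^sup>2) = (\<lambda>x. indicat_real S x *\<^sub>R (h x)\<^sup>2)"
    using S by (auto simp: fun_eq_iff split: split_indicator)
  ultimately have "integrable M (\<lambda>x. (indicat_real S x * h x)\<^sup>2)"
    by (simp add: integrable_restrict_space)
  with m show ?thesis by (simp add: real_L2_iff)
qed

text \<open>
Multiplying out the two differences turns the double integral over \<open>P\<close> and \<open>Q\<close> into pairings
of zero-extended functions with convolutions; this is the form in which limits can be taken.
\<close>

lemma interaction_expansion:
  assumes K: "interaction_kernel K"
    and P: "P \<in> sets lebesgue" "P \<subseteq> \<Omega>" and Q: "Q \<in> sets lebesgue" "Q \<subseteq> \<Omega>"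
    and u: "(\<lambda>x. indicat_real P x * u x) \<in> L2 \<Omega>" and \<phi>: "(\<lambda>x. indicat_real P x * \<phi> x) \<in> L2 \<Omega>"
    and v: "(\<lambda>x. indicat_real Q x * v x) \<in> L2 \<Omega>" and \<theta>: "(\<lambda>x. indicat_real Q x * \<theta> x) \<in> L2 \<Omega>"
    and U: "U = (\<lambda>x. indicat_real P x * u x)" and \<Phi>: "\<Phi> = (\<lambda>x. indicat_real P x * \<phi> x)"
    and V: "V = (\<lambda>x. indicat_real Q x * v x)" and \<Theta>: "\<Theta> = (\<lambda>x. indicat_real Q x * \<theta> x)"
  shows "(LINT x|lebesgue_on P. LINT y|lebesgue_on Q. K (x - y) * (v y - u x) * (\<theta> y - \<phi> x))
    = (LINT x|M. V x * \<Theta> x * conv K (indicat_real P) x) - (LINT x|M. \<Phi> x * conv K V x)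
      - (LINT x|M. U x * conv K \<Theta> x) + (LINT x|M. U x * \<Phi> x * conv K (indicat_real Q) x)"
proof -
  note L = u[folded U] \<phi>[folded \<Phi>] v[folded V] \<theta>[folded \<Theta>]
  have PM: "P \<in> sets M" and QM: "Q \<in> sets M" using P Q by (simp_all add: subregion_sets_iff)
  have i: "integrable M (\<lambda>y. V y * \<Theta> y)" "integrable M (\<lambda>y. U y * \<Phi> y)" "integrable M V" "integrable M \<Theta>"
    "integrable M U" "integrable M \<Phi>" "integrable M (indicat_real Q)" "integrable M (indicat_real P)"
    using L PM QM by (simp_all add: L2_mult_integrable L2_integrable L2_indicator)
  have inner: "(LINT y|lebesgue_on Q. K (x - y) * (v y - u x) * (\<theta> y - \<phi> x))
      = conv K (\<lambda>y. V y * \<Theta> y) x - \<phi> x * conv K V x - u x * conv K \<Theta> x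
        + u x * \<phi> x * conv K (indicat_real Q) x" (is "_ = ?R") for x
  proof -
    have "(LINT y|lebesgue_on Q. K (x - y) * (v y - u x) * (\<theta> y - \<phi> x))
      = (LINT y|M. K (x - y) * (V y * \<Theta> y) - \<phi> x * (K (x - y) * V y) - u x * (K (x - y) * \<Theta> y)
          + u x * \<phi> x * (K (x - y) * indicat_real Q y))"
      unfolding integral_subregion[OF Q] V \<Theta>
      by (intro LINT_cong) (auto simp: indicator_def algebra_simps)
    also have "\<dots> = ?R" unfolding conv_def
      using conv_integrable[OF K i(1), of x] conv_integrable[OF K i(3), of x]
        conv_integrable[OF K i(4), of x] conv_integrable[OF K i(7), of x] by simp
    finally show ?thesis .
  qed
  have "(LINT x|lebesgue_on P. LINT y|lebesgue_on Q. K (x - y) * (v y - u x) * (\<theta> y - \<phi> x))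
    = (LINT x|M. indicat_real P x * conv K (\<lambda>y. V y * \<Theta> y) x - \<Phi> x * conv K V x - U x * conv K \<Theta> x
         + (U x * \<Phi> x) * conv K (indicat_real Q) x)"
    unfolding inner integral_subregion[OF P] U \<Phi>
    by (intro LINT_cong) (auto simp: indicator_def algebra_simps)
  also have "\<dots> = (LINT x|M. indicat_real P x * conv K (\<lambda>y. V y * \<Theta> y) x) - (LINT x|M. \<Phi> x * conv K V x)
      - (LINT x|M. U x * conv K \<Theta> x) + (LINT x|M. (U x * \<Phi> x) * conv K (indicat_real Q) x)"
    using conv_mult_integrable[OF K i(1) i(8)] conv_mult_integrable[OF K i(3) i(6)]
      conv_mult_integrable[OF K i(4) i(5)] conv_mult_integrable[OF K i(7) i(2)] by simp
  also have "(LINT x|M. indicat_real P x * conv K (\<lambda>y. V y * \<Theta> y) x)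
      = (LINT x|M. (V x * \<Theta> x) * conv K (indicat_real P) x)"
    by (rule conv_symmetric[OF K i(8) i(1)])
  finally show ?thesis .
qed

text \<open>
The nonlocal part of \<open>a\<^sub>n\<close> in terms of zero-extended functions: the first three terms are the
multiplication operators by the masses that a point sees in \<open>A\<close> and \<open>B\<close>, the last three are
compact.
\<close>

definition nonlocal_form ::
  "('a \<Rightarrow> real) \<Rightarrow> ('a \<Rightarrow> real) \<Rightarrow> 'a set \<Rightarrow> 'a set \<Rightarrow>
   ('a \<Rightarrow> real) \<Rightarrow> ('a \<Rightarrow> real) \<Rightarrow> ('a \<Rightarrow> real) \<Rightarrow> ('a \<Rightarrow> real) \<Rightarrow> real" where
  "nonlocal_form J G A B U V \<Phi> \<Theta> =
     (LINT x|M. U x * \<Phi> x * conv J (indicat_real B) x)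
     + (LINT x|M. V x * \<Theta> x * conv G (indicat_real B) x)
     + (LINT x|M. V x * \<Theta> x * conv J (indicat_real A) x)
     - (LINT x|M. \<Phi> x * conv J V x) - (LINT x|M. \<Theta> x * conv J U x) - (LINT x|M. \<Theta> x * conv G V x)"

end

lemma a_form_eq_nonlocal_form:
  fixes \<Omega> :: "(real^'n) set"
  assumes "bounded_region \<Omega>"
    and J: "interaction_kernel J" and G: "interaction_kernel G"
    and A: "A \<in> sets lebesgue" "A \<subseteq> \<Omega>" and B: "B \<in> sets lebesgue" "B \<subseteq> \<Omega>"
    and u: "u \<in> L2 A" and \<phi>: "\<phi> \<in> L2 A" and v: "v \<in> L2 B" and \<theta>: "\<theta> \<in> L2 B"
  shows "a_form J G A B u Du v \<phi> D\<phi> \<theta> = (LINT x|lebesgue_on A. Du x \<bullet> D\<phi> x)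
    + bounded_region.nonlocal_form \<Omega> J G A B (\<lambda>x. indicat_real A x * u x) (\<lambda>x. indicat_real B x * v x)
        (\<lambda>x. indicat_real A x * \<phi> x) (\<lambda>x. indicat_real B x * \<theta> x)"
proof -
  interpret bounded_region \<Omega> by fact
  define U V \<Phi> \<Theta> where "U = (\<lambda>x. indicat_real A x * u x)" and "V = (\<lambda>x. indicat_real B x * v x)"
    and "\<Phi> = (\<lambda>x. indicat_real A x * \<phi> x)" and "\<Theta> = (\<lambda>x. indicat_real B x * \<theta> x)"
  note L = L2_subregion[OF A u] L2_subregion[OF A \<phi>] L2_subregion[OF B v] L2_subregion[OF B \<theta>]
  note iU = L2_integrable[OF L(1), folded U_def] and i\<Phi> = L2_integrable[OF L(2), folded \<Phi>_def]
    and iV = L2_integrable[OF L(3), folded V_def] and i\<Theta> = L2_integrable[OF L(4), folded \<Theta>_def]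
  have GG: "(LINT x|lebesgue_on B. LINT y|lebesgue_on B. G (x - y) * (v y - v x) * (\<theta> y - \<theta> x))
    = 2 * (LINT x|M. V x * \<Theta> x * conv G (indicat_real B) x) - 2 * (LINT x|M. \<Theta> x * conv G V x)"
    using interaction_expansion[OF G B B L(3,4,3,4) V_def \<Theta>_def V_def \<Theta>_def]
      conv_symmetric[OF G iV i\<Theta>] by simp
  have JJ: "(LINT x|lebesgue_on A. LINT y|lebesgue_on B. J (x - y) * (v y - u x) * (\<theta> y - \<phi> x))
    = (LINT x|M. V x * \<Theta> x * conv J (indicat_real A) x) - (LINT x|M. \<Phi> x * conv J V x)
      - (LINT x|M. \<Theta> x * conv J U x) + (LINT x|M. U x * \<Phi> x * conv J (indicat_real B) x)"
    using interaction_expansion[OF J A B L U_def \<Phi>_def V_def \<Theta>_def]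
      conv_symmetric[OF J iU i\<Theta>] by simp
  show ?thesis
    unfolding a_form_def GG JJ nonlocal_form_def U_def[symmetric] V_def[symmetric] \<Phi>_def[symmetric] \<Theta>_def[symmetric]
    by simp
qed

text \<open>
Test pairs in the weak formulation must have total mean zero. Subtracting a common constant from
both components achieves this; it changes neither \<open>a\<^sub>n\<close>, which only sees differences and gradients,
nor the right-hand side, because \<open>f\<close> has mean zero. The gradient of \<open>u\<close> survives only in the
energy inequality, where it has a sign.
\<close>

lemma weak_solution_nonlocal_identities:
  fixes \<Omega> :: "(real^'n) set"
  assumes reg: "bounded_region \<Omega>"
    and J: "interaction_kernel J" and G: "interaction_kernel G"
    and A: "A \<in> sets lebesgue" "A \<subseteq> \<Omega>" "negligible (A - interior A)" and B: "B = \<Omega> - A"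
    and f: "f \<in> L2 \<Omega>" "(LINT x|lebesgue_on \<Omega>. f x) = 0"
    and sol: "weak_solution J G A B f un vn"
    and U: "U = (\<lambda>x. indicat_real A x * un x)" and V: "V = (\<lambda>x. indicat_real B x * vn x)"
  shows "U \<in> L2 \<Omega>" "V \<in> L2 \<Omega>" "(LINT x|lebesgue_on \<Omega>. U x) + (LINT x|lebesgue_on \<Omega>. V x) = 0"
    and "bounded_region.nonlocal_form \<Omega> J G A B U V U V
      \<le> - (LINT x|lebesgue_on \<Omega>. f x * U x) - (LINT x|lebesgue_on \<Omega>. f x * V x)"
    and "\<And>\<phi> \<theta>. \<phi> \<in> L2 \<Omega> \<Longrightarrow> \<theta> \<in> L2 \<Omega> \<Longrightarrow> (\<And>x. x \<in> A \<Longrightarrow> \<forall>\<^sub>F y in nhds x. \<phi> y = \<phi> x) \<Longrightarrow>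
      bounded_region.nonlocal_form \<Omega> J G A B U V
        (\<lambda>x. indicat_real A x * \<phi> x) (\<lambda>x. indicat_real B x * \<theta> x)
      = - (LINT x|lebesgue_on \<Omega>. f x * (indicat_real A x * \<phi> x))
        - (LINT x|lebesgue_on \<Omega>. f x * (indicat_real B x * \<theta> x))"
proof -
  interpret bounded_region \<Omega> by fact
  have Bs: "B \<in> sets lebesgue" "B \<subseteq> \<Omega>" using A B by auto
  have intA: "interior A \<in> sets lebesgue" "interior A \<subseteq> A" by (auto simp: interior_subset)
  have W: "(un, vn) \<in> W_space A B" using sol by (simp add: weak_solution_def)
  then have v: "vn \<in> L2 B" and un: "un \<in> L2 (interior A)" and mean: "(LINT x|lebesgue_on A. un x) + (LINT x|lebesgue_on B. vn x) = 0"
    and "\<exists>g. is_weak_gradient (interior A) un g" by (auto simp: W_space_def H1_def)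
  then obtain Du where Du: "is_weak_gradient (interior A) un Du" by blast
  have u: "un \<in> L2 A" by (rule L2_almost_full_subset[OF A(1,3) intA un])
  show UL: "U \<in> L2 \<Omega>" unfolding U by (rule L2_subregion[OF A(1,2) u])
  show VL: "V \<in> L2 \<Omega>" unfolding V by (rule L2_subregion[OF Bs v])
  show "(LINT x|M. U x) + (LINT x|M. V x) = 0"
    using mean unfolding integral_subregion[OF A(1,2)] integral_subregion[OF Bs] U V .
  have sub: "(LINT x|lebesgue_on A. f x * p x) = (LINT x|M. f x * (indicat_real A x * p x))"
    "(LINT x|lebesgue_on B. f x * p x) = (LINT x|M. f x * (indicat_real B x * p x))" for p
    unfolding integral_subregion[OF A(1,2)] integral_subregion[OF Bs] by (simp_all add: mult_ac)
  have "a_form J G A B un Du vn un Du vn = - (LINT x|M. f x * U x) - (LINT x|M. f x * V x)"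
    using sol W Du unfolding weak_solution_def sub U V by blast
  moreover have "0 \<le> (LINT x|lebesgue_on A. Du x \<bullet> Du x)" by simp
  ultimately show "nonlocal_form J G A B U V U V \<le> - (LINT x|M. f x * U x) - (LINT x|M. f x * V x)"
    unfolding a_form_eq_nonlocal_form[OF reg J G A(1,2) Bs u u v v] U V by linarith
  fix \<phi> \<theta> :: "real^'n \<Rightarrow> real"
  assume \<phi>: "\<phi> \<in> L2 \<Omega>" and \<theta>: "\<theta> \<in> L2 \<Omega>" and loc: "\<And>x. x \<in> A \<Longrightarrow> \<forall>\<^sub>F y in nhds x. \<phi> y = \<phi> x"
  have L2_restrict: "p \<in> L2 S" if "p \<in> L2 \<Omega>" "S \<in> sets lebesgue" "S \<subseteq> \<Omega>" for p :: "real^'n \<Rightarrow> real" and S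
  proof -
    have "S \<in> sets M" using that by (simp add: subregion_sets_iff)
    then have "p \<in> borel_measurable (restrict_space M S)" "integrable (restrict_space M S) (\<lambda>x. (p x)\<^sup>2)"
      using that integrable_mult_indicator[of S M "\<lambda>x. (p x)\<^sup>2"]
      by (auto simp: real_L2_iff integrable_restrict_space[of S M] inf.absorb1 intro: measurable_restrict_space1)
    moreover have "restrict_space M S = lebesgue_on S"
      using that(2,3) by (subst restrict_restrict_space) (auto simp: inf.absorb2)
    ultimately show ?thesis by (simp add: L2_def)
  qed
  \<comment> \<open>The common constant that has to be subtracted from \<open>\<phi>\<close> and \<open>\<theta>\<close> to reach mean zero.\<close>
  define c where "c = ((LINT x|lebesgue_on A. \<phi> x) + (LINT x|lebesgue_on B. \<theta> x)) / measure lebesgue \<Omega>"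
  have pos: "0 < measure lebesgue \<Omega>"
    using region_open region_nonempty
    by (metis region_bounded measure_le_0_iff not_less open_not_negligible negligible_iff_measure0 region_lmeasurable)
  let ?\<phi> = "\<lambda>x. \<phi> x - c" and ?\<theta> = "\<lambda>x. \<theta> x - c"
  have L: "?\<phi> \<in> L2 \<Omega>" "?\<theta> \<in> L2 \<Omega>" using \<phi> \<theta> by (auto intro: L2_diff)
  have grad: "is_weak_gradient (interior A) p (\<lambda>x. 0)" if "p = \<phi> \<or> p = ?\<phi>" for p
  proof (rule weak_gradient_locally_constant)
    fix x assume "x \<in> interior A"
    then have "\<forall>\<^sub>F y in nhds x. \<phi> y = \<phi> x" using loc intA by blast
    then show "\<forall>\<^sub>F y in nhds x. p y = p x" using that by (auto elim: eventually_mono)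
  qed simp
  have ind: "indicat_real A x + indicat_real B x = 1" if "x \<in> \<Omega>" for x
    using that B A by (auto simp: indicator_def)
  have "(LINT x|lebesgue_on A. ?\<phi> x) + (LINT x|lebesgue_on B. ?\<theta> x)
      = (LINT x|lebesgue_on A. \<phi> x) + (LINT x|lebesgue_on B. \<theta> x) - c * measure lebesgue \<Omega>"
  proof -
    note i = L2_integrable[OF L2_subregion[OF A(1,2) L2_restrict[OF \<phi> A(1,2)]]]
      L2_integrable[OF L2_subregion[OF Bs L2_restrict[OF \<theta> Bs]]]
      L2_integrable[OF L2_indicator, of A] L2_integrable[OF L2_indicator, of B]
    have "(LINT x|lebesgue_on A. ?\<phi> x) + (LINT x|lebesgue_on B. ?\<theta> x)
        = (LINT x|lebesgue_on A. \<phi> x) + (LINT x|lebesgue_on B. \<theta> x)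
          - c * ((LINT x|M. indicat_real A x) + (LINT x|M. indicat_real B x))"
      unfolding integral_subregion[OF A(1,2)] integral_subregion[OF Bs]
      using i A(1,2) Bs by (simp add: right_diff_distrib subregion_sets_iff algebra_simps)
    also have "(LINT x|M. indicat_real A x) + (LINT x|M. indicat_real B x)
        = (LINT x|M. indicat_real A x + indicat_real B x)"
      using i A(1,2) Bs by (simp add: subregion_sets_iff)
    also have "\<dots> = (LINT x|M. 1)" by (rule LINT_cong) (auto simp: ind)
    finally show ?thesis by (simp add: measure_restrict_space)
  qed
  also have "\<dots> = 0" using pos by (simp add: c_def)
  finally have "(?\<phi>, ?\<theta>) \<in> W_space A B"
    using L2_restrict[OF L(1) intA(1)] L2_restrict[OF L(2) Bs] intA A(2) grad[of ?\<phi>]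
    unfolding W_space_def H1_def by auto
  then have "a_form J G A B un Du vn ?\<phi> (\<lambda>x. 0) ?\<theta>
      = - (LINT x|lebesgue_on A. f x * ?\<phi> x) - (LINT x|lebesgue_on B. f x * ?\<theta> x)"
    using sol Du grad[of ?\<phi>] unfolding weak_solution_def by blast
  moreover have "a_form J G A B un Du vn ?\<phi> (\<lambda>x. 0) ?\<theta> = a_form J G A B un Du vn \<phi> (\<lambda>x. 0) \<theta>"
    by (simp add: a_form_def)
  moreover have "- (LINT x|lebesgue_on A. f x * ?\<phi> x) - (LINT x|lebesgue_on B. f x * ?\<theta> x)
      = - (LINT x|M. f x * (indicat_real A x * \<phi> x)) - (LINT x|M. f x * (indicat_real B x * \<theta> x))"
  proof -
    have AM: "A \<in> sets M" "B \<in> sets M" using A Bs by (simp_all add: subregion_sets_iff)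
    note i = L2_mult_integrable[OF f(1) L2_indicator_mult[OF \<phi> AM(1)]]
      L2_mult_integrable[OF f(1) L2_indicator_mult[OF \<theta> AM(2)]]
      L2_mult_integrable[OF f(1) L2_indicator[OF AM(1)]] L2_mult_integrable[OF f(1) L2_indicator[OF AM(2)]]
    have "(LINT x|lebesgue_on A. f x * ?\<phi> x) + (LINT x|lebesgue_on B. f x * ?\<theta> x)
      = (LINT x|M. f x * (indicat_real A x * \<phi> x)) + (LINT x|M. f x * (indicat_real B x * \<theta> x))
        - c * ((LINT x|M. f x * indicat_real A x) + (LINT x|M. f x * indicat_real B x))"
    proof -
      have "(LINT x|lebesgue_on A. f x * ?\<phi> x)
          = (LINT x|M. f x * (indicat_real A x * \<phi> x) - c * (f x * indicat_real A x))"
        unfolding integral_subregion[OF A(1,2)]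
        by (intro LINT_cong) (auto simp: algebra_simps)
      moreover have "(LINT x|lebesgue_on B. f x * ?\<theta> x)
          = (LINT x|M. f x * (indicat_real B x * \<theta> x) - c * (f x * indicat_real B x))"
        unfolding integral_subregion[OF Bs]
        by (intro LINT_cong) (auto simp: algebra_simps)
      ultimately show ?thesis using i by (simp add: distrib_left)
    qed
    also have "(LINT x|M. f x * indicat_real A x) + (LINT x|M. f x * indicat_real B x)
        = (LINT x|M. f x * indicat_real A x + f x * indicat_real B x)"
      using i by simp
    also have "\<dots> = (LINT x|M. f x)"
      by (rule LINT_cong) (auto simp: ind simp flip: distrib_left)
    finally show ?thesis using f(2) by simp
  qed
  ultimately show "nonlocal_form J G A B U V (\<lambda>x. indicat_real A x * \<phi> x) (\<lambda>x. indicat_real B x * \<theta> x)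
      = - (LINT x|M. f x * (indicat_real A x * \<phi> x)) - (LINT x|M. f x * (indicat_real B x * \<theta> x))"
    using a_form_eq_nonlocal_form[OF reg J G A(1,2) Bs u L2_restrict[OF \<phi> A(1,2)] v L2_restrict[OF \<theta> Bs],
        of Du "\<lambda>x. 0"] by (simp add: U V)
qed

section \<open>Strong and weak convergence\<close>

context bounded_region
begin

definition L2_null :: "(nat \<Rightarrow> 'a \<Rightarrow> real) \<Rightarrow> bool" where
  "L2_null h \<longleftrightarrow> (\<forall>n. h n \<in> L2 \<Omega>) \<and> (\<lambda>n. LINT x|M. (h n x)\<^sup>2) \<longlonglongrightarrow> 0"

definition L2_bdd :: "(nat \<Rightarrow> 'a \<Rightarrow> real) \<Rightarrow> bool" where
  "L2_bdd w \<longleftrightarrow> (\<forall>n. w n \<in> L2 \<Omega>) \<and> (\<exists>C. \<forall>n. (LINT x|M. (w n x)\<^sup>2) \<le> C)"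

lemma L2_null_bdd_product:
  assumes "L2_bdd w" "L2_null h"
  shows "(\<lambda>n. LINT x|M. w n x * h n x) \<longlonglongrightarrow> 0"
proof -
  obtain C where w: "\<And>n. w n \<in> L2 \<Omega>" "\<And>n. (LINT x|M. (w n x)\<^sup>2) \<le> C"
    using assms(1) unfolding L2_bdd_def by blast
  have h: "\<And>n. h n \<in> L2 \<Omega>" "(\<lambda>n. LINT x|M. (h n x)\<^sup>2) \<longlonglongrightarrow> 0"
    using assms(2) unfolding L2_null_def by blast+
  show ?thesis
  proof (rule Lim_null_comparison)
    have "norm (LINT x|M. w n x * h n x) \<le> sqrt C * sqrt (LINT x|M. (h n x)\<^sup>2)" for n
      unfolding real_norm_def
      by (rule order_trans[OF L2_Cauchy_Schwarz[OF w(1) h(1)]]) (intro mult_right_mono, auto simp: w(2))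
    then show "\<forall>\<^sub>F n in sequentially. norm (LINT x|M. w n x * h n x)
        \<le> sqrt C * sqrt (LINT x|M. (h n x)\<^sup>2)" by simp
    show "(\<lambda>n. sqrt C * sqrt (LINT x|M. (h n x)\<^sup>2)) \<longlonglongrightarrow> 0"
      using tendsto_mult_left[OF tendsto_real_sqrt[OF h(2)], of "sqrt C"] by simp
  qed
qed

lemma integral_square_sum_le:
  fixes a b :: "'a \<Rightarrow> real"
  assumes a: "a \<in> L2 \<Omega>" and b: "b \<in> L2 \<Omega>"
  shows "(LINT x|M. (a x + b x)\<^sup>2) \<le> 2 * (LINT x|M. (a x)\<^sup>2) + 2 * (LINT x|M. (b x)\<^sup>2)"
proof -
  have "(LINT x|M. (a x + b x)\<^sup>2) \<le> (LINT x|M. 2 * (a x)\<^sup>2 + 2 * (b x)\<^sup>2)"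
  proof (rule integral_mono)
    show "(a x + b x)\<^sup>2 \<le> 2 * (a x)\<^sup>2 + 2 * (b x)\<^sup>2" for x
      using sum_squares_bound[of "a x" "b x"] by (simp add: power2_sum)
  qed (use L2D(2)[OF L2_add[OF a b]] L2D(2)[OF a] L2D(2)[OF b] in auto)
  then show ?thesis using L2D(2)[OF a] L2D(2)[OF b] by simp
qed

lemma integral_square_mult_le:
  fixes a b :: "'a \<Rightarrow> real"
  assumes a: "a \<in> L2 \<Omega>" and b: "b \<in> borel_measurable M" "\<And>x. x \<in> \<Omega> \<Longrightarrow> \<bar>b x\<bar> \<le> D"
  shows "(LINT x|M. (b x * a x)\<^sup>2) \<le> D\<^sup>2 * (LINT x|M. (a x)\<^sup>2)"
proof -
  have "(LINT x|M. (b x * a x)\<^sup>2) \<le> (LINT x|M. D\<^sup>2 * (a x)\<^sup>2)"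
  proof (rule integral_mono)
    show "integrable M (\<lambda>x. (b x * a x)\<^sup>2)" by (rule L2D(2)[OF L2_bounded_mult[OF a b]])
    fix x assume "x \<in> space M"
    then show "(b x * a x)\<^sup>2 \<le> D\<^sup>2 * (a x)\<^sup>2"
      using power_mono[OF b(2), of x 2] by (simp add: power_mult_distrib mult_right_mono)
  qed (use L2D(2)[OF a] in simp)
  then show ?thesis by simp
qed

lemma L2_null_add:
  assumes "L2_null a" "L2_null b"
  shows "L2_null (\<lambda>n x. a n x + b n x)"
proof -
  have L: "a n \<in> L2 \<Omega>" "b n \<in> L2 \<Omega>" for n using assms by (auto simp: L2_null_def)
  have "(\<lambda>n. LINT x|M. (a n x + b n x)\<^sup>2) \<longlonglongrightarrow> 0"
  proof (rule tendsto_sandwich[OF _ _ tendsto_const])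
    show "(\<lambda>n. 2 * (LINT x|M. (a n x)\<^sup>2) + 2 * (LINT x|M. (b n x)\<^sup>2)) \<longlonglongrightarrow> 0"
      using assms unfolding L2_null_def by (auto intro!: tendsto_eq_intros)
  qed (auto intro!: always_eventually integral_square_sum_le L)
  then show ?thesis using L by (auto simp: L2_null_def intro: L2_add)
qed

lemma L2_null_mult:
  assumes a: "L2_null a" and b: "\<And>n. b n \<in> borel_measurable M" "\<And>n x. x \<in> \<Omega> \<Longrightarrow> \<bar>b n x\<bar> \<le> D"
  shows "L2_null (\<lambda>n x. b n x * a n x)"
proof -
  have L: "a n \<in> L2 \<Omega>" for n using a by (auto simp: L2_null_def)
  have "(\<lambda>n. LINT x|M. (b n x * a n x)\<^sup>2) \<longlonglongrightarrow> 0"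
  proof (rule tendsto_sandwich[OF _ _ tendsto_const])
    show "(\<lambda>n. D\<^sup>2 * (LINT x|M. (a n x)\<^sup>2)) \<longlonglongrightarrow> 0"
      using a unfolding L2_null_def by (auto intro!: tendsto_eq_intros)
  qed (auto intro!: always_eventually integral_square_mult_le L b)
  then show ?thesis using L by (auto simp: L2_null_def intro: L2_bounded_mult b)
qed

lemma L2_null_cmult: "L2_null a \<Longrightarrow> L2_null (\<lambda>n x. c * a n x)"
  by (rule L2_null_mult[where D = "\<bar>c\<bar>"]) auto

lemma L2_null_diff: "L2_null a \<Longrightarrow> L2_null b \<Longrightarrow> L2_null (\<lambda>n x. a n x - b n x)"
  using L2_null_add[OF _ L2_null_cmult[of b "-1"]] by simp

lemma L2_null_subseq: "L2_null a \<Longrightarrow> strict_mono r \<Longrightarrow> L2_null (\<lambda>n. a (r n))"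
  unfolding L2_null_def using LIMSEQ_subseq_LIMSEQ[of "\<lambda>n. LINT x|M. (a n x)\<^sup>2" 0 r] by (simp add: o_def)

lemma L2_null_uniform:
  assumes "\<And>n. h n \<in> L2 \<Omega>" "uniform_limit \<Omega> h (\<lambda>x. 0) sequentially"
  shows "L2_null h"
  using assms uniform_imp_L2_vanishing by (auto simp: L2_null_def)

lemma L2_bdd_of_null:
  assumes "L2_null (\<lambda>n x. h n x - h0 x)" "h0 \<in> L2 \<Omega>"
  shows "L2_bdd h"
proof -
  have L: "(\<lambda>x. h n x - h0 x) \<in> L2 \<Omega>" for n using assms by (auto simp: L2_null_def)
  have hL: "h n \<in> L2 \<Omega>" for n using L2_add[OF L assms(2), of n] by simp
  have "Bseq (\<lambda>n. LINT x|M. (h n x - h0 x)\<^sup>2)"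
    using assms(1) unfolding L2_null_def by (meson convergentI convergent_imp_Bseq)
  then obtain D where D: "(LINT x|M. (h n x - h0 x)\<^sup>2) \<le> D" for n
    unfolding Bseq_def by (metis abs_le_D1 real_norm_def)
  have "(LINT x|M. (h n x)\<^sup>2) \<le> 2 * D + 2 * (LINT x|M. (h0 x)\<^sup>2)" for n
    using integral_square_sum_le[OF L assms(2), of n] D[of n] by simp
  then show ?thesis using hL by (auto simp: L2_bdd_def)
qed

lemma L2_bdd_mult:
  assumes a: "L2_bdd a" and b: "\<And>n. b n \<in> borel_measurable M" "\<And>n x. x \<in> \<Omega> \<Longrightarrow> \<bar>b n x\<bar> \<le> D"
  shows "L2_bdd (\<lambda>n x. b n x * a n x)"
proof -
  obtain C where C: "\<And>n. a n \<in> L2 \<Omega>" "\<And>n. (LINT x|M. (a n x)\<^sup>2) \<le> C"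
    using a by (auto simp: L2_bdd_def)
  have "(LINT x|M. (b n x * a n x)\<^sup>2) \<le> D\<^sup>2 * C" for n
    by (rule order_trans[OF integral_square_mult_le[OF C(1) b] mult_left_mono[OF C(2)]]) auto
  then show ?thesis using C(1) by (auto simp: L2_bdd_def intro: L2_bounded_mult b)
qed

lemma L2_bdd_subseq: "L2_bdd a \<Longrightarrow> L2_bdd (\<lambda>n. a (r n))"
  by (auto simp: L2_bdd_def)

lemma L2_bdd_indicator: "(\<And>n. S n \<in> sets M) \<Longrightarrow> L2_bdd (\<lambda>n. indicat_real (S n))"
proof -
  assume S: "\<And>n. S n \<in> sets M"
  have "L2_bdd (\<lambda>n x. 1)" by (auto simp: L2_bdd_def)
  from L2_bdd_mult[OF this, of "\<lambda>n. indicat_real (S n)" 1] S show ?thesis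
    by (simp add: indicator_le_1)
qed

text \<open>
Truncate \<open>g\<close>, then approximate the bounded function almost everywhere by continuous functions
with the same bound; dominated convergence applies to both steps.
\<close>

lemma L2_dense_continuous:
  fixes g :: "'a \<Rightarrow> real"
  assumes g: "g \<in> L2 \<Omega>" and e: "0 < e"
  obtains \<psi> where "continuous_on UNIV \<psi>" "(LINT x|M. (g x - \<psi> x)\<^sup>2) < e"
proof -
  define clip :: "real \<Rightarrow> real \<Rightarrow> real" where "clip k t = max (- k) (min k t)" for k t
  have clip_cont: "continuous_on UNIV (clip k)" for k
    unfolding clip_def by (intro continuous_intros)
  have clip_meas: "clip k \<in> borel_measurable borel" for k
    by (intro borel_measurable_continuous_onI clip_cont)
  have gm: "g \<in> borel_measurable M" using g by (rule L2D)
  have 1: "(\<lambda>k. LINT x|M. (g x - clip (real k) (g x))\<^sup>2) \<longlonglongrightarrow> (LINT x|M. 0)"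
  proof (rule integral_dominated_convergence)
    show "integrable M (\<lambda>x. (g x)\<^sup>2)" using g by (rule L2D)
    show "AE x in M. norm ((g x - clip (real k) (g x))\<^sup>2) \<le> (g x)\<^sup>2" for k
      by (intro AE_I2) (auto simp: clip_def abs_le_square_iff[symmetric])
    show "AE x in M. (\<lambda>k. (g x - clip (real k) (g x))\<^sup>2) \<longlonglongrightarrow> 0"
    proof (rule AE_I2)
      fix x
      obtain k0 :: nat where "\<bar>g x\<bar> \<le> real k0" using real_arch_simple by blast
      then have "\<forall>\<^sub>F k in sequentially. (g x - clip (real k) (g x))\<^sup>2 = 0"
        by (intro eventually_sequentiallyI[of k0]) (auto simp: clip_def max_def min_def)
      then show "(\<lambda>k. (g x - clip (real k) (g x))\<^sup>2) \<longlonglongrightarrow> 0" by (rule tendsto_eventually)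
    qed
    show "(\<lambda>x. (g x - clip (real k) (g x))\<^sup>2) \<in> borel_measurable M" for k
      by (intro borel_measurable_power borel_measurable_diff gm measurable_compose[OF gm clip_meas])
  qed simp
  then obtain k :: nat where k: "(LINT x|M. (g x - clip (real k) (g x))\<^sup>2) < e / 4"
    using LIMSEQ_D[OF 1, of "e / 4"] e by fastforce
  define h where "h x = clip (real k) (g x)" for x
  have hm: "h \<in> borel_measurable M"
    unfolding h_def by (rule measurable_compose[OF gm clip_meas])
  have "g measurable_on \<Omega>" using gm by (simp add: measurable_on_iff_borel_measurable)
  then obtain N p where N: "negligible N" and p: "\<And>n. continuous_on UNIV (p n)"
      "\<And>x. x \<notin> N \<Longrightarrow> (\<lambda>n. p n x) \<longlonglongrightarrow> (if x \<in> \<Omega> then g x else 0)"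
    unfolding measurable_on_def by blast
  define p' where "p' n x = clip (real k) (p n x)" for n :: nat and x
  have p': "continuous_on UNIV (p' n)" for n
    unfolding p'_def by (rule continuous_on_compose2[OF clip_cont p(1)]) auto
  have 2: "(\<lambda>n. LINT x|M. (h x - p' n x)\<^sup>2) \<longlonglongrightarrow> (LINT x|M. 0)"
  proof (rule integral_dominated_convergence)
    show "integrable M (\<lambda>x. (2 * real k)\<^sup>2)" by simp
    show "AE x in M. norm ((h x - p' n x)\<^sup>2) \<le> (2 * real k)\<^sup>2" for n
    proof (intro AE_I2)
      fix x
      have "\<bar>h x - p' n x\<bar> \<le> \<bar>2 * real k\<bar>" unfolding h_def p'_def clip_def by auto
      then show "norm ((h x - p' n x)\<^sup>2) \<le> (2 * real k)\<^sup>2"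
        unfolding real_norm_def abs_power2 by (rule abs_le_square_iff[THEN iffD1])
    qed
    have "AE x in lebesgue. x \<notin> N"
      using N by (simp add: AE_not_in negligible_iff_null_sets)
    then have "AE x in M. x \<notin> N" by (subst AE_restrict_space_iff) (auto elim: eventually_mono)
    then show "AE x in M. (\<lambda>n. (h x - p' n x)\<^sup>2) \<longlonglongrightarrow> 0"
    proof (rule AE_mp, intro AE_I2 impI)
      fix x assume x: "x \<in> space M" "x \<notin> N"
      have "(\<lambda>n. p n x) \<longlonglongrightarrow> g x" using p(2)[OF x(2)] x by simp
      then have "(\<lambda>n. p' n x) \<longlonglongrightarrow> h x"
        unfolding p'_def h_def clip_def by (intro tendsto_intros)
      then have "(\<lambda>n. (h x - p' n x)\<^sup>2) \<longlonglongrightarrow> (h x - h x)\<^sup>2" by (intro tendsto_intros)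
      then show "(\<lambda>n. (h x - p' n x)\<^sup>2) \<longlonglongrightarrow> 0" by simp
    qed
    show "(\<lambda>x. (h x - p' n x)\<^sup>2) \<in> borel_measurable M" for n
      by (intro borel_measurable_power borel_measurable_diff hm continuous_measurable
          continuous_on_subset[OF p']) auto
  qed simp
  then obtain n where n: "(LINT x|M. (h x - p' n x)\<^sup>2) < e / 4"
    using LIMSEQ_D[OF 2, of "e / 4"] e by fastforce
  have hL: "h \<in> L2 \<Omega>" by (rule L2_bounded[OF hm, of "real k"]) (auto simp: h_def clip_def)
  have pL: "p' n \<in> L2 \<Omega>" by (rule L2_continuous[OF p'])
  have "(LINT x|M. (g x - p' n x)\<^sup>2) \<le> (LINT x|M. 2 * (g x - h x)\<^sup>2 + 2 * (h x - p' n x)\<^sup>2)"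
  proof (rule integral_mono)
    show "integrable M (\<lambda>x. (g x - p' n x)\<^sup>2)" using L2_diff[OF g pL] by (rule L2D)
    show "integrable M (\<lambda>x. 2 * (g x - h x)\<^sup>2 + 2 * (h x - p' n x)\<^sup>2)"
      using L2D(2)[OF L2_diff[OF g hL]] L2D(2)[OF L2_diff[OF hL pL]] by simp
    show "(g x - p' n x)\<^sup>2 \<le> 2 * (g x - h x)\<^sup>2 + 2 * (h x - p' n x)\<^sup>2" for x
      using sum_squares_bound[of "g x - h x" "h x - p' n x"]
      by (simp add: power2_eq_square algebra_simps)
  qed
  also have "\<dots> = 2 * (LINT x|M. (g x - h x)\<^sup>2) + 2 * (LINT x|M. (h x - p' n x)\<^sup>2)"
    using L2D(2)[OF L2_diff[OF g hL]] L2D(2)[OF L2_diff[OF hL pL]] by simp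
  also have "\<dots> < e" using k n by (simp add: h_def)
  finally show ?thesis using that p' by blast
qed

lemma weakly_tendsto_of_continuous:
  assumes W: "L2_bdd W" and w: "w \<in> L2 \<Omega>"
    and lim: "\<And>\<psi>. continuous_on UNIV \<psi> \<Longrightarrow>
      (\<lambda>n. LINT x|M. W n x * \<psi> x) \<longlonglongrightarrow> (LINT x|M. w x * \<psi> x)"
  shows "L2_weakly_tendsto \<Omega> W w"
  unfolding L2_weakly_tendsto_def
proof
  fix g :: "'a \<Rightarrow> real" assume g: "g \<in> L2 \<Omega>"
  obtain C where WL: "\<And>n. W n \<in> L2 \<Omega>" and C: "\<And>n. (LINT x|M. (W n x)\<^sup>2) \<le> C"
    using W by (auto simp: L2_bdd_def)
  define D where "D = sqrt C + sqrt (LINT x|M. (w x)\<^sup>2) + 1"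
  have "0 \<le> C" using order_trans[OF _ C[of 0]] by simp
  then have D: "0 < D" by (simp add: D_def add_nonneg_pos)
  show "(\<lambda>n. LINT x|M. W n x * g x) \<longlonglongrightarrow> (LINT x|M. w x * g x)"
  proof (rule LIMSEQ_I)
    fix e :: real assume e: "0 < e"
    have "0 < (e / (2 * D))\<^sup>2" using e D by simp
    then obtain \<psi> where \<psi>: "continuous_on UNIV \<psi>" "(LINT x|M. (g x - \<psi> x)\<^sup>2) < (e / (2 * D))\<^sup>2"
      using L2_dense_continuous[OF g] by blast
    have \<psi>L: "\<psi> \<in> L2 \<Omega>" by (rule L2_continuous[OF \<psi>(1)])
    have dL: "(\<lambda>x. g x - \<psi> x) \<in> L2 \<Omega>" by (rule L2_diff[OF g \<psi>L])
    define d where "d = sqrt (LINT x|M. (g x - \<psi> x)\<^sup>2)"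
    have d: "d < e / (2 * D)" "0 \<le> d"
      using real_sqrt_less_mono[OF \<psi>(2)] e D by (auto simp: d_def)
    obtain N where N: "\<And>n. n \<ge> N \<Longrightarrow> \<bar>(LINT x|M. W n x * \<psi> x) - (LINT x|M. w x * \<psi> x)\<bar> < e / 2"
      using LIMSEQ_D[OF lim[OF \<psi>(1)], of "e / 2"] e by auto
    have split: "(LINT x|M. a x * g x) = (LINT x|M. a x * \<psi> x) + (LINT x|M. a x * (g x - \<psi> x))"
      if "a \<in> L2 \<Omega>" for a
      using L2_mult_integrable[OF that g] L2_mult_integrable[OF that \<psi>L]
      by (simp add: right_diff_distrib)
    have "norm ((LINT x|M. W n x * g x) - (LINT x|M. w x * g x)) < e" if n: "n \<ge> N" for n
    proof -
      have "\<bar>LINT x|M. W n x * (g x - \<psi> x)\<bar> \<le> sqrt C * d"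
        unfolding d_def
        by (rule order_trans[OF L2_Cauchy_Schwarz[OF WL dL]]) (intro mult_right_mono, auto simp: C)
      moreover have "\<bar>LINT x|M. w x * (g x - \<psi> x)\<bar> \<le> sqrt (LINT x|M. (w x)\<^sup>2) * d"
        unfolding d_def by (rule L2_Cauchy_Schwarz[OF w dL])
      moreover have "(sqrt C + sqrt (LINT x|M. (w x)\<^sup>2)) * d \<le> D * d"
        using d by (intro mult_right_mono) (auto simp: D_def)
      moreover have "D * d < e / 2" using d D by (simp add: field_simps)
      ultimately show ?thesis
        using N[OF n] unfolding split[OF WL] split[OF w] real_norm_def distrib_right by linarith
    qed
    then show "\<exists>N. \<forall>n\<ge>N. norm ((LINT x|M. W n x * g x) - (LINT x|M. w x * g x)) < e" by blast
  qed
qed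

lemma weakstar_indicatorD:
  assumes "Linf_weakstar_tendsto \<Omega> (\<lambda>n. indicat_real (S n)) (\<lambda>x. \<sigma>)" "integrable M g"
  shows "(\<lambda>n. LINT x|M. indicat_real (S n) x * g x) \<longlonglongrightarrow> \<sigma> * (LINT x|M. g x)"
  using assms unfolding Linf_weakstar_tendsto_def by auto

text \<open>
The equation \<open>k\<^sub>n W\<^sub>n = \<chi>\<^bsub>S\<^sub>n\<^esub> h\<^sub>n\<close>, valid asymptotically against continuous functions, passes to the
limit \<open>W = \<sigma> h / k\<close>: the coefficients \<open>k\<^sub>n\<close> and \<open>h\<^sub>n\<close> converge strongly, so that each product
contains only one weakly convergent factor. Dividing the test function by \<open>k\<close> isolates \<open>W\<close>.
\<close>

lemma weak_limit_of_quotient: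
  assumes S: "\<And>n. S n \<in> sets M" and \<sigma>: "Linf_weakstar_tendsto \<Omega> (\<lambda>n. indicat_real (S n)) (\<lambda>x. \<sigma>)"
    and W: "L2_bdd W"
    and k: "\<And>n. continuous_on UNIV (k n)" "continuous_on UNIV k0" "L2_null (\<lambda>n x. k n x - k0 x)"
    and h: "L2_null (\<lambda>n x. h n x - h0 x)" "h0 \<in> L2 \<Omega>"
    and c: "0 < c" "\<And>x. x \<in> \<Omega> \<Longrightarrow> c \<le> k0 x"
    and eq: "\<And>\<psi>. continuous_on UNIV \<psi> \<Longrightarrow>
      (\<lambda>n. (LINT x|M. W n x * (k n x * \<psi> x)) - (LINT x|M. indicat_real (S n) x * (\<psi> x * h n x))) \<longlonglongrightarrow> 0"
  shows "(\<lambda>x. \<sigma> * h0 x / k0 x) \<in> L2 \<Omega>" "L2_weakly_tendsto \<Omega> W (\<lambda>x. \<sigma> * h0 x / k0 x)"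
proof -
  have k0m: "k0 \<in> borel_measurable M"
    by (intro continuous_measurable continuous_on_subset[OF k(2)]) simp
  have "\<bar>\<sigma> / k0 x\<bar> \<le> \<bar>\<sigma>\<bar> / c" if "x \<in> \<Omega>" for x
    using c(2)[OF that] c(1) by (simp add: frac_le)
  then have "(\<lambda>x. \<sigma> / k0 x * h0 x) \<in> L2 \<Omega>"
    by (intro L2_bounded_mult[OF h(2)]) (auto intro!: borel_measurable_divide k0m)
  then show wL: "(\<lambda>x. \<sigma> * h0 x / k0 x) \<in> L2 \<Omega>" by simp
  show "L2_weakly_tendsto \<Omega> W (\<lambda>x. \<sigma> * h0 x / k0 x)"
  proof (rule weakly_tendsto_of_continuous[OF W wL])
    fix \<psi>' :: "'a \<Rightarrow> real" assume \<psi>': "continuous_on UNIV \<psi>'"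
    \<comment> \<open>On \<open>\<Omega>\<close> the maximum is \<open>k0\<close>; elsewhere it keeps \<open>\<psi>\<close> continuous.\<close>
    define \<psi> where "\<psi> x = \<psi>' x / max (k0 x) c" for x
    have \<psi>: "continuous_on UNIV \<psi>" unfolding \<psi>_def
      using c(1) by (intro continuous_intros \<psi>' k(2)) (auto simp: max_def)
    have \<psi>eq: "k0 x * \<psi> x = \<psi>' x" "\<psi> x = \<psi>' x / k0 x" if "x \<in> \<Omega>" for x
      using c(2)[OF that] c(1) by (auto simp: \<psi>_def max_def)
    obtain D where "0 < D" and D: "\<And>x. x \<in> \<Omega> \<Longrightarrow> \<bar>\<psi> x\<bar> \<le> D" using continuous_bounded_on_region[OF \<psi>] by metis
    have \<psi>m: "\<psi> \<in> borel_measurable M" by (intro continuous_measurable continuous_on_subset[OF \<psi>]) simp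
    have WL: "W n \<in> L2 \<Omega>" and hL: "h n \<in> L2 \<Omega>" for n
      using W L2_bdd_of_null[OF h] by (auto simp: L2_bdd_def)
    have i: "integrable M (\<lambda>x. W n x * (k n x * \<psi> x))" "integrable M (\<lambda>x. W n x * (k0 x * \<psi> x))"
      "integrable M (\<lambda>x. indicat_real (S n) x * (\<psi> x * h n x))"
      "integrable M (\<lambda>x. indicat_real (S n) x * (\<psi> x * h0 x))" for n
      by (intro L2_mult_integrable WL L2_indicator S L2_continuous_mult k(1,2) \<psi> hL h(2) L2_continuous)+
    have null_k: "(\<lambda>n. LINT x|M. W n x * (\<psi> x * (k n x - k0 x))) \<longlonglongrightarrow> 0"
      by (rule L2_null_bdd_product[OF W L2_null_mult[OF k(3) \<psi>m D]])
    have null_h: "(\<lambda>n. LINT x|M. indicat_real (S n) x * (\<psi> x * (h n x - h0 x))) \<longlonglongrightarrow> 0"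
      by (rule L2_null_bdd_product[OF L2_bdd_indicator[OF S] L2_null_mult[OF h(1) \<psi>m D]])
    have main: "(\<lambda>n. LINT x|M. indicat_real (S n) x * (\<psi> x * h0 x)) \<longlonglongrightarrow> \<sigma> * (LINT x|M. \<psi> x * h0 x)"
      by (rule weakstar_indicatorD[OF \<sigma>]) (intro L2_integrable L2_continuous_mult \<psi> h)
    have "(LINT x|M. W n x * \<psi>' x)
        = ((LINT x|M. W n x * (k n x * \<psi> x)) - (LINT x|M. indicat_real (S n) x * (\<psi> x * h n x)))
          - (LINT x|M. W n x * (\<psi> x * (k n x - k0 x)))
          + (LINT x|M. indicat_real (S n) x * (\<psi> x * (h n x - h0 x)))
          + (LINT x|M. indicat_real (S n) x * (\<psi> x * h0 x))" for n
    proof -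
      have "(LINT x|M. W n x * (\<psi> x * (k n x - k0 x)))
          = (LINT x|M. W n x * (k n x * \<psi> x) - W n x * (k0 x * \<psi> x))"
        by (intro LINT_cong) (auto simp: algebra_simps)
      then have 1: "(LINT x|M. W n x * (\<psi> x * (k n x - k0 x)))
          = (LINT x|M. W n x * (k n x * \<psi> x)) - (LINT x|M. W n x * (k0 x * \<psi> x))"
        using i by simp
      have "(LINT x|M. indicat_real (S n) x * (\<psi> x * (h n x - h0 x)))
          = (LINT x|M. indicat_real (S n) x * (\<psi> x * h n x) - indicat_real (S n) x * (\<psi> x * h0 x))"
        by (intro LINT_cong) (auto simp: algebra_simps)
      then have 2: "(LINT x|M. indicat_real (S n) x * (\<psi> x * (h n x - h0 x)))
          = (LINT x|M. indicat_real (S n) x * (\<psi> x * h n x)) - (LINT x|M. indicat_real (S n) x * (\<psi> x * h0 x))"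
        using i by simp
      have 3: "(LINT x|M. W n x * \<psi>' x) = (LINT x|M. W n x * (k0 x * \<psi> x))"
        by (intro LINT_cong) (auto simp: \<psi>eq(1))
      show ?thesis unfolding 1 2 3 by simp
    qed
    moreover have "(LINT x|M. \<sigma> * h0 x / k0 x * \<psi>' x) = (LINT x|M. \<sigma> * (\<psi> x * h0 x))"
      by (rule LINT_cong) (auto simp: \<psi>eq(2))
    moreover have "(\<lambda>n. ((LINT x|M. W n x * (k n x * \<psi> x)) - (LINT x|M. indicat_real (S n) x * (\<psi> x * h n x)))
          - (LINT x|M. W n x * (\<psi> x * (k n x - k0 x)))
          + (LINT x|M. indicat_real (S n) x * (\<psi> x * (h n x - h0 x)))
          + (LINT x|M. indicat_real (S n) x * (\<psi> x * h0 x))) \<longlonglongrightarrow> 0 - 0 + 0 + \<sigma> * (LINT x|M. \<psi> x * h0 x)"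
      by (intro tendsto_intros eq[OF \<psi>] null_k null_h main)
    ultimately show "(\<lambda>n. LINT x|M. W n x * \<psi>' x) \<longlonglongrightarrow> (LINT x|M. \<sigma> * h0 x / k0 x * \<psi>' x)"
      by (simp only: integral_mult_right_zero diff_0_right add_0_left)
  qed
qed

lemma conv_weak_limit:
  assumes K: "interaction_kernel K" and W: "L2_weakly_tendsto \<Omega> W w"
  shows "(\<lambda>n. conv K (W n) x) \<longlonglongrightarrow> conv K w x"
proof -
  obtain B where "0 < B" and B: "\<And>z. \<bar>K z\<bar> \<le> B" using kernel_bounded[OF K] by metis
  have "(\<lambda>y. K (x - y)) \<in> L2 \<Omega>" by (rule L2_bounded[OF kernel_section_measurable[OF K] B])
  from W[unfolded L2_weakly_tendsto_def, rule_format, OF this] show ?thesis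
    unfolding conv_def by (simp add: mult.commute)
qed

lemma conv_indicator_weakstar:
  assumes K: "interaction_kernel K" and S: "\<And>n. S n \<in> sets M"
    and \<sigma>: "Linf_weakstar_tendsto \<Omega> (\<lambda>n. indicat_real (S n)) (\<lambda>x. \<sigma>)"
  shows "(\<lambda>n. conv K (indicat_real (S n)) x) \<longlonglongrightarrow> \<sigma> * conv K (\<lambda>y. 1) x"
proof -
  have "integrable M (\<lambda>y. K (x - y))" using conv_integrable[OF K, of "\<lambda>y. 1" x] by simp
  from weakstar_indicatorD[OF \<sigma> this] show ?thesis
    unfolding conv_def by (simp add: mult.commute)
qed

lemma conv_indicator_bound:
  assumes K: "interaction_kernel K"
  obtains B where "0 < B" "\<And>S x. S \<in> sets M \<Longrightarrow> \<bar>conv K (indicat_real S) x\<bar> \<le> B"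
proof -
  obtain B where B: "0 < B" "\<And>z. \<bar>K z\<bar> \<le> B" using kernel_bounded[OF K] by metis
  have "\<bar>conv K (indicat_real S) x\<bar> \<le> B * measure M \<Omega> + 1" if S: "S \<in> sets M" for S x
  proof -
    have "\<bar>conv K (indicat_real S) x\<bar> \<le> B * (LINT y|M. \<bar>indicat_real S y\<bar>)"
      by (intro conv_bound K B L2_integrable L2_indicator S)
    also have "(LINT y|M. \<bar>indicat_real S y\<bar>) \<le> (LINT y|M. 1)"
      by (rule integral_mono) (use L2_integrable[OF L2_indicator[OF S]] in \<open>auto simp: indicator_le_1\<close>)
    finally show ?thesis using B(1) by simp
  qed
  moreover have "0 < B * measure M \<Omega> + 1" using B(1) by (simp add: add_nonneg_pos)
  ultimately show ?thesis using that by blast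
qed

text \<open>
Weak-* convergence of the indicators gives pointwise convergence of their convolutions, and these
are uniformly bounded.
\<close>

lemma conv_indicator_L2_null:
  assumes K: "interaction_kernel K" and S: "\<And>n. S n \<in> sets M"
    and \<sigma>: "Linf_weakstar_tendsto \<Omega> (\<lambda>n. indicat_real (S n)) (\<lambda>x. \<sigma>)"
  shows "L2_null (\<lambda>n x. conv K (indicat_real (S n)) x - \<sigma> * conv K (\<lambda>y. 1) x)"
proof -
  let ?d = "\<lambda>n x. conv K (indicat_real (S n)) x - \<sigma> * conv K (\<lambda>y. 1) x"
  obtain B where B: "0 < B" "\<And>S x. S \<in> sets M \<Longrightarrow> \<bar>conv K (indicat_real S) x\<bar> \<le> B"
    using conv_indicator_bound[OF K] by metis
  have cS: "continuous_on UNIV (conv K (indicat_real (S n)))" for n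
    by (intro conv_continuous K L2_integrable L2_indicator S)
  have c1: "continuous_on UNIV (conv K (\<lambda>y. 1))" by (intro conv_continuous K) simp
  have L: "?d n \<in> L2 \<Omega>" for n by (intro L2_continuous continuous_intros cS c1)
  have bd: "\<bar>\<sigma> * conv K (\<lambda>y. 1) x\<bar> \<le> B" for x
    using tendsto_rabs[OF conv_indicator_weakstar[OF K S \<sigma>, of x]] B(2)[OF S]
    by (intro LIMSEQ_le_const2) auto
  have "(\<lambda>n. LINT x|M. (?d n x)\<^sup>2) \<longlonglongrightarrow> (LINT x|M. 0)"
  proof (rule integral_dominated_convergence)
    show "integrable M (\<lambda>x. (2 * B)\<^sup>2)" by simp
    show "AE x in M. norm ((?d n x)\<^sup>2) \<le> (2 * B)\<^sup>2" for n
    proof (intro AE_I2)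
      fix x
      have "\<bar>?d n x\<bar> \<le> \<bar>2 * B\<bar>" using bd[of x] B(2)[OF S, of n x] by linarith
      then show "norm ((?d n x)\<^sup>2) \<le> (2 * B)\<^sup>2"
        unfolding real_norm_def abs_power2 by (rule abs_le_square_iff[THEN iffD1])
    qed
    show "AE x in M. (\<lambda>n. (?d n x)\<^sup>2) \<longlonglongrightarrow> 0"
    proof (intro AE_I2)
      fix x
      have "(\<lambda>n. (?d n x)\<^sup>2) \<longlonglongrightarrow> (\<sigma> * conv K (\<lambda>y. 1) x - \<sigma> * conv K (\<lambda>y. 1) x)\<^sup>2"
        by (intro tendsto_intros conv_indicator_weakstar[OF K S \<sigma>])
      then show "(\<lambda>n. (?d n x)\<^sup>2) \<longlonglongrightarrow> 0" by simp
    qed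
    show "(\<lambda>x. (?d n x)\<^sup>2) \<in> borel_measurable M" for n by (intro borel_measurable_power L2D L)
  qed simp
  then show ?thesis using L by (simp add: L2_null_def)
qed

text \<open>
The kernel is positive near the origin, so every point of the closure of \<open>\<Omega>\<close> sees a positive mass
of \<open>\<Omega>\<close>; compactness makes the bound uniform.
\<close>

lemma kernel_mass_positive:
  assumes K: "interaction_kernel K"
  obtains c where "0 < c" "\<And>x. x \<in> \<Omega> \<Longrightarrow> c \<le> conv K (\<lambda>y. 1) x"
proof -
  obtain d where d: "0 < d" "\<And>z. norm z < d \<Longrightarrow> K 0 / 2 < K z" and "0 < K 0"
    using kernel_positive_near_zero[OF K] by metis
  have pos: "0 < conv K (\<lambda>y. 1) x" if x: "x \<in> closure \<Omega>" for x
  proof -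
    have op: "open (ball x d \<inter> \<Omega>)" by (intro open_Int open_ball region_open)
    obtain y where "y \<in> \<Omega>" "dist y x < d" using x d(1) unfolding closure_approachable by blast
    then have "y \<in> ball x d \<inter> \<Omega>" by (simp add: dist_commute)
    then have nn: "\<not> negligible (ball x d \<inter> \<Omega>)" using open_not_negligible[OF op] by blast
    have lm: "ball x d \<inter> \<Omega> \<in> lmeasurable"
      by (rule lmeasurable_open[OF _ op]) (simp add: bounded_Int region_bounded)
    have m: "0 < measure lebesgue (ball x d \<inter> \<Omega>)"
      using nn lm unfolding negligible_iff_measure by (simp add: zero_less_measure_iff)
    have s: "ball x d \<inter> \<Omega> \<in> sets M" using lm by (subst subregion_sets_iff) auto
    have "0 < K 0 / 2 * measure lebesgue (ball x d \<inter> \<Omega>)" using m \<open>0 < K 0\<close> by simp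
    also have "measure lebesgue (ball x d \<inter> \<Omega>) = (LINT y|M. indicat_real (ball x d \<inter> \<Omega>) y)"
      using s by (simp add: measure_restrict_space)
    also have "K 0 / 2 * \<dots> = (LINT y|M. K 0 / 2 * indicat_real (ball x d \<inter> \<Omega>) y)" by simp
    also have "\<dots> \<le> (LINT y|M. K (x - y) * 1)"
    proof (rule integral_mono)
      show "integrable M (\<lambda>y. K 0 / 2 * indicat_real (ball x d \<inter> \<Omega>) y)"
        using L2_integrable[OF L2_indicator[OF s]] by simp
      show "integrable M (\<lambda>y. K (x - y) * 1)" by (rule conv_integrable[OF K]) simp
      show "K 0 / 2 * indicat_real (ball x d \<inter> \<Omega>) y \<le> K (x - y) * 1" for y
      proof (cases "y \<in> ball x d \<inter> \<Omega>")
        case True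
        then have "norm (x - y) < d" by (simp add: dist_norm)
        then show ?thesis using True d(2)[of "x - y"] by simp
      next
        case False
        then show ?thesis using kernel_nonneg[OF K, of "x - y"] by simp
      qed
    qed
    finally show ?thesis by (simp add: conv_def)
  qed
  have "compact (closure \<Omega>)" "closure \<Omega> \<noteq> {}" using region_bounded region_nonempty by auto
  moreover have "continuous_on (closure \<Omega>) (conv K (\<lambda>y. 1))" by (rule conv_continuous[OF K]) simp
  ultimately obtain x0 where x0: "x0 \<in> closure \<Omega>" "\<And>x. x \<in> closure \<Omega> \<Longrightarrow> conv K (\<lambda>y. 1) x0 \<le> conv K (\<lambda>y. 1) x"
    using continuous_attains_inf[of "closure \<Omega>" "conv K (\<lambda>y. 1)"] by blast
  have "conv K (\<lambda>y. 1) x0 \<le> conv K (\<lambda>y. 1) x" if "x \<in> \<Omega>" for x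
    using x0(2) that closure_subset by blast
  with pos[OF x0(1)] show ?thesis by (rule that)
qed


section \<open>Compactness of the solutions and identification of the limit\<close>

text \<open>
What is used of the weak solution on one perforated domain, after extension by zero: the mean
condition, the energy inequality, and the weak equation for test pairs whose first component is
\<open>\<psi> \<circ> s\<close>, where \<open>s\<close> stands for a map close to the identity that is constant near each hole. The
conditions are stable under scaling of \<open>(f, U, V)\<close>, which permits the normalisation in the proof of
the uniform bound.
\<close>

definition hole_solution ::
  "('a \<Rightarrow> real) \<Rightarrow> ('a \<Rightarrow> real) \<Rightarrow> ('a \<Rightarrow> 'a) \<Rightarrow> 'a set \<Rightarrow> 'a set \<Rightarrow>
   ('a \<Rightarrow> real) \<Rightarrow> ('a \<Rightarrow> real) \<Rightarrow> ('a \<Rightarrow> real) \<Rightarrow> bool" where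
  "hole_solution J G s A B f U V \<longleftrightarrow>
     A \<in> sets M \<and> B = \<Omega> - A \<and> f \<in> L2 \<Omega> \<and> U \<in> L2 \<Omega> \<and> V \<in> L2 \<Omega> \<and>
     (\<forall>x. x \<notin> A \<longrightarrow> U x = 0) \<and> (\<forall>x. x \<notin> B \<longrightarrow> V x = 0) \<and>
     (LINT x|M. U x) + (LINT x|M. V x) = 0 \<and>
     nonlocal_form J G A B U V U V \<le> - (LINT x|M. f x * U x) - (LINT x|M. f x * V x) \<and>
     (\<forall>\<psi> \<theta>. continuous_on UNIV \<psi> \<longrightarrow> continuous_on UNIV \<theta> \<longrightarrow>
        nonlocal_form J G A B U V (\<lambda>x. indicat_real A x * \<psi> (s x)) (\<lambda>x. indicat_real B x * \<theta> x)
        = - (LINT x|M. f x * (indicat_real A x * \<psi> (s x)))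
          - (LINT x|M. f x * (indicat_real B x * \<theta> x)))"

text \<open>
The homogenized system at the point \<open>x\<close>, with the integrals written as convolutions.
\<close>

definition limit_system ::
  "('a \<Rightarrow> real) \<Rightarrow> ('a \<Rightarrow> real) \<Rightarrow> real \<Rightarrow> ('a \<Rightarrow> real) \<Rightarrow> ('a \<Rightarrow> real) \<Rightarrow> ('a \<Rightarrow> real) \<Rightarrow> 'a \<Rightarrow> bool" where
  "limit_system J G X f u v x \<longleftrightarrow>
     f x * X = X * conv J v x - (1 - X) * u x * conv J (\<lambda>y. 1) x \<and>
     f x * (1 - X) = (1 - X) * conv G v x - (1 - X) * v x * conv G (\<lambda>y. 1) x
        + (1 - X) * conv J u x - X * v x * conv J (\<lambda>y. 1) x"

lemma uniform_limit_comp_near_id: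
  fixes \<psi> :: "'a \<Rightarrow> real" and s :: "nat \<Rightarrow> 'a \<Rightarrow> 'a"
  assumes \<psi>: "continuous_on UNIV \<psi>"
    and s: "\<And>n x. x \<in> \<Omega> \<Longrightarrow> norm (s n x - x) \<le> \<delta> n" and \<delta>: "\<delta> \<longlonglongrightarrow> 0"
  shows "uniform_limit \<Omega> (\<lambda>n x. \<psi> x - \<psi> (s n x)) (\<lambda>x. 0) sequentially"
proof (rule uniform_limitI)
  fix e :: real assume e: "0 < e"
  obtain R where R: "\<And>x. x \<in> \<Omega> \<Longrightarrow> norm x \<le> R"
    using region_bounded unfolding bounded_iff by blast
  have "uniformly_continuous_on (cball 0 (R + 1)) \<psi>"
    by (intro compact_uniformly_continuous continuous_on_subset[OF \<psi>]) auto
  then obtain d where d: "0 < d" "\<And>x y. x \<in> cball 0 (R + 1) \<Longrightarrow> y \<in> cball 0 (R + 1) \<Longrightarrow> dist y x < d \<Longrightarrow> dist (\<psi> y) (\<psi> x) < e"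
    using e unfolding uniformly_continuous_on_def by metis
  have "\<forall>\<^sub>F n in sequentially. \<delta> n < min d 1"
    using order_tendstoD(2)[OF \<delta>, of "min d 1"] d(1) by simp
  then show "\<forall>\<^sub>F n in sequentially. \<forall>x\<in>\<Omega>. dist (\<psi> x - \<psi> (s n x)) 0 < e"
  proof (eventually_elim, intro ballI)
    fix n x assume n: "\<delta> n < min d 1" and x: "x \<in> \<Omega>"
    have 1: "norm (s n x - x) < min d 1" using s[OF x, of n] n by linarith
    have "norm (s n x) \<le> norm (s n x - x) + norm x" using norm_triangle_ineq[of "s n x - x" x] by simp
    then have "norm (s n x) \<le> R + 1" using 1 R[OF x] by simp
    then have "dist (\<psi> (s n x)) (\<psi> x) < e" using d(2)[of x "s n x"] 1 R[OF x] by (simp add: dist_norm)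
    then show "dist (\<psi> x - \<psi> (s n x)) 0 < e" by (simp add: dist_real_def abs_minus_commute)
  qed
qed

lemma L2_comp_near_id:
  fixes \<psi> :: "'a \<Rightarrow> real" and s :: "'a \<Rightarrow> 'a"
  assumes \<psi>: "continuous_on UNIV \<psi>" and s: "s \<in> borel_measurable borel"
    "\<And>x. x \<in> \<Omega> \<Longrightarrow> norm (s x - x) \<le> \<delta>"
  shows "(\<lambda>x. \<psi> (s x)) \<in> L2 \<Omega>"
proof -
  obtain R where R: "\<And>x. x \<in> \<Omega> \<Longrightarrow> norm x \<le> R"
    using region_bounded unfolding bounded_iff by blast
  have "compact (\<psi> ` cball 0 (R + \<delta>))" by (intro compact_continuous_image continuous_on_subset[OF \<psi>]) auto
  then have "bounded (\<psi> ` cball 0 (R + \<delta>))" by (rule compact_imp_bounded)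
  then obtain C where "\<forall>y\<in>\<psi> ` cball 0 (R + \<delta>). norm y \<le> C" unfolding bounded_iff by blast
  then have C: "\<And>z. norm z \<le> R + \<delta> \<Longrightarrow> \<bar>\<psi> z\<bar> \<le> C" by simp
  have "norm (s x) \<le> R + \<delta>" if x: "x \<in> \<Omega>" for x
    using norm_triangle_ineq[of "s x - x" x] s(2)[OF x] R[OF x] by simp
  moreover have "(\<lambda>x. \<psi> (s x)) \<in> borel_measurable M"
    by (intro measurable_on_region measurable_compose[OF s(1)] borel_measurable_continuous_onI \<psi>)
  ultimately show ?thesis using C by (intro L2_bounded[of _ C]) auto
qed

lemma L2_bdd_L1:
  assumes "L2_bdd w"
  obtains C where "0 \<le> C" "\<And>n. (LINT x|M. \<bar>w n x\<bar>) \<le> C"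
proof -
  obtain C where C: "\<And>n. w n \<in> L2 \<Omega>" "\<And>n. (LINT x|M. (w n x)\<^sup>2) \<le> C"
    using assms by (auto simp: L2_bdd_def)
  have "(LINT x|M. \<bar>w n x\<bar>) \<le> sqrt C * sqrt (measure M \<Omega>)" for n
  proof -
    have a: "(\<lambda>x. \<bar>w n x\<bar>) \<in> L2 \<Omega>" using C(1)[of n] by (simp add: real_L2_iff borel_measurable_abs)
    have "(LINT x|M. \<bar>w n x\<bar>) \<le> sqrt (LINT x|M. (w n x)\<^sup>2) * sqrt (measure M \<Omega>)"
      using L2_Cauchy_Schwarz[OF a L2_const[of 1]] by simp
    also have "\<dots> \<le> sqrt C * sqrt (measure M \<Omega>)" using C(2) by (intro mult_right_mono) auto
    finally show ?thesis .
  qed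
  moreover have "0 \<le> C" using C(2)[of 0] order_trans[OF _ C(2)[of 0]] by simp
  ultimately show ?thesis using that[of "sqrt C * sqrt (measure M \<Omega>)"] by simp
qed

lemma L2_continuous_closure:
  fixes p :: "'a \<Rightarrow> real"
  assumes "continuous_on (closure \<Omega>) p"
  shows "p \<in> L2 \<Omega>"
proof -
  have "compact (p ` closure \<Omega>)"
    by (intro compact_continuous_image assms) (simp add: region_bounded compact_closure)
  then have "bounded (p ` closure \<Omega>)" by (rule compact_imp_bounded)
  then obtain C where "\<forall>y\<in>p ` closure \<Omega>. norm y \<le> C" unfolding bounded_iff by blast
  then have "\<And>x. x \<in> \<Omega> \<Longrightarrow> \<bar>p x\<bar> \<le> C" using closure_subset[of \<Omega>] by auto
  moreover have "p \<in> borel_measurable M"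
    by (intro continuous_measurable continuous_on_subset[OF assms] closure_subset)
  ultimately show ?thesis by (intro L2_bounded)
qed

text \<open>
Convolution with a uniformly continuous bounded kernel maps sets that are bounded in \<open>L\<^sup>1\<close> to
bounded equicontinuous sets, so the theorem of Arzela and Ascoli applies. It is applied to the three
sequences at once, as one function into \<open>\<real>\<^sup>3\<close>, in order to get a common subsequence.
\<close>

lemma conv_sequence_compact:
  assumes J: "interaction_kernel J" and G: "interaction_kernel G"
    and U: "L2_bdd U" and V: "L2_bdd V"
  obtains r p q g where "strict_mono r"
    "continuous_on (closure \<Omega>) p" "continuous_on (closure \<Omega>) q" "continuous_on (closure \<Omega>) g"
    "uniform_limit \<Omega> (\<lambda>n. conv J (U (r n))) p sequentially"
    "uniform_limit \<Omega> (\<lambda>n. conv J (V (r n))) q sequentially"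
    "uniform_limit \<Omega> (\<lambda>n. conv G (V (r n))) g sequentially"
proof -
  obtain C1 where C1: "0 \<le> C1" "\<And>n. (LINT x|M. \<bar>U n x\<bar>) \<le> C1" using L2_bdd_L1[OF U] by metis
  obtain C2 where C2: "0 \<le> C2" "\<And>n. (LINT x|M. \<bar>V n x\<bar>) \<le> C2" using L2_bdd_L1[OF V] by metis
  define C where "C = max C1 C2"
  have C: "0 \<le> C" "\<And>n. (LINT x|M. \<bar>U n x\<bar>) \<le> C" "\<And>n. (LINT x|M. \<bar>V n x\<bar>) \<le> C"
    using C1 C2 by (auto simp: C_def le_max_iff_disj)
  have UI: "integrable M (U n)" and VI: "integrable M (V n)" for n
    using U V by (auto simp: L2_bdd_def intro: L2_integrable)
  obtain BJ where BJ: "0 < BJ" "\<And>z. \<bar>J z\<bar> \<le> BJ" using kernel_bounded[OF J] by metis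
  obtain BG where BG: "0 < BG" "\<And>z. \<bar>G z\<bar> \<le> BG" using kernel_bounded[OF G] by metis
  define F where "F n x = (conv J (U n) x, conv J (V n) x, conv G (V n) x)" for n x
  have norm3: "norm (a, b, c) \<le> \<bar>a\<bar> + \<bar>b\<bar> + \<bar>c\<bar>" for a b c :: real
    using norm_Pair_le[of a "(b, c)"] norm_Pair_le[of b c] by simp
  have bd: "\<bar>conv K w x\<bar> \<le> B * C"
    if "interaction_kernel K" "\<And>z. \<bar>K z\<bar> \<le> B" "0 < B" "integrable M w" "(LINT x|M. \<bar>w x\<bar>) \<le> C" for K w x B
    by (rule order_trans[OF conv_bound[OF that(1,4,2)]]) (use that in \<open>auto intro: mult_left_mono\<close>)
  have FM: "norm (F n x) \<le> BJ * C + BJ * C + BG * C" for n x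
    unfolding F_def
    by (rule order_trans[OF norm3 add_mono[OF add_mono]])
       (auto intro!: bd BJ BG J G UI VI C)
  have Fe: "\<exists>d>0. \<forall>n y. y \<in> closure \<Omega> \<and> norm (x - y) < d \<longrightarrow> norm (F n x - F n y) < e"
    if e: "0 < e" for x e
  proof -
    obtain d1 where d1: "0 < d1" "\<And>w x x'. integrable M w \<Longrightarrow> (LINT y|M. \<bar>w y\<bar>) \<le> C \<Longrightarrow>
      norm (x - x') < d1 \<Longrightarrow> \<bar>conv J w x - conv J w x'\<bar> < e / 3"
      using conv_equicontinuous[OF J _ C(1), of "e / 3"] e by (metis divide_pos_pos zero_less_numeral)
    obtain d2 where d2: "0 < d2" "\<And>w x x'. integrable M w \<Longrightarrow> (LINT y|M. \<bar>w y\<bar>) \<le> C \<Longrightarrow>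
      norm (x - x') < d2 \<Longrightarrow> \<bar>conv G w x - conv G w x'\<bar> < e / 3"
      using conv_equicontinuous[OF G _ C(1), of "e / 3"] e by (metis divide_pos_pos zero_less_numeral)
    have "norm (F n x - F n y) < e" if "norm (x - y) < min d1 d2" for n y
      using norm3[of "conv J (U n) x - conv J (U n) y" "conv J (V n) x - conv J (V n) y" "conv G (V n) x - conv G (V n) y"]
        d1(2)[OF UI C(2), of x y n] d1(2)[OF VI C(3), of x y n] d2(2)[OF VI C(3), of x y n] that
      unfolding F_def by simp
    then show ?thesis using d1(1) d2(1) by (intro exI[of _ "min d1 d2"]) auto
  qed
  have "compact (closure \<Omega>)" by (simp add: region_bounded compact_closure)
  then obtain h r where h: "continuous_on (closure \<Omega>) h" and r: "strict_mono (r :: nat \<Rightarrow> nat)"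
    and lim: "\<And>e. 0 < e \<Longrightarrow> \<exists>N. \<forall>n x. n \<ge> N \<and> x \<in> closure \<Omega> \<longrightarrow> norm (F (r n) x - h x) < e"
    using Arzela_Ascoli[of "closure \<Omega>" F "BJ * C + BJ * C + BG * C"] FM Fe by metis
  have unif: "uniform_limit \<Omega> (\<lambda>n x. P (F (r n) x)) (\<lambda>x. P (h x)) sequentially"
    if P: "\<And>a b. \<bar>P a - P b\<bar> \<le> norm (a - b)" for P :: "real \<times> real \<times> real \<Rightarrow> real"
  proof (rule uniform_limitI)
    fix e :: real assume "0 < e"
    then obtain N where N: "\<And>n x. n \<ge> N \<Longrightarrow> x \<in> closure \<Omega> \<Longrightarrow> norm (F (r n) x - h x) < e" using lim by blast
    show "\<forall>\<^sub>F n in sequentially. \<forall>x\<in>\<Omega>. dist (P (F (r n) x)) (P (h x)) < e"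
    proof (rule eventually_sequentiallyI[of N], intro ballI)
      fix n x assume n: "N \<le> n" and x: "x \<in> \<Omega>"
      have "norm (F (r n) x - h x) < e" using N[OF n] closure_subset x by blast
      then show "dist (P (F (r n) x)) (P (h x)) < e"
        using P[of "F (r n) x" "h x"] by (simp add: dist_real_def)
    qed
  qed
  have P1: "\<bar>fst a - fst b\<bar> \<le> norm (a - b)"
    and P2: "\<bar>fst (snd a) - fst (snd b)\<bar> \<le> norm (a - b)"
    and P3: "\<bar>snd (snd a) - snd (snd b)\<bar> \<le> norm (a - b)" for a b :: "real \<times> real \<times> real"
  proof -
    obtain x y z where d: "a - b = (x, y, z)" by (metis prod_cases3)
    have "fst a - fst b = x" "fst (snd a) - fst (snd b) = y" "snd (snd a) - snd (snd b) = z"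
      using d by (auto simp: minus_prod_def)
    then show "\<bar>fst a - fst b\<bar> \<le> norm (a - b)" "\<bar>fst (snd a) - fst (snd b)\<bar> \<le> norm (a - b)"
      "\<bar>snd (snd a) - snd (snd b)\<bar> \<le> norm (a - b)"
      using norm_fst_le[of x "(y, z)"] norm_snd_le[of "(y, z)" x] norm_fst_le[of y z] norm_snd_le[of z y]
      unfolding d by auto
  qed
  show ?thesis
  proof (rule that[OF r])
    show "uniform_limit \<Omega> (\<lambda>n. conv J (U (r n))) (\<lambda>x. fst (h x)) sequentially"
      using unif[OF P1] by (simp add: F_def)
    show "uniform_limit \<Omega> (\<lambda>n. conv J (V (r n))) (\<lambda>x. fst (snd (h x))) sequentially"
      using unif[of "\<lambda>z. fst (snd z)", OF P2] by (simp add: F_def)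
    show "uniform_limit \<Omega> (\<lambda>n. conv G (V (r n))) (\<lambda>x. snd (snd (h x))) sequentially"
      using unif[of "\<lambda>z. snd (snd z)", OF P3] by (simp add: F_def)
  qed (intro continuous_intros h)+
qed

lemma uniform_limit_conv_L2_null:
  assumes K: "interaction_kernel K" and W: "\<And>n. W n \<in> L2 \<Omega>" and p: "continuous_on (closure \<Omega>) p"
    and lim: "uniform_limit \<Omega> (\<lambda>n. conv K (W n)) p sequentially"
  shows "L2_null (\<lambda>n x. conv K (W n) x - p x)"
proof (rule L2_null_uniform)
  show "(\<lambda>x. conv K (W n) x - p x) \<in> L2 \<Omega>" for n
    by (intro L2_diff conv_L2 K L2_integrable W L2_continuous_closure p)
  show "uniform_limit \<Omega> (\<lambda>n x. conv K (W n) x - p x) (\<lambda>x. 0) sequentially"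
    using lim unfolding uniform_limit_iff by (simp add: dist_real_def)
qed

lemma weakstar_complement:
  assumes A: "\<And>n. A n \<in> sets M" and B: "\<And>n. B n = \<Omega> - A n"
    and X: "Linf_weakstar_tendsto \<Omega> (\<lambda>n. indicat_real (A n)) (\<lambda>x. X)"
  shows "Linf_weakstar_tendsto \<Omega> (\<lambda>n. indicat_real (B n)) (\<lambda>x. 1 - X)"
  unfolding Linf_weakstar_tendsto_def
proof (intro allI impI)
  fix g :: "'a \<Rightarrow> real" assume g: "integrable M g"
  have "(LINT x|M. indicat_real (B n) x * g x) = (LINT x|M. g x) - (LINT x|M. indicat_real (A n) x * g x)" for n
  proof -
    have "(LINT x|M. indicat_real (B n) x * g x) = (LINT x|M. g x - indicat_real (A n) x * g x)"
      by (rule LINT_cong) (auto simp: B indicator_def)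
    then show ?thesis
      using g integrable_mult_indicator[OF A g, of n] by simp
  qed
  moreover have "(\<lambda>n. (LINT x|M. g x) - (LINT x|M. indicat_real (A n) x * g x)) \<longlonglongrightarrow> (LINT x|M. g x) - X * (LINT x|M. g x)"
    by (intro tendsto_intros weakstar_indicatorD[OF X g])
  ultimately show "(\<lambda>n. LINT x|M. indicat_real (B n) x * g x) \<longlonglongrightarrow> (LINT x|M. (1 - X) * g x)"
    by (simp add: left_diff_distrib[of 1 X "integral\<^sup>L M g"])
qed


lemma weakstar_subseq:
  assumes "Linf_weakstar_tendsto \<Omega> w w0" "strict_mono r"
  shows "Linf_weakstar_tendsto \<Omega> (\<lambda>n. w (r n)) w0"
  unfolding Linf_weakstar_tendsto_def
proof (intro allI impI)
  fix g :: "'a \<Rightarrow> real" assume "integrable M g"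
  then have "(\<lambda>n. LINT x|M. w n x * g x) \<longlonglongrightarrow> (LINT x|M. w0 x * g x)"
    using assms(1) unfolding Linf_weakstar_tendsto_def by blast
  from LIMSEQ_subseq_LIMSEQ[OF this assms(2)]
  show "(\<lambda>n. LINT x|M. w (r n) x * g x) \<longlonglongrightarrow> (LINT x|M. w0 x * g x)" by (simp add: o_def)
qed

lemma weakly_tendsto_integral:
  assumes "L2_weakly_tendsto \<Omega> W w"
  shows "(\<lambda>n. LINT x|M. W n x) \<longlonglongrightarrow> (LINT x|M. w x)"
  using assms[unfolded L2_weakly_tendsto_def, rule_format, OF L2_const[of 1]] by simp

lemma conv_uniform_weak_limit_eq:
  assumes "interaction_kernel K" "uniform_limit \<Omega> (\<lambda>n. conv K (W n)) p sequentially"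
    "L2_weakly_tendsto \<Omega> W w" "x \<in> \<Omega>"
  shows "p x = conv K w x"
  using tendsto_uniform_limitI[OF assms(2,4)] conv_weak_limit[OF assms(1,3)] LIMSEQ_unique by blast

lemma hole_solution_test_A:
  assumes sol: "hole_solution J G s A B f U V" and J: "interaction_kernel J"
    and \<psi>: "continuous_on UNIV \<psi>" and s: "(\<lambda>x. \<psi> (s x)) \<in> L2 \<Omega>"
  shows "(LINT x|M. U x * (conv J (indicat_real B) x * \<psi> (s x)))
    = (LINT x|M. indicat_real A x * (\<psi> (s x) * (conv J V x - f x)))"
proof -
  have A: "A \<in> sets M" and f: "f \<in> L2 \<Omega>" and V: "V \<in> L2 \<Omega>" and U0: "\<And>x. x \<notin> A \<Longrightarrow> U x = 0"
    and eq: "nonlocal_form J G A B U V (\<lambda>x. indicat_real A x * \<psi> (s x)) (\<lambda>x. indicat_real B x * 0)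
        = - (LINT x|M. f x * (indicat_real A x * \<psi> (s x))) - (LINT x|M. f x * (indicat_real B x * 0))"
    using sol \<psi> continuous_on_const[of UNIV "0 :: real"] unfolding hole_solution_def by blast+
  let ?\<Phi> = "\<lambda>x. indicat_real A x * \<psi> (s x)"
  have \<Phi>: "?\<Phi> \<in> L2 \<Omega>" by (rule L2_indicator_mult[OF s A])
  have "(LINT x|M. U x * (conv J (indicat_real B) x * \<psi> (s x)))
      = (LINT x|M. U x * ?\<Phi> x * conv J (indicat_real B) x)"
    using U0 by (intro LINT_cong) (auto simp: indicator_def)
  also have "\<dots> = (LINT x|M. ?\<Phi> x * conv J V x) - (LINT x|M. f x * ?\<Phi> x)"
    using eq by (simp add: nonlocal_form_def)
  also have "\<dots> = (LINT x|M. ?\<Phi> x * conv J V x - f x * ?\<Phi> x)"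
    using L2_mult_integrable[OF \<Phi> conv_L2[OF J L2_integrable[OF V]]] L2_mult_integrable[OF f \<Phi>] by simp
  also have "\<dots> = (LINT x|M. indicat_real A x * (\<psi> (s x) * (conv J V x - f x)))"
    by (intro LINT_cong) (auto simp: algebra_simps)
  finally show ?thesis .
qed

lemma hole_solution_test_B:
  assumes sol: "hole_solution J G s A B f U V" and J: "interaction_kernel J" and G: "interaction_kernel G"
    and \<psi>: "continuous_on UNIV \<psi>"
  shows "(LINT x|M. V x * ((conv G (indicat_real B) x + conv J (indicat_real A) x) * \<psi> x))
    = (LINT x|M. indicat_real B x * (\<psi> x * (conv G V x + conv J U x - f x)))"
proof -
  have A: "A \<in> sets M" and f: "f \<in> L2 \<Omega>" and V: "V \<in> L2 \<Omega>" and U: "U \<in> L2 \<Omega>" and V0: "\<And>x. x \<notin> B \<Longrightarrow> V x = 0"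
    and B: "B = \<Omega> - A"
    and eq: "nonlocal_form J G A B U V (\<lambda>x. indicat_real A x * 0) (\<lambda>x. indicat_real B x * \<psi> x)
        = - (LINT x|M. f x * (indicat_real A x * 0)) - (LINT x|M. f x * (indicat_real B x * \<psi> x))"
    using sol \<psi> continuous_on_const[of UNIV "0 :: real"] unfolding hole_solution_def by blast+
  have BM: "B \<in> sets M" using A B sets.compl_sets[of A M] by simp
  let ?\<Theta> = "\<lambda>x. indicat_real B x * \<psi> x"
  have \<Theta>: "?\<Theta> \<in> L2 \<Omega>" by (rule L2_indicator_mult[OF L2_continuous[OF \<psi>] BM])
  have V\<Theta>: "V x * ?\<Theta> x = V x * \<psi> x" for x using V0 by (auto simp: indicator_def)
  have i: "integrable M (\<lambda>x. V x * ?\<Theta> x * conv G (indicat_real B) x)"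
    "integrable M (\<lambda>x. V x * ?\<Theta> x * conv J (indicat_real A) x)"
    by (intro conv_mult_integrable J G L2_mult_integrable V \<Theta> L2_integrable L2_indicator A BM)+
  have i2: "integrable M (\<lambda>x. ?\<Theta> x * conv G V x)" "integrable M (\<lambda>x. ?\<Theta> x * conv J U x)"
    "integrable M (\<lambda>x. f x * ?\<Theta> x)"
    by (intro L2_mult_integrable \<Theta> f conv_L2 J G L2_integrable[OF U] L2_integrable[OF V])+
  have "(LINT x|M. V x * ((conv G (indicat_real B) x + conv J (indicat_real A) x) * \<psi> x))
      = (LINT x|M. V x * ?\<Theta> x * conv G (indicat_real B) x + V x * ?\<Theta> x * conv J (indicat_real A) x)"
    by (intro LINT_cong refl, unfold V\<Theta>) (simp add: algebra_simps)
  also have "\<dots> = (LINT x|M. V x * ?\<Theta> x * conv G (indicat_real B) x) + (LINT x|M. V x * ?\<Theta> x * conv J (indicat_real A) x)"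
    by (rule Bochner_Integration.integral_add[OF i])
  also have "\<dots> = (LINT x|M. ?\<Theta> x * conv G V x) + (LINT x|M. ?\<Theta> x * conv J U x) - (LINT x|M. f x * ?\<Theta> x)"
    using eq by (simp add: nonlocal_form_def)
  also have "\<dots> = (LINT x|M. ?\<Theta> x * conv G V x + ?\<Theta> x * conv J U x - f x * ?\<Theta> x)"
    using i2 by simp
  also have "\<dots> = (LINT x|M. indicat_real B x * (\<psi> x * (conv G V x + conv J U x - f x)))"
    by (intro LINT_cong) (auto simp: algebra_simps)
  finally show ?thesis .
qed

text \<open>
Along the subsequence on which \<open>J * U\<^sub>n\<close>, \<open>J * V\<^sub>n\<close> and \<open>G * V\<^sub>n\<close> converge uniformly, to \<open>p\<close>, \<open>q\<close> and
\<open>g\<close>, the two test identities have the shape required by \<open>weak_limit_of_quotient\<close>. This yields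
\<open>u = X (q - f) / ((1 - X) (J * 1))\<close> and a similar formula for \<open>v\<close>. Weak convergence then
identifies \<open>p\<close>, \<open>q\<close>, \<open>g\<close> as \<open>J * u\<close>, \<open>J * v\<close>, \<open>G * v\<close>, and the formulas become the homogenized
system.
\<close>

lemma hole_solutions_compact:
  assumes J: "interaction_kernel J" and G: "interaction_kernel G" and X: "0 < X" "X < 1"
    and A: "Linf_weakstar_tendsto \<Omega> (\<lambda>n. indicat_real (A n)) (\<lambda>x. X)"
    and s: "\<And>n. s n \<in> borel_measurable borel" "\<And>n x. x \<in> \<Omega> \<Longrightarrow> norm (s n x - x) \<le> \<delta> n" "\<delta> \<longlonglongrightarrow> 0"
    and sol: "\<And>n. hole_solution J G (s n) (A n) (B n) (f n) (U n) (V n)"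
    and f: "L2_null (\<lambda>n x. f n x - f0 x)" "f0 \<in> L2 \<Omega>"
    and bdd: "L2_bdd U" "L2_bdd V"
  obtains r u v where "strict_mono r" "u \<in> L2 \<Omega>" "v \<in> L2 \<Omega>"
    "L2_weakly_tendsto \<Omega> (\<lambda>n. U (r n)) u" "L2_weakly_tendsto \<Omega> (\<lambda>n. V (r n)) v"
    "(LINT x|M. u x) + (LINT x|M. v x) = 0"
    "\<And>x. x \<in> \<Omega> \<Longrightarrow> limit_system J G X f0 u v x"
    "L2_null (\<lambda>n x. conv J (U (r n)) x - conv J u x)"
    "L2_null (\<lambda>n x. conv J (V (r n)) x - conv J v x)"
    "L2_null (\<lambda>n x. conv G (V (r n)) x - conv G v x)"
proof -
  obtain r p q g where r: "strict_mono r"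
    and cont: "continuous_on (closure \<Omega>) p" "continuous_on (closure \<Omega>) q" "continuous_on (closure \<Omega>) g"
    and unif: "uniform_limit \<Omega> (\<lambda>n. conv J (U (r n))) p sequentially"
      "uniform_limit \<Omega> (\<lambda>n. conv J (V (r n))) q sequentially"
      "uniform_limit \<Omega> (\<lambda>n. conv G (V (r n))) g sequentially"
    using conv_sequence_compact[OF J G bdd] by metis
  have UL: "U n \<in> L2 \<Omega>" and VL: "V n \<in> L2 \<Omega>" and AM: "A n \<in> sets M" and Beq: "B n = \<Omega> - A n" for n
    using sol[of n] unfolding hole_solution_def by blast+
  have BM: "B n \<in> sets M" for n using AM[of n] Beq sets.compl_sets[of "A n" M] by simp
  have Aw: "Linf_weakstar_tendsto \<Omega> (\<lambda>n. indicat_real (A (r n))) (\<lambda>x. X)"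
    by (rule weakstar_subseq[OF A r])
  have Bw: "Linf_weakstar_tendsto \<Omega> (\<lambda>n. indicat_real (B (r n))) (\<lambda>x. 1 - X)"
    by (rule weakstar_complement[OF AM Beq Aw])
  have nf: "L2_null (\<lambda>n x. f (r n) x - f0 x)" using L2_null_subseq[OF f(1) r] .
  have np: "L2_null (\<lambda>n x. conv J (U (r n)) x - p x)"
    by (rule uniform_limit_conv_L2_null[OF J UL cont(1) unif(1)])
  have nq: "L2_null (\<lambda>n x. conv J (V (r n)) x - q x)"
    by (rule uniform_limit_conv_L2_null[OF J VL cont(2) unif(2)])
  have ng: "L2_null (\<lambda>n x. conv G (V (r n)) x - g x)"
    by (rule uniform_limit_conv_L2_null[OF G VL cont(3) unif(3)])
  have pL: "p \<in> L2 \<Omega>" and qL: "q \<in> L2 \<Omega>" and gL: "g \<in> L2 \<Omega>"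
    using cont by (auto intro: L2_continuous_closure)
  have cK: "continuous_on UNIV (conv K (indicat_real (S n)))"
    if "interaction_kernel K" "\<And>n. S n \<in> sets M" for K and S :: "nat \<Rightarrow> 'a set" and n
    by (intro conv_continuous that L2_integrable L2_indicator)
  have c1: "continuous_on UNIV (conv K (\<lambda>y. 1))" if "interaction_kernel K" for K
    by (intro conv_continuous that) simp
  obtain cJ where cJ: "0 < cJ" "\<And>x. x \<in> \<Omega> \<Longrightarrow> cJ \<le> conv J (\<lambda>y. 1) x"
    using kernel_mass_positive[OF J] by metis
  obtain cG where cG: "0 < cG" "\<And>x. x \<in> \<Omega> \<Longrightarrow> cG \<le> conv G (\<lambda>y. 1) x"
    using kernel_mass_positive[OF G] by metis

  \<comment> \<open>The identity on the holes: the coefficient of \<open>U\<close> and the strongly convergent right-hand side.\<close>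
  define kA where "kA n x = conv J (indicat_real (B (r n))) x" for n x
  define kA0 where "kA0 x = (1 - X) * conv J (\<lambda>y. 1) x" for x
  define hA where "hA n x = conv J (V (r n)) x - f (r n) x" for n x
  define hA0 where "hA0 x = q x - f0 x" for x
  have nkA: "L2_null (\<lambda>n x. kA n x - kA0 x)"
    unfolding kA_def kA0_def by (rule conv_indicator_L2_null[OF J BM Bw])
  have nhA: "L2_null (\<lambda>n x. hA n x - hA0 x)"
    using L2_null_diff[OF nq nf] by (simp add: hA_def hA0_def algebra_simps)
  have hA0L: "hA0 \<in> L2 \<Omega>" unfolding hA0_def by (rule L2_diff[OF qL f(2)])
  have kAc: "continuous_on UNIV (kA n)" for n unfolding kA_def[abs_def] by (rule cK[OF J]) (rule BM)
  have kA0c: "continuous_on UNIV kA0" unfolding kA0_def[abs_def] by (intro continuous_intros c1 J)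
  obtain BJ where BJ: "0 < BJ" "\<And>S x. S \<in> sets M \<Longrightarrow> \<bar>conv J (indicat_real S) x\<bar> \<le> BJ"
    using conv_indicator_bound[OF J] by metis
  have eqA: "(\<lambda>n. (LINT x|M. U (r n) x * (kA n x * \<psi> x))
      - (LINT x|M. indicat_real (A (r n)) x * (\<psi> x * hA n x))) \<longlonglongrightarrow> 0"
    if \<psi>: "continuous_on UNIV \<psi>" for \<psi>
  proof -
    \<comment> \<open>Only \<open>\<phi> n\<close> is admissible in the identity; replacing it by \<open>\<psi>\<close> costs a uniformly small error.\<close>
    define \<phi> where "\<phi> n x = \<psi> (s (r n) x)" for n x
    have \<phi>L: "\<phi> n \<in> L2 \<Omega>" for n unfolding \<phi>_def by (rule L2_comp_near_id[OF \<psi> s(1,2)])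
    have \<psi>L: "\<psi> \<in> L2 \<Omega>" by (rule L2_continuous[OF \<psi>])
    have \<delta>r: "(\<lambda>n. \<delta> (r n)) \<longlonglongrightarrow> 0" using LIMSEQ_subseq_LIMSEQ[OF s(3) r] by (simp add: o_def)
    have n\<phi>: "L2_null (\<lambda>n x. \<psi> x - \<phi> n x)"
    proof (rule L2_null_uniform)
      show "uniform_limit \<Omega> (\<lambda>n x. \<psi> x - \<phi> n x) (\<lambda>x. 0) sequentially"
        unfolding \<phi>_def by (rule uniform_limit_comp_near_id[OF \<psi> s(2) \<delta>r])
    qed (rule L2_diff[OF \<psi>L \<phi>L])
    have kAm: "kA n \<in> borel_measurable M" for n
      by (intro continuous_measurable continuous_on_subset[OF kAc]) simp
    have kAb: "\<bar>kA n x\<bar> \<le> BJ" for n x unfolding kA_def by (rule BJ(2)[OF BM])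
    have 1: "(\<lambda>n. LINT x|M. U (r n) x * (kA n x * (\<psi> x - \<phi> n x))) \<longlonglongrightarrow> 0"
      by (rule L2_null_bdd_product[OF L2_bdd_subseq[OF bdd(1)] L2_null_mult[OF n\<phi> kAm kAb]])
    have hAb: "L2_bdd hA" by (rule L2_bdd_of_null[OF nhA hA0L])
    have hAL: "hA n \<in> L2 \<Omega>" for n using hAb by (simp add: L2_bdd_def)
    have "L2_bdd (\<lambda>n x. indicat_real (A (r n)) x * hA n x)"
      by (rule L2_bdd_mult[OF hAb, where D = 1]) (use AM in \<open>auto simp: indicator_le_1\<close>)
    from L2_null_bdd_product[OF this n\<phi>]
    have 2: "(\<lambda>n. LINT x|M. indicat_real (A (r n)) x * hA n x * (\<psi> x - \<phi> n x)) \<longlonglongrightarrow> 0" .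
    have "(LINT x|M. U (r n) x * (kA n x * \<psi> x)) - (LINT x|M. indicat_real (A (r n)) x * (\<psi> x * hA n x))
      = (LINT x|M. U (r n) x * (kA n x * (\<psi> x - \<phi> n x)))
        - (LINT x|M. indicat_real (A (r n)) x * hA n x * (\<psi> x - \<phi> n x))" for n
    proof -
      have test: "(LINT x|M. U (r n) x * (kA n x * \<phi> n x)) = (LINT x|M. indicat_real (A (r n)) x * hA n x * \<phi> n x)"
        using hole_solution_test_A[OF sol J \<psi> \<phi>L[of n, unfolded \<phi>_def]]
        by (simp add: kA_def \<phi>_def hA_def mult_ac)
      have "integrable M (\<lambda>x. U (r n) x * (kA n x * \<psi> x))" "integrable M (\<lambda>x. U (r n) x * (kA n x * \<phi> n x))"
        by (intro L2_mult_integrable UL L2_continuous_mult kAc \<phi>L \<psi>L)+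
      moreover have "(LINT x|M. U (r n) x * (kA n x * (\<psi> x - \<phi> n x)))
          = (LINT x|M. U (r n) x * (kA n x * \<psi> x) - U (r n) x * (kA n x * \<phi> n x))"
        by (intro LINT_cong) (auto simp: algebra_simps)
      ultimately have a: "(LINT x|M. U (r n) x * (kA n x * (\<psi> x - \<phi> n x)))
          = (LINT x|M. U (r n) x * (kA n x * \<psi> x)) - (LINT x|M. U (r n) x * (kA n x * \<phi> n x))" by simp
      have "integrable M (\<lambda>x. indicat_real (A (r n)) x * hA n x * \<psi> x)"
        "integrable M (\<lambda>x. indicat_real (A (r n)) x * hA n x * \<phi> n x)"
        by (intro L2_mult_integrable L2_indicator_mult hAL AM \<phi>L \<psi>L)+
      moreover have "(LINT x|M. indicat_real (A (r n)) x * hA n x * (\<psi> x - \<phi> n x))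
          = (LINT x|M. indicat_real (A (r n)) x * hA n x * \<psi> x - indicat_real (A (r n)) x * hA n x * \<phi> n x)"
        by (intro LINT_cong) (auto simp: algebra_simps)
      ultimately have b: "(LINT x|M. indicat_real (A (r n)) x * hA n x * (\<psi> x - \<phi> n x))
          = (LINT x|M. indicat_real (A (r n)) x * hA n x * \<psi> x) - (LINT x|M. indicat_real (A (r n)) x * hA n x * \<phi> n x)"
        by simp
      have c: "(LINT x|M. indicat_real (A (r n)) x * (\<psi> x * hA n x)) = (LINT x|M. indicat_real (A (r n)) x * hA n x * \<psi> x)"
        by (intro LINT_cong) auto
      show ?thesis unfolding a b c test by simp
    qed
    then show ?thesis using tendsto_diff[OF 1 2] by simp
  qed
  have lowA: "0 < (1 - X) * cJ" "(1 - X) * cJ \<le> kA0 x" if "x \<in> \<Omega>" for x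
    using cJ(1) cJ(2)[OF that] X by (auto simp: kA0_def)
  define u where "u x = X * hA0 x / kA0 x" for x
  obtain x0 where "x0 \<in> \<Omega>" using region_nonempty by blast
  note quotA = weak_limit_of_quotient[OF AM Aw L2_bdd_subseq[OF bdd(1)] kAc kA0c nkA nhA hA0L lowA(1)[OF \<open>x0 \<in> \<Omega>\<close>] lowA(2) eqA]
  have uL: "u \<in> L2 \<Omega>" and uw: "L2_weakly_tendsto \<Omega> (\<lambda>n. U (r n)) u"
    using quotA unfolding u_def by blast+

  \<comment> \<open>The same for \<open>V\<close> on the complement; here the identity holds exactly for continuous test functions.\<close>
  define kB where "kB n x = conv G (indicat_real (B (r n))) x + conv J (indicat_real (A (r n))) x" for n x
  define kB0 where "kB0 x = (1 - X) * conv G (\<lambda>y. 1) x + X * conv J (\<lambda>y. 1) x" for x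
  define hB where "hB n x = conv G (V (r n)) x + conv J (U (r n)) x - f (r n) x" for n x
  define hB0 where "hB0 x = g x + p x - f0 x" for x
  have nkB: "L2_null (\<lambda>n x. kB n x - kB0 x)"
    using L2_null_add[OF conv_indicator_L2_null[OF G BM Bw] conv_indicator_L2_null[OF J AM Aw]]
    by (simp add: kB_def kB0_def algebra_simps)
  have nhB: "L2_null (\<lambda>n x. hB n x - hB0 x)"
    using L2_null_diff[OF L2_null_add[OF ng np] nf] by (simp add: hB_def hB0_def algebra_simps)
  have hB0L: "hB0 \<in> L2 \<Omega>" unfolding hB0_def by (intro L2_diff L2_add gL pL f(2))
  have kBc: "continuous_on UNIV (kB n)" for n unfolding kB_def[abs_def]
    by (intro continuous_on_add cK[OF G, of "\<lambda>n. B (r n)"] cK[OF J, of "\<lambda>n. A (r n)"] AM BM)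
  have kB0c: "continuous_on UNIV kB0" unfolding kB0_def[abs_def] by (intro continuous_intros c1 J G)
  have eqB: "(\<lambda>n. (LINT x|M. V (r n) x * (kB n x * \<psi> x))
      - (LINT x|M. indicat_real (B (r n)) x * (\<psi> x * hB n x))) \<longlonglongrightarrow> 0"
    if \<psi>: "continuous_on UNIV \<psi>" for \<psi>
    using hole_solution_test_B[OF sol J G \<psi>] by (simp add: kB_def hB_def)
  have lowB: "X * cJ \<le> kB0 x" if "x \<in> \<Omega>" for x
  proof -
    have "0 \<le> (1 - X) * conv G (\<lambda>y. 1) x" using cG(1) cG(2)[OF that] X by simp
    moreover have "X * cJ \<le> X * conv J (\<lambda>y. 1) x" using cJ(2)[OF that] X by simp
    ultimately show ?thesis by (simp add: kB0_def)
  qed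
  have lowB0: "0 < X * cJ" using cJ(1) X by simp
  define v where "v x = (1 - X) * hB0 x / kB0 x" for x
  note quotB = weak_limit_of_quotient[OF BM Bw L2_bdd_subseq[OF bdd(2)] kBc kB0c nkB nhB hB0L lowB0 lowB eqB]
  have vL: "v \<in> L2 \<Omega>" and vw: "L2_weakly_tendsto \<Omega> (\<lambda>n. V (r n)) v"
    using quotB unfolding v_def by blast+

  have p: "p x = conv J u x" and q: "q x = conv J v x" and g: "g x = conv G v x" if "x \<in> \<Omega>" for x
    using conv_uniform_weak_limit_eq[OF J unif(1) uw that] conv_uniform_weak_limit_eq[OF J unif(2) vw that]
      conv_uniform_weak_limit_eq[OF G unif(3) vw that] by auto
  have lim: "limit_system J G X f0 u v x" if x: "x \<in> \<Omega>" for x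
  proof -
    have "kA0 x \<noteq> 0" "kB0 x \<noteq> 0" using lowA[OF x] lowB0 lowB[OF x] by auto
    then have "u x * kA0 x = X * hA0 x" "v x * kB0 x = (1 - X) * hB0 x" by (auto simp: u_def v_def)
    then show ?thesis
      unfolding limit_system_def kA0_def kB0_def hA0_def hB0_def p[OF x] q[OF x] g[OF x]
      by (auto simp: algebra_simps)
  qed
  have "(LINT x|M. U (r n) x) + (LINT x|M. V (r n) x) = 0" for n
    using sol[of "r n"] unfolding hole_solution_def by blast
  then have mean: "(LINT x|M. u x) + (LINT x|M. v x) = 0"
    using tendsto_add[OF weakly_tendsto_integral[OF uw] weakly_tendsto_integral[OF vw]]
    by (simp add: LIMSEQ_const_iff)
  have unif': "uniform_limit \<Omega> (\<lambda>n. conv J (U (r n))) (conv J u) sequentially"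
      "uniform_limit \<Omega> (\<lambda>n. conv J (V (r n))) (conv J v) sequentially"
      "uniform_limit \<Omega> (\<lambda>n. conv G (V (r n))) (conv G v) sequentially"
    using unif p q g unfolding uniform_limit_iff by simp_all
  show ?thesis
    by (rule that[OF r uL vL uw vw mean lim])
       (auto intro!: uniform_limit_conv_L2_null J G UL VL conv_continuous L2_integrable[OF uL] L2_integrable[OF vL] unif')
qed


section \<open>Uniqueness for the homogenized system\<close>

text \<open>
This is the integral of \<open>K (x - y) (t - b y)\<^sup>2\<close> over \<open>y\<close>, expanded so that continuity in \<open>x\<close> and \<open>t\<close>
is visible.
\<close>

definition interaction_density :: "('a \<Rightarrow> real) \<Rightarrow> ('a \<Rightarrow> real) \<Rightarrow> real \<Rightarrow> 'a \<Rightarrow> real" where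
  "interaction_density K b t x =
     t\<^sup>2 * conv K (\<lambda>y. 1) x - 2 * t * conv K b x + conv K (\<lambda>y. (b y)\<^sup>2) x"

lemma interaction_density_eq:
  assumes K: "interaction_kernel K" and b: "b \<in> L2 \<Omega>"
  shows "integrable M (\<lambda>y. K (x - y) * (t - b y)\<^sup>2)"
    and "interaction_density K b t x = (LINT y|M. K (x - y) * (t - b y)\<^sup>2)"
proof -
  have i: "integrable M (\<lambda>y. K (x - y) * 1)" "integrable M (\<lambda>y. K (x - y) * b y)" "integrable M (\<lambda>y. K (x - y) * (b y)\<^sup>2)"
    by (intro conv_integrable K L2_integrable[OF b] L2D(2)[OF b]; simp)+
  have eq: "(\<lambda>y. K (x - y) * (t - b y)\<^sup>2)
      = (\<lambda>y. t\<^sup>2 * (K (x - y) * 1) - 2 * t * (K (x - y) * b y) + K (x - y) * (b y)\<^sup>2)"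
    by (auto simp: power2_eq_square algebra_simps)
  show "integrable M (\<lambda>y. K (x - y) * (t - b y)\<^sup>2)" unfolding eq using i by simp
  show "interaction_density K b t x = (LINT y|M. K (x - y) * (t - b y)\<^sup>2)"
    unfolding eq interaction_density_def conv_def using i by simp
qed

lemma interaction_density_nonneg:
  assumes K: "interaction_kernel K" and b: "b \<in> L2 \<Omega>"
  shows "0 \<le> interaction_density K b t x"
  unfolding interaction_density_eq(2)[OF assms]
  by (intro integral_nonneg_AE AE_I2 mult_nonneg_nonneg kernel_nonneg[OF K]) simp

lemma interaction_density_integral:
  assumes K: "interaction_kernel K" and a: "a \<in> L2 \<Omega>" and b: "b \<in> L2 \<Omega>"
  shows "integrable M (\<lambda>x. interaction_density K b (a x) x)"
    and "(LINT x|M. interaction_density K b (a x) x)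
      = (LINT x|M. (a x)\<^sup>2 * conv K (\<lambda>y. 1) x) - 2 * (LINT x|M. a x * conv K b x)
        + (LINT x|M. (b x)\<^sup>2 * conv K (\<lambda>y. 1) x)"
proof -
  have i: "integrable M (\<lambda>x. (a x)\<^sup>2 * conv K (\<lambda>y. 1) x)" "integrable M (\<lambda>x. a x * conv K b x)"
    "integrable M (\<lambda>x. 1 * conv K (\<lambda>y. (b y)\<^sup>2) x)"
    by (intro conv_mult_integrable K L2D(2)[OF a] L2D(2)[OF b] L2_integrable[OF a] L2_integrable[OF b]; simp)+
  have eq: "(\<lambda>x. interaction_density K b (a x) x)
    = (\<lambda>x. (a x)\<^sup>2 * conv K (\<lambda>y. 1) x - 2 * (a x * conv K b x) + 1 * conv K (\<lambda>y. (b y)\<^sup>2) x)"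
    by (auto simp: interaction_density_def)
  show "integrable M (\<lambda>x. interaction_density K b (a x) x)" unfolding eq using i by simp
  have "(LINT x|M. 1 * conv K (\<lambda>y. (b y)\<^sup>2) x) = (LINT x|M. (b x)\<^sup>2 * conv K (\<lambda>y. 1) x)"
    by (rule conv_symmetric[OF K _ L2D(2)[OF b]]) simp
  then show "(LINT x|M. interaction_density K b (a x) x)
      = (LINT x|M. (a x)\<^sup>2 * conv K (\<lambda>y. 1) x) - 2 * (LINT x|M. a x * conv K b x)
        + (LINT x|M. (b x)\<^sup>2 * conv K (\<lambda>y. 1) x)"
    unfolding eq using i by simp
qed

lemma AE_region_witness:
  assumes ae: "AE x in M. P x" and S: "open S" "S \<subseteq> \<Omega>" "S \<noteq> {}"
  obtains x where "x \<in> S" "P x"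
proof -
  have "\<exists>x\<in>S. P x"
  proof (rule ccontr)
    assume none: "\<not> (\<exists>x\<in>S. P x)"
    have "AE x in lebesgue. x \<in> \<Omega> \<longrightarrow> P x" using ae by (simp add: AE_restrict_space_iff)
    then have "AE x in lebesgue. x \<notin> S" using none S(2) by (auto elim!: eventually_mono)
    moreover have "S \<in> sets lebesgue" using S(1) by simp
    ultimately have "S \<in> null_sets lebesgue" by (simp add: AE_iff_null_sets)
    then show False using open_not_negligible[OF S(1,3)] by (simp add: negligible_iff_null_sets)
  qed
  then show ?thesis using that by blast
qed

text \<open>
The function \<open>a\<close> agrees almost everywhere with the continuous function \<open>(J * b) / (J * 1)\<close>. Its
interaction with \<open>b\<close> is continuous and vanishes almost everywhere, hence everywhere. So for
every \<open>x\<close> the function \<open>b\<close> takes the value \<open>a x\<close> almost everywhere near \<open>x\<close>; nearby points share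
such a neighbourhood, thus \<open>a\<close> is locally constant, and \<open>\<Omega>\<close> is connected.
\<close>

lemma constant_of_interaction_zero:
  assumes J: "interaction_kernel J" and con: "connected \<Omega>" and a: "a \<in> L2 \<Omega>" and b: "b \<in> L2 \<Omega>"
    and fix_a: "AE x in M. a x * conv J (\<lambda>y. 1) x = conv J b x"
    and zero: "AE x in M. interaction_density J b (a x) x = 0"
  obtains k where "AE x in M. a x = k"
proof -
  obtain c where c: "0 < c" "\<And>x. x \<in> \<Omega> \<Longrightarrow> c \<le> conv J (\<lambda>y. 1) x" using kernel_mass_positive[OF J] by metis
  \<comment> \<open>The continuous representative of \<open>a\<close>; the maximum only matters outside \<open>\<Omega>\<close>.\<close>
  define ah where "ah x = conv J b x / max c (conv J (\<lambda>y. 1) x)" for x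
  have cJ: "continuous_on UNIV (conv J (\<lambda>y. 1))" "continuous_on UNIV (conv J b)"
    "continuous_on UNIV (conv J (\<lambda>y. (b y)\<^sup>2))"
    by (intro conv_continuous J L2_integrable[OF b] L2D(2)[OF b]; simp)+
  have ahc: "continuous_on UNIV ah" unfolding ah_def[abs_def]
    using c(1) by (intro continuous_intros cJ) (auto simp: max_def)
  have a_ah: "AE x in M. a x = ah x"
    using fix_a
  proof (rule AE_mp, intro AE_I2 impI)
    fix x assume x: "x \<in> space M" "a x * conv J (\<lambda>y. 1) x = conv J b x"
    then have "c \<le> conv J (\<lambda>y. 1) x" using c(2) by simp
    then show "a x = ah x" using x(2) c(1) by (simp add: ah_def max_def field_simps)
  qed
  define D where "D x = interaction_density J b (ah x) x" for x
  have Dc: "continuous_on UNIV D" unfolding D_def[abs_def] interaction_density_def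
    by (intro continuous_intros cJ ahc)
  have D_AE: "AE x in M. D x = 0" using a_ah zero by eventually_elim (simp add: D_def)
  have D0: "D x = 0" if x: "x \<in> \<Omega>" for x
  proof (rule ccontr)
    assume "D x \<noteq> 0"
    define S where "S = \<Omega> \<inter> {y. D y \<noteq> 0}"
    have "open {y. D y \<noteq> 0}" by (intro open_Collect_neq Dc continuous_on_const)
    then have "open S" "S \<subseteq> \<Omega>" "x \<in> S" using region_open x \<open>D x \<noteq> 0\<close> by (auto simp: S_def)
    then obtain y where "y \<in> S" "D y = 0" using AE_region_witness[OF D_AE] by blast
    then show False by (simp add: S_def)
  qed
  obtain d where d0: "0 < d" "\<And>z. norm z < d \<Longrightarrow> J 0 / 2 < J z" and "0 < J 0"
    using kernel_positive_near_zero[OF J] by metis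
  have d: "0 < d" "\<And>z. norm z < d \<Longrightarrow> 0 < J z"
    using d0 \<open>0 < J 0\<close> by (auto intro: less_trans[of 0 "J 0 / 2"])
  have near: "AE y in M. norm (x - y) < d \<longrightarrow> b y = ah x" if x: "x \<in> \<Omega>" for x
  proof -
    have "(LINT y|M. J (x - y) * (ah x - b y)\<^sup>2) = 0"
      using D0[OF x] interaction_density_eq(2)[OF J b] by (simp add: D_def)
    then have "AE y in M. J (x - y) * (ah x - b y)\<^sup>2 = 0"
      using integral_nonneg_eq_0_iff_AE[OF interaction_density_eq(1)[OF J b]] kernel_nonneg[OF J] by simp
    then show ?thesis
    proof (rule AE_mp, intro AE_I2 impI)
      fix y assume "J (x - y) * (ah x - b y)\<^sup>2 = 0" "norm (x - y) < d"
      then show "b y = ah x" using d(2)[of "x - y"] by simp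
    qed
  qed
  have loc: "ah x' = ah x" if x: "x \<in> \<Omega>" and x': "x' \<in> \<Omega>" and n: "dist x x' < d" for x x'
  proof -
    have "AE y in M. (norm (x - y) < d \<longrightarrow> b y = ah x) \<and> (norm (x' - y) < d \<longrightarrow> b y = ah x')"
      using near[OF x] near[OF x'] by eventually_elim simp
    moreover have "open (ball x d \<inter> ball x' d \<inter> \<Omega>)" by (intro open_Int open_ball region_open)
    moreover have "x \<in> ball x d \<inter> ball x' d \<inter> \<Omega>" using x n d(1) by (simp add: dist_commute)
    ultimately obtain y where y: "y \<in> ball x d \<inter> ball x' d \<inter> \<Omega>"
      "(norm (x - y) < d \<longrightarrow> b y = ah x) \<and> (norm (x' - y) < d \<longrightarrow> b y = ah x')"
      using AE_region_witness[of _ "ball x d \<inter> ball x' d \<inter> \<Omega>"] by blast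
    then show ?thesis by (simp add: dist_norm)
  qed
  have "ah constant_on \<Omega>"
  proof (rule locally_constant_imp_constant[OF con])
    fix x assume x: "x \<in> \<Omega>"
    have "openin (top_of_set \<Omega>) (\<Omega> \<inter> ball x d)" by (rule openin_open_Int[OF open_ball])
    moreover have "x \<in> \<Omega> \<inter> ball x d" using x d(1) by simp
    moreover have "\<forall>x'\<in>\<Omega> \<inter> ball x d. ah x' = ah x" using loc[OF x] by simp
    ultimately show "\<exists>T. openin (top_of_set \<Omega>) T \<and> x \<in> T \<and> (\<forall>x'\<in>T. ah x' = ah x)" by blast
  qed
  then obtain k where k: "\<And>x. x \<in> \<Omega> \<Longrightarrow> ah x = k" unfolding constant_on_def by blast
  have "AE x in M. x \<in> \<Omega>" using AE_space[of M] by simp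
  with a_ah have "AE x in M. a x = k" by eventually_elim (simp add: k)
  then show ?thesis by (rule that)
qed

text \<open>
In the variables \<open>a = u / X\<close> and \<open>b = v / (1 - X)\<close> the system is the Euler equation of a positive
combination of the double integrals of \<open>J (x - y) (a x - b y)\<^sup>2\<close> and \<open>G (x - y) (b x - b y)\<^sup>2\<close>. With zero source both vanish,
so \<open>a\<close> and \<open>b\<close> equal one constant \<open>k\<close>, and the mean condition reads \<open>k |\<Omega>| = 0\<close>.
\<close>

lemma limit_system_zero:
  assumes J: "interaction_kernel J" and G: "interaction_kernel G" and con: "connected \<Omega>"
    and X: "0 < X" "X < 1" and u: "u \<in> L2 \<Omega>" and v: "v \<in> L2 \<Omega>"
    and sys: "AE x in M. limit_system J G X (\<lambda>x. 0) u v x"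
    and mean: "(LINT x|M. u x) + (LINT x|M. v x) = 0"
  shows "AE x in M. u x = 0 \<and> v x = 0"
proof -
  define a where "a x = u x / X" for x
  define b where "b x = v x / (1 - X)" for x
  have aL: "a \<in> L2 \<Omega>" using L2_cmult[OF u, of "1 / X"] by (simp add: a_def[abs_def])
  have bL: "b \<in> L2 \<Omega>" using L2_cmult[OF v, of "1 / (1 - X)"] by (simp add: b_def[abs_def])
  have uv: "u x = X * a x" "v x = (1 - X) * b x" for x using X by (auto simp: a_def b_def)
  have cu: "conv K u x = X * conv K a x" and cv: "conv K v x = (1 - X) * conv K b x" for K x
    unfolding uv[abs_def] conv_cmult by simp_all
  note ai = L2_integrable[OF aL] and bi = L2_integrable[OF bL]
  have E1: "AE x in M. a x * conv J (\<lambda>y. 1) x = conv J b x"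
    using sys
  proof eventually_elim
    case (elim x)
    then have "X * (1 - X) * (a x * conv J (\<lambda>y. 1) x) = X * (1 - X) * conv J b x"
      unfolding limit_system_def cu cv uv by (simp add: algebra_simps)
    then show ?case using X by simp
  qed
  have E2: "AE x in M. X * (b x * conv J a x - (b x)\<^sup>2 * conv J (\<lambda>y. 1) x)
      + (1 - X) * (b x * conv G b x - (b x)\<^sup>2 * conv G (\<lambda>y. 1) x) = 0"
    using sys
  proof eventually_elim
    case (elim x)
    then have "(1 - X) * (X * (conv J a x - b x * conv J (\<lambda>y. 1) x)
        + (1 - X) * (conv G b x - b x * conv G (\<lambda>y. 1) x)) = 0"
      unfolding limit_system_def cu cv uv by (simp add: algebra_simps)
    then have "X * (conv J a x - b x * conv J (\<lambda>y. 1) x)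
        + (1 - X) * (conv G b x - b x * conv G (\<lambda>y. 1) x) = 0" using X by simp
    then have "b x * (X * (conv J a x - b x * conv J (\<lambda>y. 1) x)
        + (1 - X) * (conv G b x - b x * conv G (\<lambda>y. 1) x)) = 0" by simp
    then show ?case by (simp add: algebra_simps power2_eq_square)
  qed
  have one: "integrable M (\<lambda>y. 1 :: real)" by simp
  have i: "integrable M (\<lambda>x. b x * conv J a x)" "integrable M (\<lambda>x. (b x)\<^sup>2 * conv J (\<lambda>y. 1) x)"
    "integrable M (\<lambda>x. b x * conv G b x)" "integrable M (\<lambda>x. (b x)\<^sup>2 * conv G (\<lambda>y. 1) x)"
    by (intro conv_mult_integrable J G ai bi one L2D(2)[OF bL])+
  define aa ab bb gb gg where "aa = (LINT x|M. (a x)\<^sup>2 * conv J (\<lambda>y. 1) x)"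
    and "ab = (LINT x|M. a x * conv J b x)" and "bb = (LINT x|M. (b x)\<^sup>2 * conv J (\<lambda>y. 1) x)"
    and "gb = (LINT x|M. b x * conv G b x)" and "gg = (LINT x|M. (b x)\<^sup>2 * conv G (\<lambda>y. 1) x)"
  have ba: "(LINT x|M. b x * conv J a x) = ab" unfolding ab_def by (rule conv_symmetric[OF J bi ai])
  have "aa = ab" unfolding aa_def ab_def
  proof (rule integral_cong_AE)
    show "AE x in M. (a x)\<^sup>2 * conv J (\<lambda>y. 1) x = a x * conv J b x"
      using E1 by eventually_elim (simp add: power2_eq_square mult.assoc)
    show "(\<lambda>x. (a x)\<^sup>2 * conv J (\<lambda>y. 1) x) \<in> borel_measurable M" "(\<lambda>x. a x * conv J b x) \<in> borel_measurable M"
      by (intro borel_measurable_integrable conv_mult_integrable J ai bi one L2D(2)[OF aL])+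
  qed
  moreover have "X * (ab - bb) + (1 - X) * (gb - gg) = 0"
  proof -
    have "(LINT x|M. X * (b x * conv J a x - (b x)\<^sup>2 * conv J (\<lambda>y. 1) x)
      + (1 - X) * (b x * conv G b x - (b x)\<^sup>2 * conv G (\<lambda>y. 1) x)) = 0"
      using E2 by (rule integral_eq_zero_AE)
    then show ?thesis using i by (simp add: ba bb_def gb_def gg_def)
  qed
  moreover have "0 \<le> gg - 2 * gb + gg"
  proof -
    have "0 \<le> (LINT x|M. interaction_density G b (b x) x)"
      by (intro integral_nonneg_AE AE_I2 interaction_density_nonneg G bL)
    then show ?thesis unfolding interaction_density_integral(2)[OF G bL bL] gb_def gg_def .
  qed
  moreover have Jab: "(LINT x|M. interaction_density J b (a x) x) = aa - 2 * ab + bb"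
    unfolding interaction_density_integral(2)[OF J aL bL] aa_def ab_def bb_def ..
  moreover have "0 \<le> (LINT x|M. interaction_density J b (a x) x)"
    by (intro integral_nonneg_AE AE_I2 interaction_density_nonneg J bL)
  ultimately have Jzero: "aa - 2 * ab + bb = 0"
  proof -
    assume h: "aa = ab" "X * (ab - bb) + (1 - X) * (gb - gg) = 0" "0 \<le> gg - 2 * gb + gg"
      "(LINT x|M. interaction_density J b (a x) x) = aa - 2 * ab + bb"
      "0 \<le> (LINT x|M. interaction_density J b (a x) x)"
    have "(1 - X) * (gb - gg) \<le> 0" using h(3) X by (intro mult_nonneg_nonpos) auto
    then have "0 \<le> X * (ab - bb)" using h(2) by linarith
    then have "0 \<le> ab - bb" using X by (simp add: zero_le_mult_iff)
    then show ?thesis using h(1,4,5) by linarith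
  qed
  have Z1: "AE x in M. interaction_density J b (a x) x = 0"
    using integral_nonneg_eq_0_iff_AE[OF interaction_density_integral(1)[OF J aL bL]]
      interaction_density_nonneg[OF J bL] Jab Jzero by simp
  obtain k where k: "AE x in M. a x = k"
    by (rule constant_of_interaction_zero[OF J con aL bL E1 Z1])
  have "(LINT x|M. interaction_density J a (b x) x) = bb - 2 * ab + aa"
    unfolding interaction_density_integral(2)[OF J bL aL] aa_def bb_def ba ..
  then have Z2: "AE x in M. interaction_density J a (b x) x = 0"
    using integral_nonneg_eq_0_iff_AE[OF interaction_density_integral(1)[OF J bL aL]]
      interaction_density_nonneg[OF J aL] Jzero by simp
  have am: "a \<in> borel_measurable M" by (rule L2D(1)[OF aL])
  have ck: "conv J a x = k * conv J (\<lambda>y. 1) x" and ck2: "conv J (\<lambda>y. (a y)\<^sup>2) x = k\<^sup>2 * conv J (\<lambda>y. 1) x" for x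
  proof -
    have "conv J a x = conv J (\<lambda>y. k * 1) x" by (rule conv_cong_AE[OF _ am _ J]) (use k in simp_all)
    then show "conv J a x = k * conv J (\<lambda>y. 1) x" by (simp only: conv_cmult)
    have "AE y in M. (a y)\<^sup>2 = k\<^sup>2 * 1" using k by eventually_elim simp
    then have "conv J (\<lambda>y. (a y)\<^sup>2) x = conv J (\<lambda>y. k\<^sup>2 * 1) x"
      by (rule conv_cong_AE[OF _ _ _ J]) (use am in simp_all)
    then show "conv J (\<lambda>y. (a y)\<^sup>2) x = k\<^sup>2 * conv J (\<lambda>y. 1) x" by (simp only: conv_cmult)
  qed
  obtain c where c: "0 < c" "\<And>x. x \<in> \<Omega> \<Longrightarrow> c \<le> conv J (\<lambda>y. 1) x" using kernel_mass_positive[OF J] by metis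
  have bk: "AE x in M. b x = k"
    using Z2
  proof (rule AE_mp, intro AE_I2 impI)
    fix x assume x: "x \<in> space M" "interaction_density J a (b x) x = 0"
    have "interaction_density J a (b x) x = (b x - k)\<^sup>2 * conv J (\<lambda>y. 1) x"
      unfolding interaction_density_def ck ck2 by (simp add: power2_eq_square algebra_simps)
    moreover have "conv J (\<lambda>y. 1) x \<noteq> 0" using c(1) c(2)[of x] x(1) by auto
    ultimately show "b x = k" using x(2) by simp
  qed
  have "AE x in M. u x = X * k" "AE x in M. v x = (1 - X) * k"
    using k bk by (eventually_elim, simp add: uv)+
  then have "(LINT x|M. u x) = (LINT x|M. X * k)" "(LINT x|M. v x) = (LINT x|M. (1 - X) * k)"
    using integral_cong_AE[OF L2D(1)[OF u], of "\<lambda>x. X * k"]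
      integral_cong_AE[OF L2D(1)[OF v], of "\<lambda>x. (1 - X) * k"] by auto
  then have "k * measure M \<Omega> = 0" using mean by (simp add: algebra_simps)
  moreover have "measure M \<Omega> \<noteq> 0"
    using open_not_negligible[OF region_open region_nonempty] region_lmeasurable
    by (simp add: measure_restrict_space negligible_iff_measure)
  ultimately have "k = 0" by simp
  show ?thesis using k bk by eventually_elim (simp add: uv \<open>k = 0\<close>)
qed


section \<open>The uniform bound\<close>

lemma nonlocal_form_scale:
  "nonlocal_form J G A B (\<lambda>x. c * U x) (\<lambda>x. c * V x) (\<lambda>x. d * \<Phi> x) (\<lambda>x. d * \<Theta> x)
    = c * d * nonlocal_form J G A B U V \<Phi> \<Theta>"
proof -
  have sc: "(LINT x|M. c * p x * (d * q x) * k x) = c * d * (LINT x|M. p x * q x * k x)"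
    "(LINT x|M. d * p x * (c * q x)) = c * d * (LINT x|M. p x * q x)" for p q k :: "'a \<Rightarrow> real"
    by (simp_all flip: integral_mult_right_zero add: mult_ac)
  show ?thesis unfolding nonlocal_form_def conv_cmult sc by (simp add: algebra_simps)
qed

lemma hole_solution_scale:
  assumes "hole_solution J G s A B f U V"
  shows "hole_solution J G s A B (\<lambda>x. c * f x) (\<lambda>x. c * U x) (\<lambda>x. c * V x)"
proof -
  note h = assms[unfolded hole_solution_def]
  have sc: "(LINT x|M. c * p x * (c * q x)) = c\<^sup>2 * (LINT x|M. p x * q x)"
    "(LINT x|M. c * p x * q x) = c * (LINT x|M. p x * q x)" for p q :: "'a \<Rightarrow> real"
    by (simp_all flip: integral_mult_right_zero add: power2_eq_square mult_ac)
  have "(LINT x|M. c * U x) + (LINT x|M. c * V x) = c * ((LINT x|M. U x) + (LINT x|M. V x))"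
    by (simp add: distrib_left)
  then have mean: "(LINT x|M. c * U x) + (LINT x|M. c * V x) = 0" using h by simp
  have "c\<^sup>2 * nonlocal_form J G A B U V U V \<le> c\<^sup>2 * (- (LINT x|M. f x * U x) - (LINT x|M. f x * V x))"
    using h by (intro mult_left_mono) auto
  then have energy: "nonlocal_form J G A B (\<lambda>x. c * U x) (\<lambda>x. c * V x) (\<lambda>x. c * U x) (\<lambda>x. c * V x)
      \<le> - (LINT x|M. c * f x * (c * U x)) - (LINT x|M. c * f x * (c * V x))"
    unfolding nonlocal_form_scale sc by (simp add: power2_eq_square algebra_simps)
  have test: "nonlocal_form J G A B (\<lambda>x. c * U x) (\<lambda>x. c * V x) (\<lambda>x. indicat_real A x * \<psi> (s x)) (\<lambda>x. indicat_real B x * \<theta> x)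
        = - (LINT x|M. c * f x * (indicat_real A x * \<psi> (s x))) - (LINT x|M. c * f x * (indicat_real B x * \<theta> x))"
    if "continuous_on UNIV \<psi>" "continuous_on UNIV \<theta>" for \<psi> \<theta>
  proof -
    have eq: "nonlocal_form J G A B U V (\<lambda>x. indicat_real A x * \<psi> (s x)) (\<lambda>x. indicat_real B x * \<theta> x)
        = - (LINT x|M. f x * (indicat_real A x * \<psi> (s x))) - (LINT x|M. f x * (indicat_real B x * \<theta> x))"
      using h that by blast
    have "nonlocal_form J G A B (\<lambda>x. c * U x) (\<lambda>x. c * V x) (\<lambda>x. indicat_real A x * \<psi> (s x)) (\<lambda>x. indicat_real B x * \<theta> x)
        = c * nonlocal_form J G A B U V (\<lambda>x. indicat_real A x * \<psi> (s x)) (\<lambda>x. indicat_real B x * \<theta> x)"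
      using nonlocal_form_scale[of J G A B c U V 1 "\<lambda>x. indicat_real A x * \<psi> (s x)" "\<lambda>x. indicat_real B x * \<theta> x"]
      by simp
    then show ?thesis unfolding eq sc by (simp only: right_diff_distrib mult_minus_right)
  qed
  show ?thesis unfolding hole_solution_def
    using h mean energy test by (auto intro: L2_cmult)
qed

lemma unbounded_subsequence:
  fixes N :: "nat \<Rightarrow> real"
  assumes "\<nexists>C. \<forall>n. N n \<le> C"
  obtains t where "strict_mono t" "\<And>k. real k < N (t k)"
proof -
  have big: "\<exists>y. C < N y \<and> x < y" for C x
  proof (rule ccontr)
    assume no: "\<nexists>y. C < N y \<and> x < y"
    have "N n \<le> max C (Max (N ` {..x}))" for n
    proof (cases "n \<le> x")
      case True
      then show ?thesis by (intro max.coboundedI2 Max_ge) auto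
    next
      case False
      then show ?thesis using no by (intro max.coboundedI1) (meson not_le)
    qed
    then show False using assms by blast
  qed
  have "\<exists>t. \<forall>k. real k < N (t k) \<and> t k < t (Suc k)"
    by (rule dependent_nat_choice) (use big in blast)+
  then show ?thesis using that strict_mono_Suc_iff by metis
qed

text \<open>
If the norms were unbounded, the normalised solutions along a subsequence would have norm one and
sources tending to zero, so by \<open>hole_solutions_compact\<close> and uniqueness their weak limit would be zero.
Then \<open>J * U\<^sub>n\<close>, \<open>J * V\<^sub>n\<close>, \<open>G * V\<^sub>n\<close> tend to zero strongly, and so does, by the energy inequality, the
sum of the integrals of \<open>U\<^sub>n\<^sup>2 (J * \<chi>\<^sub>B)\<close> and \<open>V\<^sub>n\<^sup>2 (J * \<chi>\<^sub>A)\<close>. Their coefficients stay above a positive constant,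
which contradicts norm one.
\<close>

lemma hole_solutions_bounded:
  assumes J: "interaction_kernel J" and G: "interaction_kernel G" and con: "connected \<Omega>"
    and X: "0 < X" "X < 1"
    and A: "Linf_weakstar_tendsto \<Omega> (\<lambda>n. indicat_real (A n)) (\<lambda>x. X)"
    and s: "\<And>n. s n \<in> borel_measurable borel" "\<And>n x. x \<in> \<Omega> \<Longrightarrow> norm (s n x - x) \<le> \<delta> n" "\<delta> \<longlonglongrightarrow> 0"
    and sol: "\<And>n. hole_solution J G (s n) (A n) (B n) (f n) (U n) (V n)"
    and f: "L2_bdd f"
  shows "L2_bdd U" "L2_bdd V"
proof -
  define N where "N n = (LINT x|M. (U n x)\<^sup>2) + (LINT x|M. (V n x)\<^sup>2)" for n
  have UL: "U n \<in> L2 \<Omega>" and VL: "V n \<in> L2 \<Omega>" and AM: "A n \<in> sets M" and Beq: "B n = \<Omega> - A n"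
    and fL: "f n \<in> L2 \<Omega>" for n
    using sol[of n] unfolding hole_solution_def by blast+
  have BM: "B n \<in> sets M" for n using AM[of n] Beq sets.compl_sets[of "A n" M] by simp
  have "\<exists>C. \<forall>n. N n \<le> C"
  proof (rule ccontr)
    assume "\<nexists>C. \<forall>n. N n \<le> C"
    then obtain t where t: "strict_mono t" "\<And>k. real k < N (t k)" using unbounded_subsequence by blast
    define c where "c k = 1 / sqrt (N (t k))" for k
    have Npos: "0 < N (t k)" for k using t(2)[of k] by (meson le_less_trans of_nat_0_le_iff)
    have c2: "(c k)\<^sup>2 = 1 / N (t k)" for k using Npos[of k] by (simp add: c_def power_divide)
    define f' U' V' where "f' k x = c k * f (t k) x" and "U' k x = c k * U (t k) x"
      and "V' k x = c k * V (t k) x" for k x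
    have sol': "hole_solution J G (s (t k)) (A (t k)) (B (t k)) (f' k) (U' k) (V' k)" for k
      unfolding f'_def U'_def V'_def by (rule hole_solution_scale[OF sol])
    have UL': "U' k \<in> L2 \<Omega>" and VL': "V' k \<in> L2 \<Omega>" and fL': "f' k \<in> L2 \<Omega>" for k
      unfolding f'_def U'_def V'_def by (intro L2_cmult UL VL fL)+
    have sq: "(LINT x|M. (c k * p x)\<^sup>2) = (LINT x|M. (p x)\<^sup>2) / N (t k)" for k and p :: "'a \<Rightarrow> real"
      unfolding power_mult_distrib c2 by simp
    have one: "(LINT x|M. (U' k x)\<^sup>2) + (LINT x|M. (V' k x)\<^sup>2) = 1" for k
      using Npos[of k] unfolding U'_def V'_def sq by (simp add: N_def flip: add_divide_distrib)
    have nn: "0 \<le> (LINT x|M. (p x)\<^sup>2)" for p :: "'a \<Rightarrow> real" by simp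
    have bU: "(LINT x|M. (U' k x)\<^sup>2) \<le> 1" and bV: "(LINT x|M. (V' k x)\<^sup>2) \<le> 1" for k
      using one[of k] nn[of "V' k"] nn[of "U' k"] by linarith+
    have bdd: "L2_bdd U'" "L2_bdd V'" using UL' VL' bU bV unfolding L2_bdd_def by blast+
    obtain C where C: "\<And>n. (LINT x|M. (f n x)\<^sup>2) \<le> C" using f unfolding L2_bdd_def by blast
    have C0: "0 \<le> C" by (rule order_trans[OF _ C[of 0]]) simp
    have "(\<lambda>k. LINT x|M. (f' k x)\<^sup>2) \<longlonglongrightarrow> 0"
    proof (rule tendsto_sandwich[OF _ _ tendsto_const])
      show "(\<lambda>k. C / real k) \<longlonglongrightarrow> 0" by (rule lim_const_over_n)
      have "(LINT x|M. (f' k x)\<^sup>2) \<le> C / real k" if "0 < k" for k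
      proof -
        have "(LINT x|M. (f' k x)\<^sup>2) \<le> C / N (t k)"
          unfolding f'_def sq using C Npos[of k] by (intro divide_right_mono) auto
        also have "\<dots> \<le> C / real k" using t(2)[of k] that C0 by (intro divide_left_mono) auto
        finally show ?thesis .
      qed
      then show "\<forall>\<^sub>F k in sequentially. (LINT x|M. (f' k x)\<^sup>2) \<le> C / real k"
        by (intro eventually_sequentiallyI[of 1]) auto
    qed simp
    then have f'null: "L2_null f'" using fL' by (simp add: L2_null_def)
    have At: "Linf_weakstar_tendsto \<Omega> (\<lambda>k. indicat_real (A (t k))) (\<lambda>x. X)" by (rule weakstar_subseq[OF A t(1)])
    have Bt: "Linf_weakstar_tendsto \<Omega> (\<lambda>k. indicat_real (B (t k))) (\<lambda>x. 1 - X)" by (rule weakstar_complement[OF AM Beq At])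
    have \<delta>t: "(\<lambda>k. \<delta> (t k)) \<longlonglongrightarrow> 0" using LIMSEQ_subseq_LIMSEQ[OF s(3) t(1)] by (simp add: o_def)
    have f'null0: "L2_null (\<lambda>k x. f' k x - 0)" using f'null by simp
    obtain r u v where r: "strict_mono r" and u: "u \<in> L2 \<Omega>" and v: "v \<in> L2 \<Omega>"
      and mean: "(LINT x|M. u x) + (LINT x|M. v x) = 0"
      and lim: "\<And>x. x \<in> \<Omega> \<Longrightarrow> limit_system J G X (\<lambda>x. 0) u v x"
      and null: "L2_null (\<lambda>n x. conv J (U' (r n)) x - conv J u x)"
        "L2_null (\<lambda>n x. conv J (V' (r n)) x - conv J v x)"
        "L2_null (\<lambda>n x. conv G (V' (r n)) x - conv G v x)"
      by (rule hole_solutions_compact[OF J G X At s(1) s(2) \<delta>t sol' f'null0 L2_const bdd], assumption) blast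
    have "AE x in M. u x = 0 \<and> v x = 0"
      by (rule limit_system_zero[OF J G con X u v _ mean]) (use lim in auto)
    then have "AE x in M. u x = 0" "AE x in M. v x = 0" by auto
    then have z: "conv K u x = 0" "conv K v x = 0" if "interaction_kernel K" for K x
      using conv_cong_AE[of u "\<lambda>x. 0" K x] conv_cong_AE[of v "\<lambda>x. 0" K x] L2D(1)[OF u] L2D(1)[OF v] that
      by (simp_all add: conv_def)
    have null': "L2_null (\<lambda>n. conv J (U' (r n)))" "L2_null (\<lambda>n. conv J (V' (r n)))" "L2_null (\<lambda>n. conv G (V' (r n)))"
      using null by (simp_all add: z J G)

    \<comment> \<open>A further subsequence makes \<open>J * \<chi>\<^sub>A\<close> and \<open>J * \<chi>\<^sub>B\<close> converge uniformly, which gives their lower bound.\<close>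
    have bAB: "L2_bdd (\<lambda>n. indicat_real (A (t (r n))))" "L2_bdd (\<lambda>n. indicat_real (B (t (r n))))"
      by (intro L2_bdd_indicator AM BM)+
    obtain r2 p q where r2: "strict_mono r2"
      and unif: "uniform_limit \<Omega> (\<lambda>n. conv J (indicat_real (A (t (r (r2 n)))))) p sequentially"
        "uniform_limit \<Omega> (\<lambda>n. conv J (indicat_real (B (t (r (r2 n)))))) q sequentially"
      by (rule conv_sequence_compact[OF J J bAB]) blast
    define m where "m n = r (r2 n)" for n
    have m: "strict_mono m" using r r2 by (simp add: m_def strict_mono_def)
    obtain cJ where cJ: "0 < cJ" "\<And>x. x \<in> \<Omega> \<Longrightarrow> cJ \<le> conv J (\<lambda>y. 1) x"
      using kernel_mass_positive[OF J] by metis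
    have low: "\<forall>\<^sub>F n in sequentially. \<forall>x\<in>\<Omega>. \<sigma> * cJ / 2 \<le> conv J (indicat_real (S (t (m n)))) x"
      if hyp: "0 < \<sigma>" "\<And>n. S n \<in> sets M" "Linf_weakstar_tendsto \<Omega> (\<lambda>k. indicat_real (S (t k))) (\<lambda>x. \<sigma>)"
        "uniform_limit \<Omega> (\<lambda>n. conv J (indicat_real (S (t (m n))))) p' sequentially" for \<sigma> p' and S :: "nat \<Rightarrow> 'a set"
    proof -
      have p': "p' x = \<sigma> * conv J (\<lambda>y. 1) x" if x: "x \<in> \<Omega>" for x
        using tendsto_uniform_limitI[OF hyp(4) x]
          conv_indicator_weakstar[OF J hyp(2) weakstar_subseq[OF hyp(3) m]] LIMSEQ_unique by blast
      have "\<forall>\<^sub>F n in sequentially. \<forall>x\<in>\<Omega>. dist (conv J (indicat_real (S (t (m n)))) x) (p' x) < \<sigma> * cJ / 2"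
        using hyp(1) cJ(1) by (intro uniform_limitD[OF hyp(4)]) simp
      then show ?thesis
      proof (eventually_elim, intro ballI)
        fix n x assume d: "\<forall>x\<in>\<Omega>. dist (conv J (indicat_real (S (t (m n)))) x) (p' x) < \<sigma> * cJ / 2" and x: "x \<in> \<Omega>"
        have "\<sigma> * cJ \<le> p' x" using p'[OF x] cJ(2)[OF x] hyp(1) by simp
        moreover have "\<bar>conv J (indicat_real (S (t (m n)))) x - p' x\<bar> < \<sigma> * cJ / 2"
          using d x by (simp add: dist_real_def)
        ultimately show "\<sigma> * cJ / 2 \<le> conv J (indicat_real (S (t (m n)))) x" by linarith
      qed
    qed
    define c' where "c' = min X (1 - X) * cJ / 2"
    have c': "0 < c'" using X cJ(1) by (simp add: c'_def)
    have c'le: "c' \<le> X * cJ / 2" "c' \<le> (1 - X) * cJ / 2"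
      using cJ(1) by (auto simp: c'_def intro!: mult_right_mono)
    define Q where "Q n = - (LINT x|M. U' n x * f' n x) - (LINT x|M. V' n x * f' n x)
      + (LINT x|M. U' n x * conv J (V' n) x) + (LINT x|M. V' n x * conv J (U' n) x)
      + (LINT x|M. V' n x * conv G (V' n) x)" for n
    have "(\<lambda>n. Q (r n)) \<longlonglongrightarrow> - 0 - 0 + 0 + 0 + 0"
      unfolding Q_def
      by (intro tendsto_intros L2_null_bdd_product L2_bdd_subseq[OF bdd(1)] L2_bdd_subseq[OF bdd(2)] null'
          L2_null_subseq[OF f'null r])
    then have Q0: "(\<lambda>n. Q (m n)) \<longlonglongrightarrow> 0"
      using LIMSEQ_subseq_LIMSEQ[of "\<lambda>n. Q (r n)" 0 r2] r2 by (simp add: o_def m_def)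
    have X': "0 < 1 - X" using X(2) by simp
    have "\<forall>\<^sub>F n in sequentially. c' \<le> Q (m n)"
      using low[of X A, OF X(1) AM At unif(1)[folded m_def]] low[of "1 - X" B, OF X' BM Bt unif(2)[folded m_def]]
    proof eventually_elim
      case (elim n)
      let ?k = "m n"
      have lowA: "c' \<le> conv J (indicat_real (A (t ?k))) x" and lowB: "c' \<le> conv J (indicat_real (B (t ?k))) x"
        if "x \<in> \<Omega>" for x using elim X c'le that by force+
      have IA: "integrable M (indicat_real (A (t ?k)))" and IB: "integrable M (indicat_real (B (t ?k)))"
        by (intro L2_integrable L2_indicator AM BM)+
      have mono: "c' * (LINT x|M. (w x)\<^sup>2) \<le> (LINT x|M. w x * w x * conv J (indicat_real S) x)"
        if w: "w \<in> L2 \<Omega>" and S: "S \<in> sets M" and le: "\<And>x. x \<in> \<Omega> \<Longrightarrow> c' \<le> conv J (indicat_real S) x" for w S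
      proof -
        have "(LINT x|M. c' * (w x)\<^sup>2) \<le> (LINT x|M. w x * w x * conv J (indicat_real S) x)"
        proof (rule integral_mono)
          show "integrable M (\<lambda>x. w x * w x * conv J (indicat_real S) x)"
            by (intro conv_mult_integrable J L2_mult_integrable w L2_integrable[OF L2_indicator[OF S]])
          show "c' * (w x)\<^sup>2 \<le> w x * w x * conv J (indicat_real S) x" if "x \<in> space M" for x
            using mult_left_mono[OF le[of x], of "(w x)\<^sup>2"] that by (simp add: power2_eq_square mult_ac)
        qed (use L2D(2)[OF w] in simp)
        then show ?thesis by simp
      qed
      have "0 \<le> conv G (indicat_real (B (t ?k))) x" for x
        unfolding conv_def by (intro integral_nonneg_AE AE_I2 mult_nonneg_nonneg kernel_nonneg[OF G]) simp
      then have G0: "0 \<le> (LINT x|M. V' ?k x * V' ?k x * conv G (indicat_real (B (t ?k))) x)"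
        by (intro integral_nonneg_AE AE_I2 mult_nonneg_nonneg[OF zero_le_square])
      have "nonlocal_form J G (A (t ?k)) (B (t ?k)) (U' ?k) (V' ?k) (U' ?k) (V' ?k)
          \<le> - (LINT x|M. f' ?k x * U' ?k x) - (LINT x|M. f' ?k x * V' ?k x)"
        using sol'[of ?k] unfolding hole_solution_def by blast
      then have "(LINT x|M. U' ?k x * U' ?k x * conv J (indicat_real (B (t ?k))) x)
          + (LINT x|M. V' ?k x * V' ?k x * conv J (indicat_real (A (t ?k))) x) \<le> Q ?k"
        using G0 unfolding nonlocal_form_def Q_def mult.commute[of "f' ?k _"] by linarith
      moreover have "c' * ((LINT x|M. (U' ?k x)\<^sup>2) + (LINT x|M. (V' ?k x)\<^sup>2))
          \<le> (LINT x|M. U' ?k x * U' ?k x * conv J (indicat_real (B (t ?k))) x)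
          + (LINT x|M. V' ?k x * V' ?k x * conv J (indicat_real (A (t ?k))) x)"
        unfolding distrib_left by (intro add_mono mono UL' VL' AM BM lowA lowB)
      ultimately show ?case unfolding one by simp
    qed
    then have "c' \<le> 0" using Q0 by (intro tendsto_lowerbound) auto
    then show False using c' by simp
  qed
  then obtain C where C: "\<And>n. N n \<le> C" by blast
  have "(LINT x|M. (U n x)\<^sup>2) \<le> N n" "(LINT x|M. (V n x)\<^sup>2) \<le> N n" for n
    by (simp_all add: N_def)
  then show "L2_bdd U" "L2_bdd V" using UL VL C unfolding L2_bdd_def by (meson order_trans)+
qed


section \<open>Convergence of the whole sequence\<close>

lemma limit_system_diff:
  assumes J: "interaction_kernel J" and G: "interaction_kernel G"
    and L: "u \<in> L2 \<Omega>" "v \<in> L2 \<Omega>" "u' \<in> L2 \<Omega>" "v' \<in> L2 \<Omega>"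
    and sys: "limit_system J G X f u v x" "limit_system J G X f u' v' x"
  shows "limit_system J G X (\<lambda>x. 0) (\<lambda>x. u x - u' x) (\<lambda>x. v x - v' x) x"
proof -
  have c: "conv J (\<lambda>x. u x - u' x) x = conv J u x - conv J u' x"
    "conv J (\<lambda>x. v x - v' x) x = conv J v x - conv J v' x"
    "conv G (\<lambda>x. v x - v' x) x = conv G v x - conv G v' x"
    by (intro conv_diff J G L2_integrable L)+
  show ?thesis using sys unfolding limit_system_def c by (simp add: algebra_simps)
qed

lemma limit_system_unique:
  assumes J: "interaction_kernel J" and G: "interaction_kernel G" and con: "connected \<Omega>"
    and X: "0 < X" "X < 1"
    and L: "u \<in> L2 \<Omega>" "v \<in> L2 \<Omega>" "u' \<in> L2 \<Omega>" "v' \<in> L2 \<Omega>"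
    and sys: "AE x in M. limit_system J G X f u v x" "AE x in M. limit_system J G X f u' v' x"
    and mean: "(LINT x|M. u x) + (LINT x|M. v x) = 0" "(LINT x|M. u' x) + (LINT x|M. v' x) = 0"
  shows "AE x in M. u x = u' x \<and> v x = v' x"
proof -
  have "AE x in M. limit_system J G X (\<lambda>x. 0) (\<lambda>x. u x - u' x) (\<lambda>x. v x - v' x) x"
    using sys by eventually_elim (rule limit_system_diff[OF J G L])
  moreover have "(LINT x|M. u x - u' x) + (LINT x|M. v x - v' x) = 0"
    using mean L2_integrable[OF L(1)] L2_integrable[OF L(2)] L2_integrable[OF L(3)] L2_integrable[OF L(4)] by simp
  ultimately have "AE x in M. u x - u' x = 0 \<and> v x - v' x = 0"
    by (intro limit_system_zero[OF J G con X] L2_diff L)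
  then show ?thesis by eventually_elim simp
qed

lemma L2_weakly_tendsto_subseqI:
  assumes "\<And>t :: nat \<Rightarrow> nat. strict_mono t \<Longrightarrow> \<exists>r :: nat \<Rightarrow> nat. strict_mono r \<and> L2_weakly_tendsto \<Omega> (\<lambda>n. W (t (r n))) w"
  shows "L2_weakly_tendsto \<Omega> W w"
  unfolding L2_weakly_tendsto_def
proof (intro ballI, rule ccontr)
  fix g :: "'a \<Rightarrow> real" assume g: "g \<in> L2 \<Omega>"
  let ?I = "\<lambda>n. LINT x|M. W n x * g x"
  let ?L = "LINT x|M. w x * g x"
  assume "\<not> ?I \<longlonglongrightarrow> ?L"
  then obtain e where e: "0 < e" "\<And>N. \<exists>n\<ge>N. e \<le> dist (?I n) ?L"
    unfolding lim_sequentially by (metis not_le)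
  have "infinite {n. e \<le> dist (?I n) ?L}"
    unfolding infinite_nat_iff_unbounded_le using e(2) by blast
  then obtain t :: "nat \<Rightarrow> nat" where t: "strict_mono t" "\<And>n. e \<le> dist (?I (t n)) ?L"
    using infinite_enumerate by blast
  obtain r where "strict_mono r" "L2_weakly_tendsto \<Omega> (\<lambda>n. W (t (r n))) w" using assms[OF t(1)] by blast
  then have "(\<lambda>n. ?I (t (r n))) \<longlonglongrightarrow> ?L" using g unfolding L2_weakly_tendsto_def by blast
  then obtain n where "dist (?I (t (r n))) ?L < e"
    using e(1) unfolding lim_sequentially by blast
  then show False using t(2)[of "r n"] by simp
qed

lemma L2_weakly_tendsto_cong_AE:
  assumes "L2_weakly_tendsto \<Omega> W w" "AE x in M. w x = w' x" "w \<in> L2 \<Omega>" "w' \<in> L2 \<Omega>"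
  shows "L2_weakly_tendsto \<Omega> W w'"
proof -
  have "(LINT x|M. w x * g x) = (LINT x|M. w' x * g x)" if g: "g \<in> L2 \<Omega>" for g
  proof (rule integral_cong_AE)
    show "AE x in M. w x * g x = w' x * g x" using assms(2) by eventually_elim simp
  qed (intro borel_measurable_times L2D(1) assms g)+
  then show ?thesis using assms(1) unfolding L2_weakly_tendsto_def by simp
qed

text \<open>
By \<open>hole_solutions_compact\<close> every subsequence has a further subsequence that converges to a solution
of the homogenized system, and the solution is unique.
\<close>

lemma hole_solutions_converge:
  assumes J: "interaction_kernel J" and G: "interaction_kernel G" and con: "connected \<Omega>"
    and X: "0 < X" "X < 1"
    and A: "Linf_weakstar_tendsto \<Omega> (\<lambda>n. indicat_real (A n)) (\<lambda>x. X)"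
    and s: "\<And>n. s n \<in> borel_measurable borel" "\<And>n x. x \<in> \<Omega> \<Longrightarrow> norm (s n x - x) \<le> \<delta> n" "\<delta> \<longlonglongrightarrow> 0"
    and sol: "\<And>n. hole_solution J G (s n) (A n) (B n) (f n) (U n) (V n)"
    and f: "L2_null (\<lambda>n x. f n x - f0 x)" "f0 \<in> L2 \<Omega>"
  obtains u v where "u \<in> L2 \<Omega>" "v \<in> L2 \<Omega>" "L2_weakly_tendsto \<Omega> U u" "L2_weakly_tendsto \<Omega> V v"
    "(LINT x|M. u x) + (LINT x|M. v x) = 0" "AE x in M. limit_system J G X f0 u v x"
proof -
  note bdd = hole_solutions_bounded[OF J G con X A s(1) s(2) s(3) sol L2_bdd_of_null[OF f]]
  have sub: "\<exists>(r :: nat \<Rightarrow> nat) u v. strict_mono r \<and> u \<in> L2 \<Omega> \<and> v \<in> L2 \<Omega> \<and>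
      L2_weakly_tendsto \<Omega> (\<lambda>n. U (t (r n))) u \<and> L2_weakly_tendsto \<Omega> (\<lambda>n. V (t (r n))) v \<and>
      (LINT x|M. u x) + (LINT x|M. v x) = 0 \<and> (AE x in M. limit_system J G X f0 u v x)"
    if t: "strict_mono t" for t :: "nat \<Rightarrow> nat"
  proof -
    have \<delta>t: "(\<lambda>n. \<delta> (t n)) \<longlonglongrightarrow> 0" using LIMSEQ_subseq_LIMSEQ[OF s(3) t] by (simp add: o_def)
    show ?thesis
    proof (rule hole_solutions_compact[OF J G X weakstar_subseq[OF A t] s(1) s(2) \<delta>t sol
          L2_null_subseq[OF f(1) t] f(2) L2_bdd_subseq[OF bdd(1)] L2_bdd_subseq[OF bdd(2)]], assumption)
      fix r :: "nat \<Rightarrow> nat" and u v :: "'a \<Rightarrow> real"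
      assume 1: "strict_mono r" "u \<in> L2 \<Omega>" "v \<in> L2 \<Omega>"
        "L2_weakly_tendsto \<Omega> (\<lambda>n. U (t (r n))) u" "L2_weakly_tendsto \<Omega> (\<lambda>n. V (t (r n))) v"
        "(LINT x|M. u x) + (LINT x|M. v x) = 0"
      assume 2: "\<And>x. x \<in> \<Omega> \<Longrightarrow> limit_system J G X f0 u v x"
      have "AE x in M. limit_system J G X f0 u v x" using 2 by (intro AE_I2) simp
      with 1 show ?thesis by blast
    qed
  qed
  obtain r0 u v where uv: "u \<in> L2 \<Omega>" "v \<in> L2 \<Omega>" "(LINT x|M. u x) + (LINT x|M. v x) = 0"
    "AE x in M. limit_system J G X f0 u v x"
    using sub[of "\<lambda>n. n"] by (auto simp: strict_mono_def)
  have all: "\<exists>r :: nat \<Rightarrow> nat. strict_mono r \<and> L2_weakly_tendsto \<Omega> (\<lambda>n. U (t (r n))) u \<and> L2_weakly_tendsto \<Omega> (\<lambda>n. V (t (r n))) v"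
    if t: "strict_mono t" for t :: "nat \<Rightarrow> nat"
  proof -
    obtain r u' v' where 1: "strict_mono r" "u' \<in> L2 \<Omega>" "v' \<in> L2 \<Omega>"
      "L2_weakly_tendsto \<Omega> (\<lambda>n. U (t (r n))) u'" "L2_weakly_tendsto \<Omega> (\<lambda>n. V (t (r n))) v'"
      "(LINT x|M. u' x) + (LINT x|M. v' x) = 0" "AE x in M. limit_system J G X f0 u' v' x"
      using sub[OF t] by blast
    have "AE x in M. u' x = u x \<and> v' x = v x"
      by (rule limit_system_unique[OF J G con X 1(2,3) uv(1,2) 1(7) uv(4) 1(6) uv(3)])
    then have "AE x in M. u' x = u x" "AE x in M. v' x = v x" by auto
    then have "L2_weakly_tendsto \<Omega> (\<lambda>n. U (t (r n))) u" "L2_weakly_tendsto \<Omega> (\<lambda>n. V (t (r n))) v"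
      using L2_weakly_tendsto_cong_AE[OF 1(4) _ 1(2) uv(1)] L2_weakly_tendsto_cong_AE[OF 1(5) _ 1(3) uv(2)] by auto
    then show ?thesis using 1(1) by blast
  qed
  have "L2_weakly_tendsto \<Omega> U u" "L2_weakly_tendsto \<Omega> V v"
    by (rule L2_weakly_tendsto_subseqI; use all in blast)+
  then show ?thesis by (intro that[OF uv(1,2) _ _ uv(3,4)])
qed

end

lemma homogenized_system_iff:
  fixes \<Omega> :: "(real^'n) set"
  assumes reg: "bounded_region \<Omega>" and J: "interaction_kernel J" and G: "interaction_kernel G"
    and u: "u \<in> L2 \<Omega>" and v: "v \<in> L2 \<Omega>"
  shows "homogenized_system J G \<Omega> X f u v \<longleftrightarrow>
    (AE x in lebesgue_on \<Omega>. bounded_region.limit_system \<Omega> J G X f u v x)"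
proof -
  interpret bounded_region \<Omega> by fact
  have split: "(LINT y|M. K (x - y) * (\<alpha> * p y - \<beta>)) = \<alpha> * conv K p x - \<beta> * conv K (\<lambda>y. 1) x"
    if K: "interaction_kernel K" and p: "p \<in> L2 \<Omega>" for K p \<alpha> \<beta> x
  proof -
    have "(LINT y|M. K (x - y) * (\<alpha> * p y - \<beta>)) = (LINT y|M. \<alpha> * (K (x - y) * p y) - \<beta> * (K (x - y) * 1))"
      by (intro LINT_cong) (auto simp: algebra_simps)
    then show ?thesis
      using conv_integrable[OF K L2_integrable[OF p], of x] conv_integrable[OF K, of "\<lambda>y. 1" x]
      by (simp add: conv_def)
  qed
  show ?thesis
    unfolding homogenized_system_def limit_system_def split[OF J u] split[OF J v] split[OF G v]
    by (simp add: algebra_simps)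
qed

theorem theorem2p1:
  fixes \<Omega> T :: "(real^'n) set"
    and l :: "real^'n"
    and J G :: "real^'n \<Rightarrow> real"
    and X :: real
    and f :: "real^'n \<Rightarrow> real"
    and fn un vn :: "nat \<Rightarrow> real^'n \<Rightarrow> real"
    and A B :: "nat \<Rightarrow> (real^'n) set"
  assumes dim: "CARD('n) \<ge> 2"
    and dom: "smooth_bounded_domain \<Omega>"
    and J: "interaction_kernel J" and G: "interaction_kernel G"
    and J_supp: "\<exists>R>diameter \<Omega>. ball 0 R \<subseteq> supp J"
    and cell: "\<And>i. 0 < l $ i"
    and T: "open T" "T \<noteq> {}" "smooth_boundary T" "closure T \<subseteq> reference_cell l"
    and A_def: "\<And>n. A n = holes \<Omega> l T n"
    and B_def: "\<And>n. B n = \<Omega> - A n"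
    and X: "0 < X" "X < 1"
    and X_lim: "Linf_weakstar_tendsto \<Omega> (\<lambda>n. indicat_real (A n)) (\<lambda>x. X)"
    and fn_L2: "\<And>n. 0 < n \<Longrightarrow> A n \<noteq> {} \<Longrightarrow> fn n \<in> L2 \<Omega>"
    and fn_mean: "\<And>n. 0 < n \<Longrightarrow> A n \<noteq> {} \<Longrightarrow> (LINT x|lebesgue_on \<Omega>. fn n x) = 0"
    and f_L2: "f \<in> L2 \<Omega>"
    and fn_lim: "L2_tendsto \<Omega> fn f"
    and sol: "\<And>n. 0 < n \<Longrightarrow> A n \<noteq> {} \<Longrightarrow> weak_solution J G (A n) (B n) (fn n) (un n) (vn n)"
  shows "\<exists>u v. u \<in> L2 \<Omega> \<and> v \<in> L2 \<Omega> \<and>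
    L2_weakly_tendsto \<Omega> (\<lambda>n x. indicat_real (A n) x * un n x) u \<and>
    L2_weakly_tendsto \<Omega> (\<lambda>n x. indicat_real (B n) x * vn n x) v \<and>
    (LINT x|lebesgue_on \<Omega>. u x) + (LINT x|lebesgue_on \<Omega>. v x) = 0 \<and>
    homogenized_system J G \<Omega> X f u v \<and>
    (\<forall>u' v'. u' \<in> L2 \<Omega> \<longrightarrow> v' \<in> L2 \<Omega> \<longrightarrow>
       (LINT x|lebesgue_on \<Omega>. u' x) + (LINT x|lebesgue_on \<Omega>. v' x) = 0 \<longrightarrow>
       homogenized_system J G \<Omega> X f u' v' \<longrightarrow>
       (AE x in lebesgue_on \<Omega>. u' x = u x \<and> v' x = v x))"
proof -
  have reg: "bounded_region \<Omega>" and con: "connected \<Omega>"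
    using dom by (auto simp: smooth_bounded_domain_def bounded_region_def)
  interpret bounded_region \<Omega> by (rule reg)
  have Asub: "A n \<subseteq> \<Omega>" and Aleb: "A n \<in> sets lebesgue" for n
    using holes_subset[of \<Omega> l T n] holes_borel[OF T(4), of \<Omega> n] by (simp_all add: A_def)
  have AM: "A n \<in> sets M" for n using Asub Aleb by (simp add: subregion_sets_iff)

  \<comment> \<open>Since \<open>X > 0\<close>, the holes fill a positive volume for large \<open>n\<close>; shifting the index to those \<open>n\<close>
    makes every member of the sequence a weak solution.\<close>
  have "(\<lambda>n. LINT x|M. indicat_real (A n) x * 1) \<longlonglongrightarrow> X * (LINT x|M. 1)"
    by (rule weakstar_indicatorD[OF X_lim]) simp
  moreover have "0 < X * (LINT x|M. 1)"
    using open_not_negligible[OF region_open region_nonempty] X(1)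
    by (simp add: measure_restrict_space negligible_iff_measure zero_less_measure_iff)
  ultimately have "\<forall>\<^sub>F n in sequentially. 0 < (LINT x|M. indicat_real (A n) x * 1)"
    by (rule order_tendstoD(1))
  then obtain N where N: "\<And>n. N \<le> n \<Longrightarrow> A n \<noteq> {}"
    unfolding eventually_sequentially by fastforce
  define m where "m n = n + Suc N" for n
  have m: "0 < m n" "A (m n) \<noteq> {}" for n using N by (simp_all add: m_def)
  have msm: "strict_mono m" by (simp add: m_def strict_mono_def)

  define \<delta> where "\<delta> n = (\<Sum>i\<in>UNIV. l $ i) / real (m n)" for n
  have \<delta>: "\<delta> \<longlonglongrightarrow> 0"
    using LIMSEQ_subseq_LIMSEQ[OF lim_const_over_n msm, of "\<Sum>i\<in>UNIV. l $ i"] by (simp add: \<delta>_def[abs_def] o_def)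
  have close: "norm (cell_corner l (m n) x - x) \<le> \<delta> n" for n x
    unfolding \<delta>_def by (rule cell_corner_close[OF cell m(1)])
  define U V where "U n x = indicat_real (A (m n)) x * un (m n) x"
    and "V n x = indicat_real (B (m n)) x * vn (m n) x" for n x
  have hs: "hole_solution J G (cell_corner l (m n)) (A (m n)) (B (m n)) (fn (m n)) (U n) (V n)" for n
  proof -
    have neg: "negligible (A (m n) - interior (A (m n)))"
      unfolding A_def by (rule negligible_holes_diff_interior[OF T(1,3,4) m(1)])
    have UV: "U n = (\<lambda>x. indicat_real (A (m n)) x * un (m n) x)"
      "V n = (\<lambda>x. indicat_real (B (m n)) x * vn (m n) x)" by (simp_all add: U_def[abs_def] V_def[abs_def])
    note facts = weak_solution_nonlocal_identities[OF reg J G Aleb Asub neg B_def fn_L2[OF m] fn_mean[OF m] sol[OF m] UV]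
    have test: "nonlocal_form J G (A (m n)) (B (m n)) (U n) (V n)
        (\<lambda>x. indicat_real (A (m n)) x * \<psi> (cell_corner l (m n) x)) (\<lambda>x. indicat_real (B (m n)) x * \<theta> x)
      = - (LINT x|M. fn (m n) x * (indicat_real (A (m n)) x * \<psi> (cell_corner l (m n) x)))
        - (LINT x|M. fn (m n) x * (indicat_real (B (m n)) x * \<theta> x))"
      if \<psi>: "continuous_on UNIV \<psi>" and \<theta>: "continuous_on UNIV \<theta>" for \<psi> \<theta>
    proof (rule facts(5))
      show "(\<lambda>x. \<psi> (cell_corner l (m n) x)) \<in> L2 \<Omega>"
        by (rule L2_comp_near_id[OF \<psi> cell_corner_measurable close])
      show "\<theta> \<in> L2 \<Omega>" by (rule L2_continuous[OF \<theta>])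
      fix x assume "x \<in> A (m n)"
      then have "\<forall>\<^sub>F y in nhds x. cell_corner l (m n) y = cell_corner l (m n) x"
        unfolding A_def by (rule cell_corner_locally_constant[OF cell m(1) T(4)])
      then show "\<forall>\<^sub>F y in nhds x. \<psi> (cell_corner l (m n) y) = \<psi> (cell_corner l (m n) x)"
        by eventually_elim simp
    qed
    have zero: "x \<notin> A (m n) \<Longrightarrow> U n x = 0" "x \<notin> B (m n) \<Longrightarrow> V n x = 0" for x
      by (simp_all add: U_def V_def)
    show ?thesis
      unfolding hole_solution_def
      by (intro conjI allI impI AM B_def fn_L2[OF m] facts(1-4) test zero)
  qed

  have fnull: "L2_null (\<lambda>n x. fn (m n) x - f x)"
  proof -
    have "(\<lambda>n. sqrt (LINT x|M. (fn (m n) x - f x)\<^sup>2)) \<longlonglongrightarrow> 0"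
      using LIMSEQ_subseq_LIMSEQ[OF fn_lim[unfolded L2_tendsto_def] msm] by (simp add: o_def)
    then have "(\<lambda>n. (sqrt (LINT x|M. (fn (m n) x - f x)\<^sup>2))\<^sup>2) \<longlonglongrightarrow> 0\<^sup>2" by (intro tendsto_intros)
    then show ?thesis using fn_L2[OF m] f_L2 by (simp add: L2_null_def L2_diff)
  qed
  obtain u v where uv: "u \<in> L2 \<Omega>" "v \<in> L2 \<Omega>" and w: "L2_weakly_tendsto \<Omega> U u" "L2_weakly_tendsto \<Omega> V v"
    and mean: "(LINT x|M. u x) + (LINT x|M. v x) = 0" and sys: "AE x in M. limit_system J G X f u v x"
    by (rule hole_solutions_converge[OF J G con X weakstar_subseq[OF X_lim msm] cell_corner_measurable close \<delta> hs fnull f_L2])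
      blast
  have unshift: "L2_weakly_tendsto \<Omega> W w" if "L2_weakly_tendsto \<Omega> (\<lambda>n. W (m n)) w" for W w
    using that LIMSEQ_offset[of "\<lambda>n. LINT x|M. W n x * _ x" "Suc N"]
    unfolding L2_weakly_tendsto_def m_def by blast
  have "L2_weakly_tendsto \<Omega> (\<lambda>n x. indicat_real (A n) x * un n x) u"
    by (rule unshift) (use w(1) in \<open>simp add: U_def[abs_def]\<close>)
  moreover have "L2_weakly_tendsto \<Omega> (\<lambda>n x. indicat_real (B n) x * vn n x) v"
    by (rule unshift) (use w(2) in \<open>simp add: V_def[abs_def]\<close>)
  moreover have "homogenized_system J G \<Omega> X f u v"
    using sys by (simp add: homogenized_system_iff[OF reg J G uv])
  moreover have "AE x in M. u' x = u x \<and> v' x = v x"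
    if "u' \<in> L2 \<Omega>" "v' \<in> L2 \<Omega>" "(LINT x|M. u' x) + (LINT x|M. v' x) = 0" "homogenized_system J G \<Omega> X f u' v'" for u' v'
    using that limit_system_unique[OF J G con X that(1,2) uv _ sys that(3) mean]
    by (simp add: homogenized_system_iff[OF reg J G that(1,2)])
  ultimately show ?thesis using uv mean by blast
qed



end
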